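(* Let $(x,u)$ be an optimal solution of the optimal control problem (OCP) on $[0,T]$ with adjoint state $\lambda$, let $0=t_0<t_1<\dots<t_M=T$ be a time grid, and suppose that Assumption (S), stated in the context, holds. Let $0<\tau\le T$ and consider $$I^\tau(x,u):=\int_0^\tau\bar J(t,x,u)\,dt.$$ Let $(v_k,q_k,z_k)\in W^M([0,T])\times L_2(0,T;U)\times W^M([0,T])$ (the discrete-time secondary variables) solve $$\begin{pmatrix} L_{xx}(x,u)&0&\Lambda^{k,-}\\ 0&J_{uu}(x,u)&-B^*\\ \Lambda^k&-B&0\end{pmatrix}\begin{pmatrix} v_k\\ q_k\\ z_k\end{pmatrix}=-\begin{pmatrix} I^\tau_x(x,u)\\ I^\tau_u(x,u)\\ 0\end{pmatrix}.$$ Let $$M^k:=\begin{pmatrix} L_{xx}(x,u)&\Lambda^{k,-}\\ \Lambda^k&-BJ_{uu}(x,u)^{-1}B^*\end{pmatrix}.$$ Then for all $\mu>0$ satisfying $$\mu<\frac{1}{\|(M^k)^{-1}\|_{L((L_2(0,T;V^* )\times H)^2,\,W^M([0,T])^2)}}$$ there is a constant $c(\tau)>0$ independent of $T$ such that $$\left\|e^{\mu t}\begin{pmatrix} v_k\\ q_k\\ z_k\end{pmatrix}\right\|_{W^M([0,T])\times L_2(0,T;U)\times W^M([0,T])}\le c(\tau)\big(\|J_x(x,u)\|_{L_2(0,\tau;V^* )}+\|J_u(x,u)\|_{L_2(0,\tau;U)}\big).$$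
   Context: **Spaces.** $(V,\|\cdot\|_V)$ is a separable Banach space, $(H,\langle\cdot,\cdot\rangle)$ is a Hilbert space with norm $\|\cdot\|$, and $V\hookrightarrow H\cong H^*\hookrightarrow V^*$ is a Gelfand triple (continuous and dense embeddings). $U$ is a Hilbert space. For an interval $[a,b]$, $W([a,b]):=\{v:[a,b]\to V \mid v\in L_2(a,b;V),\ \dot v\in L_2(a,b;V^* )\}$ with its usual norm, where $\dot v$ is the weak time derivative; $W([a,b])\hookrightarrow C(a,b;H)$. **Problem (OCP).** For $T>0$, minimize $J(x,u):=\int_0^T\bar J(t,x(t),u(t))\,dt$ subject to $\dot x(t)=\bar A(x(t))+\bar Bu(t)+f(t)$ for a.e. $t\in[0,T]$, $x(0)=x_0$, where $x_0\in H$, $f\in L_2(0,T;V^* )$. For a.e. $t$, $\bar J(t,\cdot,\cdot)$ is twice continuously Fréchet differentiable on $V\times U$; $J$ is twice continuously Fréchet differentiable on $L_2(0,T;V)\times L_2(0,T;U)$; $J_{xu}=J_{ux}=0$; $\bar B:U\to V^*$ is linear and continuous; $\bar A:V\to V^*$ is twice continuously Fréchet differentiable. $A$ and $B$ are the induced operators $\langle A(x),\lambda\rangle_{L_2(0,T;V^* )\times L_2(0,T;V)}=\int_0^T\langle\bar A(x),\lambda\rangle_{V^*\times V}\,dt$ and $\langle Bu,\lambda\rangle_{L_2(0,T;V^* )\times L_2(0,T;V)}=\int_0^T\langle\bar Bu,\lambda\rangle_{V^*\times V}\,dt$. The problem is assumed to have a solution with $x\in W([0,T])$; the adjoint state $\lambda\in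 W([0,T])$ satisfies $J_x(x,u)-\dot\lambda-A'(x)^*\lambda=0$, $\lambda(T)=0$, $J_u(x,u)-B^*\lambda=0$. $L_{xx}(x,u):=J_{xx}(x,u)-A''(x)^*\lambda$ is the second derivative of the Lagrange function with respect to the state. Subscripts $x,u$ denote partial derivatives; $\|J_x(x,u)\|_{L_2(0,\tau;V^* )}$ and $\|J_u(x,u)\|_{L_2(0,\tau;U)}$ are the norms of the restrictions to $(0,\tau)$. **Assumption (S)** (where $(x,u)$ is an optimal solution of (OCP)). - There is a Banach space $(Y,\|\cdot\|_Y)$ and an operator $C\in L(L_2(0,T;V),L_2(0,T;Y))$ such that $L_{xx}(x,u)=C^*C$. - There is an operator $R\in L(L_2(0,T;U),L_2(0,T;U))$ satisfying the coercivity condition $\|Ru\|_{L_2(0,T;U)}\ge\alpha\|u\|_{L_2(0,T;U)}$ for $\alpha>0$ such that $J_{uu}(x,u)=R^*R$. - $A'(x)\in L(L_2(0,T;V),L_2(0,T;V^* ))$. - $(A'(x),C)$ is exponentially detectable in the sense that there are $K_C\in L(L_2(0,T;Y),L_2(0,T;V^* ))$ and $\alpha>0$ such that $-\langle(A'(x)+K_CC)v,v\rangle_{L_2(0,T;V^* )\times L_2(0,T;V)}\ge\alpha\|v\|^2_{L_2(0,T;V)}$ for all $v\in L_2(0,T;V)$. - $(A'(x),B)$ is exponentially stabilizable in the sense that there are $K_B\in L(L_2(0,T;V),L_2(0,T;U))$ and $\alpha>0$ such that $-\langle(A'(x)+BK_B)v,v\rangle_{L_2(0,T;V^* )\times L_2(0,T;V)}\ge\alpha\|v\|^2_{L_2(0,T;V)}$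 for all $v\in L_2(0,T;V)$. - $\|A'(x)\|_{L(L_2(0,T;V),L_2(0,T;V^* ))}$, $\|B\|_{L(L_2(0,T;U),L_2(0,T;V^* ))}$, $\|C\|_{L(L_2(0,T;V),L_2(0,T;Y))}$ and $\|R\|_{L(L_2(0,T;U))}$ can be bounded independently of $T$. **Discrete-time objects.** $I_m=(t_{m-1},t_m]$, $m=1,\dots,M$, and $\langle v,w\rangle_{I_m}:=\int_{I_m}\langle v(t),w(t)\rangle_{V^*\times V}\,dt$. Define $$W^M([0,T]):=\{v\in L_2(0,T;V)\mid v|_{I_m}\in W([t_{m-1},t_m]),\ m=1,\dots,M,\ v(0)\in H\}.$$ Write $v_m^{+}$, $v_m^-$ for the right and left limits of $v$ at $t_m$ (with $v_0^-:=v(0)$), and $[v]_m:=v_m^+-v_m^-$. The norm is $$\|v\|_{W^M([0,T])}=\sum_{m=1}^M\big(\|v\|_{W([t_{m-1},t_m])}+\|v_{m-1}^--v_{m-1}^+\|\big)+\|v(0)\|.$$ The linear operators $\Lambda^k,\Lambda^{k,-}:W^M([0,T])\to W^M([0,T])^*$ are given by $$\langle\Lambda^kv,\varphi\rangle:=\sum_{m=1}^M\big(\langle\dot v,\varphi\rangle_{I_m}+\langle[v]_{m-1},\varphi_{m-1}^+\rangle\big)-\langle A'(x)v,\varphi\rangle_{L_2(0,T;V^* )\times L_2(0,T;V)}+\langle v_0^-,\varphi_0^-\rangle,$$ $$\langle\Lambda^{k,-}v,\varphi\rangle:=-\sum_{m=1}^M\big(\langle\dot v,\varphi\rangle_{I_m}+\langle[v]_{m-1},\varphi_{m-1}^-\rangle\big)-\langle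 A'(x)^*v,\varphi\rangle_{L_2(0,T;V^* )\times L_2(0,T;V)}+\langle v_M^-,\varphi_M^-\rangle.$$ The initial and terminal conditions are included in $\Lambda^k$ and $\Lambda^{k,-}$ through the terms $\langle v_0^-,\varphi_0^-\rangle$ and $\langle v_M^-,\varphi_M^-\rangle$. Accordingly, $(M^k)^{-1}$ maps data $((l_1,z_T),(l_2,v_0))\in(L_2(0,T;V^* )\times H)^2$ to the solution $(v,z)\in W^M([0,T])^2$ of $M^k(v,z)=((l_1,z_T),(l_2,v_0))$, the data acting on test functions $\varphi$ as $\langle l_1,\varphi\rangle_{L_2(0,T;V^* )\times L_2(0,T;V)}+\langle z_T,\varphi_M^-\rangle$ in the first row and $\langle l_2,\varphi\rangle_{L_2(0,T;V^* )\times L_2(0,T;V)}+\langle v_0,\varphi_0^-\rangle$ in the second row.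
   Formalization: The norm of (M^k)^{-1} is replaced by a T-uniform bound N with μ < 1/N, and it is also required that μ times the norm of the embedding V→V* be below 1/N; this is automatic if that norm is at most 1, and without it the T-independent bound can fail. *)

theory Defs
  imports "HOL-Analysis.Analysis"
begin

text \<open>
  Elements of a Bochner space \<open>L\<^sub>2(a,b;E)\<close> are represented by functions \<open>real \<Rightarrow> 'e\<close>; values outside
  \<open>{a..b}\<close> and on null sets are irrelevant.  \<open>X\<^sup>*\<close> is \<open>'x \<Rightarrow>\<^sub>L real\<close>, and the duality pairing
  \<open>\<langle>g, v\<rangle>\<close> of \<open>g :: 'x \<Rightarrow>\<^sub>L real\<close> with \<open>v\<close> is \<open>blinfun_apply g v\<close>.
  Finite products of normed spaces carry the sum norm, except that \<open>L\<^sub>2(0,T;V) \<times> L\<^sub>2(0,T;U)\<close> is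
  identified with \<open>L\<^sub>2(0,T;V \<times> U)\<close>, which gives an equivalent norm and hence the same derivatives.
\<close>

text \<open>The second condition makes \<open>f\<close> strongly measurable also when \<open>'e\<close> is not separable.\<close>

definition L2 :: "real \<Rightarrow> real \<Rightarrow> (real \<Rightarrow> 'e::real_normed_vector) set" where
  "L2 a b = {f. f \<in> borel_measurable (lebesgue_on {a..b})
     \<and> (\<exists>D. countable D \<and> (AE s in lebesgue_on {a..b}. f s \<in> closure D))
     \<and> integrable (lebesgue_on {a..b}) (\<lambda>s. (norm (f s))\<^sup>2)}"

definition L2norm :: "real \<Rightarrow> real \<Rightarrow> (real \<Rightarrow> 'e::real_normed_vector) \<Rightarrow> real" where
  "L2norm a b f = sqrt (LINT s|lebesgue_on {a..b}. (norm (f s))\<^sup>2)"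

text \<open>\<open>G \<in> L(L\<^sub>2(a,b;E), L\<^sub>2(a,b;F))\<close> with operator norm at most \<open>K\<close>.\<close>

definition L2_operator ::
  "real \<Rightarrow> real \<Rightarrow> real \<Rightarrow> ((real \<Rightarrow> 'e::real_normed_vector) \<Rightarrow> real \<Rightarrow> 'f::real_normed_vector) \<Rightarrow> bool" where
  "L2_operator a b K G \<longleftrightarrow>
     (\<forall>f\<in>L2 a b. G f \<in> L2 a b) \<and>
     (\<forall>f\<in>L2 a b. \<forall>g\<in>L2 a b.
        AE s in lebesgue_on {a..b}. G (\<lambda>r. f r + g r) s = G f s + G g s) \<and>
     (\<forall>f\<in>L2 a b. \<forall>c::real.
        AE s in lebesgue_on {a..b}. G (\<lambda>r. c *\<^sub>R f r) s = c *\<^sub>R G f s) \<and>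
     (\<forall>f\<in>L2 a b. L2norm a b (G f) \<le> K * L2norm a b f)"

definition L2_functional :: "real \<Rightarrow> real \<Rightarrow> ((real \<Rightarrow> 'e::real_normed_vector) \<Rightarrow> real) \<Rightarrow> bool" where
  "L2_functional a b l \<longleftrightarrow>
     (\<forall>f\<in>L2 a b. \<forall>g\<in>L2 a b. l (\<lambda>r. f r + g r) = l f + l g) \<and>
     (\<forall>f\<in>L2 a b. \<forall>c::real. l (\<lambda>r. c *\<^sub>R f r) = c * l f) \<and>
     (\<exists>K. \<forall>f\<in>L2 a b. \<bar>l f\<bar> \<le> K * L2norm a b f)"

definition L2_bilinear_form ::
  "real \<Rightarrow> real \<Rightarrow> ((real \<Rightarrow> 'e::real_normed_vector) \<Rightarrow> (real \<Rightarrow> 'e) \<Rightarrow> real) \<Rightarrow> bool" where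
  "L2_bilinear_form a b B \<longleftrightarrow>
     (\<forall>f\<in>L2 a b. L2_functional a b (B f)) \<and>
     (\<forall>g\<in>L2 a b. L2_functional a b (\<lambda>f. B f g)) \<and>
     (\<exists>K. \<forall>f\<in>L2 a b. \<forall>g\<in>L2 a b. \<bar>B f g\<bar> \<le> K * L2norm a b f * L2norm a b g)"

text \<open>Riesz representatives of functionals on \<open>L\<^sub>2(0,T;X)\<close> in \<open>L\<^sub>2(0,T;X\<^sup>*)\<close>, and in \<open>L\<^sub>2(0,T;U)\<close> for
  a Hilbert space \<open>U\<close>; they are unique up to null sets.\<close>

definition dual_repr ::
  "real \<Rightarrow> ((real \<Rightarrow> 'v::real_normed_vector) \<Rightarrow> real) \<Rightarrow> real \<Rightarrow> 'v \<Rightarrow>\<^sub>L real" where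
  "dual_repr T l = (SOME g. g \<in> L2 0 T \<and>
     (\<forall>v\<in>L2 0 T. l v = (LINT s|lebesgue_on {0..T}. blinfun_apply (g s) (v s))))"

definition hilbert_repr ::
  "real \<Rightarrow> ((real \<Rightarrow> 'u::real_inner) \<Rightarrow> real) \<Rightarrow> real \<Rightarrow> 'u" where
  "hilbert_repr T l = (SOME g. g \<in> L2 0 T \<and>
     (\<forall>p\<in>L2 0 T. l p = (LINT s|lebesgue_on {0..T}. inner (g s) (p s))))"

definition fderiv :: "('a::real_normed_vector \<Rightarrow> 'b::real_normed_vector) \<Rightarrow> 'a \<Rightarrow> 'a \<Rightarrow>\<^sub>L 'b" where
  "fderiv f y = Blinfun (frechet_derivative f (at y))"

definition C2_frechet :: "('a::real_normed_vector \<Rightarrow> 'b::real_normed_vector) \<Rightarrow> bool" where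
  "C2_frechet f \<longleftrightarrow> (\<forall>y. f differentiable (at y)) \<and> (\<forall>y. fderiv f differentiable (at y))
     \<and> continuous_on UNIV (fderiv (fderiv f))"

text \<open>The same notions for functionals \<open>F\<close> on \<open>L\<^sub>2(0,T;E)\<close>; the derivatives are unique as functionals
  and bilinear forms on \<open>L\<^sub>2(0,T;E)\<close>.\<close>

definition L2_has_derivative ::
  "real \<Rightarrow> ((real \<Rightarrow> 'e::real_normed_vector) \<Rightarrow> real) \<Rightarrow> (real \<Rightarrow> 'e) \<Rightarrow> ((real \<Rightarrow> 'e) \<Rightarrow> real) \<Rightarrow> bool" where
  "L2_has_derivative T F w D \<longleftrightarrow> L2_functional 0 T D \<and>
     (\<forall>\<epsilon>>0. \<exists>\<delta>>0. \<forall>h\<in>L2 0 T. L2norm 0 T h < \<delta> \<longrightarrow>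
        \<bar>F (\<lambda>s. w s + h s) - F w - D h\<bar> \<le> \<epsilon> * L2norm 0 T h)"

definition L2_deriv ::
  "real \<Rightarrow> ((real \<Rightarrow> 'e::real_normed_vector) \<Rightarrow> real) \<Rightarrow> (real \<Rightarrow> 'e) \<Rightarrow> (real \<Rightarrow> 'e) \<Rightarrow> real" where
  "L2_deriv T F w = (SOME D. L2_has_derivative T F w D)"

definition L2_has_derivative2 ::
  "real \<Rightarrow> ((real \<Rightarrow> 'e::real_normed_vector) \<Rightarrow> real) \<Rightarrow> (real \<Rightarrow> 'e)
     \<Rightarrow> ((real \<Rightarrow> 'e) \<Rightarrow> (real \<Rightarrow> 'e) \<Rightarrow> real) \<Rightarrow> bool" where
  "L2_has_derivative2 T F w B \<longleftrightarrow> L2_bilinear_form 0 T B \<and>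
     (\<forall>\<epsilon>>0. \<exists>\<delta>>0. \<forall>h\<in>L2 0 T. L2norm 0 T h < \<delta> \<longrightarrow> (\<forall>g\<in>L2 0 T.
        \<bar>L2_deriv T F (\<lambda>s. w s + h s) g - L2_deriv T F w g - B h g\<bar>
          \<le> \<epsilon> * L2norm 0 T h * L2norm 0 T g))"

definition L2_deriv2 ::
  "real \<Rightarrow> ((real \<Rightarrow> 'e::real_normed_vector) \<Rightarrow> real) \<Rightarrow> (real \<Rightarrow> 'e)
     \<Rightarrow> (real \<Rightarrow> 'e) \<Rightarrow> (real \<Rightarrow> 'e) \<Rightarrow> real" where
  "L2_deriv2 T F w = (SOME B. L2_has_derivative2 T F w B)"

definition L2_C2 :: "real \<Rightarrow> ((real \<Rightarrow> 'e::real_normed_vector) \<Rightarrow> real) \<Rightarrow> bool" where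
  "L2_C2 T F \<longleftrightarrow>
     (\<forall>w\<in>L2 0 T. \<exists>D. L2_has_derivative T F w D) \<and>
     (\<forall>w\<in>L2 0 T. \<exists>B. L2_has_derivative2 T F w B) \<and>
     (\<forall>w\<in>L2 0 T. \<forall>\<epsilon>>0. \<exists>\<delta>>0. \<forall>h\<in>L2 0 T. L2norm 0 T h < \<delta> \<longrightarrow>
        (\<forall>f\<in>L2 0 T. \<forall>g\<in>L2 0 T.
          \<bar>L2_deriv2 T F (\<lambda>s. w s + h s) f g - L2_deriv2 T F w f g\<bar>
            \<le> \<epsilon> * L2norm 0 T f * L2norm 0 T g))"

text \<open>\<open>j\<close> is the embedding of \<open>V\<close> into \<open>H\<close>, \<open>Hdual j\<close> the induced embedding of \<open>H \<cong> H\<^sup>*\<close> into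
  \<open>V\<^sup>*\<close>, and \<open>Vdual j\<close> the composition of the two.  Its norm is the constant of the embedding of
  \<open>V\<close> into \<open>V\<^sup>*\<close>, which scales the perturbation caused by an exponential weight:
  \<open>(e\<^sup>\<mu>\<^sup>tv)' = e\<^sup>\<mu>\<^sup>tv' + \<mu>e\<^sup>\<mu>\<^sup>tv\<close> has its last term in \<open>V \<hookrightarrow> V\<^sup>*\<close>.\<close>

definition Hdual :: "('v::real_normed_vector \<Rightarrow> 'h::real_inner) \<Rightarrow> 'h \<Rightarrow> 'v \<Rightarrow>\<^sub>L real" where
  "Hdual j h = Blinfun (\<lambda>v. inner h (j v))"

definition Vdual :: "('v::real_normed_vector \<Rightarrow> 'h::real_inner) \<Rightarrow> 'v \<Rightarrow>\<^sub>L ('v \<Rightarrow>\<^sub>L real)" where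
  "Vdual j = Blinfun (\<lambda>v. Hdual j (j v))"

definition gelfand_triple :: "('v::real_normed_vector \<Rightarrow> 'h::real_inner) \<Rightarrow> bool" where
  "gelfand_triple j \<longleftrightarrow> bounded_linear j \<and> inj j \<and> closure (range j) = UNIV
     \<and> closure (range (Hdual j)) = UNIV"

definition test_functions :: "real \<Rightarrow> real \<Rightarrow> (real \<Rightarrow> real) set" where
  "test_functions a b = {\<phi>. (\<forall>n s. (deriv ^^ n) \<phi> field_differentiable (at s))
     \<and> (\<exists>c d. a < c \<and> d < b \<and> (\<forall>s. s \<notin> {c..d} \<longrightarrow> \<phi> s = 0))}"

text \<open>The defining identity in \<open>V\<^sup>*\<close> is tested with every \<open>w \<in> V\<close>, and \<open>v(t) \<in> V\<close> acts on \<open>w\<close> through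
  the inner product of \<open>H\<close>.\<close>

definition is_weak_deriv ::
  "('v::real_normed_vector \<Rightarrow> 'h::real_inner) \<Rightarrow> real \<Rightarrow> real \<Rightarrow> (real \<Rightarrow> 'v)
     \<Rightarrow> (real \<Rightarrow> 'v \<Rightarrow>\<^sub>L real) \<Rightarrow> bool" where
  "is_weak_deriv j a b v g \<longleftrightarrow> (\<forall>\<phi>\<in>test_functions a b. \<forall>w.
     (LINT s|lebesgue_on {a..b}. \<phi> s * blinfun_apply (g s) w)
       = - (LINT s|lebesgue_on {a..b}. deriv \<phi> s * inner (j (v s)) (j w)))"

definition weak_deriv ::
  "('v::real_normed_vector \<Rightarrow> 'h::real_inner) \<Rightarrow> real \<Rightarrow> real \<Rightarrow> (real \<Rightarrow> 'v) \<Rightarrow> real \<Rightarrow> 'v \<Rightarrow>\<^sub>L real" where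
  "weak_deriv j a b v = (SOME g. g \<in> L2 a b \<and> is_weak_deriv j a b v g)"

definition W :: "('v::real_normed_vector \<Rightarrow> 'h::real_inner) \<Rightarrow> real \<Rightarrow> real \<Rightarrow> (real \<Rightarrow> 'v) set" where
  "W j a b = {v. v \<in> L2 a b \<and> (\<exists>g. g \<in> L2 a b \<and> is_weak_deriv j a b v g)}"

definition W_norm :: "('v::real_normed_vector \<Rightarrow> 'h::real_inner) \<Rightarrow> real \<Rightarrow> real \<Rightarrow> (real \<Rightarrow> 'v) \<Rightarrow> real" where
  "W_norm j a b v = sqrt ((L2norm a b v)\<^sup>2 + (L2norm a b (weak_deriv j a b v))\<^sup>2)"

text \<open>Value in \<open>H\<close> at \<open>s \<in> {a..b}\<close> of the continuous representative of \<open>v \<in> W([a,b])\<close>, which exists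
  by the embedding of \<open>W([a,b])\<close> into \<open>C(a,b;H)\<close>.  The value 0 is only a default for functions
  without a continuous representative.\<close>

definition H_repr ::
  "('v::real_normed_vector \<Rightarrow> 'h::real_inner) \<Rightarrow> real \<Rightarrow> real \<Rightarrow> (real \<Rightarrow> 'v) \<Rightarrow> (real \<Rightarrow> 'h) \<Rightarrow> bool" where
  "H_repr j a b v w \<longleftrightarrow> continuous_on {a..b} w \<and> (AE s in lebesgue_on {a..b}. w s = j (v s))"

definition H_value ::
  "('v::real_normed_vector \<Rightarrow> 'h::real_inner) \<Rightarrow> real \<Rightarrow> real \<Rightarrow> (real \<Rightarrow> 'v) \<Rightarrow> real \<Rightarrow> 'h" where
  "H_value j a b v s = (if \<exists>w. H_repr j a b v w then (SOME w. H_repr j a b v w) s else 0)"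

text \<open>Problem data without the horizon: \<open>cost\<close> and \<open>force\<close> are given on \<open>[0,\<infinity>)\<close>, so that the problems
  on \<open>[0,T]\<close> for different \<open>T\<close> form one family.\<close>

record (overloaded) ('v, 'h, 'u) ocp =
  emb :: "'v::{banach,second_countable_topology} \<Rightarrow> 'h::{real_inner,banach}"
  cost :: "real \<Rightarrow> 'v \<times> 'u::{real_inner,banach} \<Rightarrow> real"
  drift :: "'v \<Rightarrow> 'v \<Rightarrow>\<^sub>L real"
  ctrl :: "'u \<Rightarrow>\<^sub>L ('v \<Rightarrow>\<^sub>L real)"
  force :: "real \<Rightarrow> 'v \<Rightarrow>\<^sub>L real"
  init :: "'h"

text \<open>\<open>cost_functional P \<tau>\<close> is \<open>I\<^sup>\<tau>\<close>, and it is \<open>J\<close> for \<open>\<tau> = T\<close>.\<close>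

definition cost_functional ::
  "('v::{banach,second_countable_topology}, 'h::{real_inner,banach}, 'u::{real_inner,banach}) ocp
     \<Rightarrow> real \<Rightarrow> (real \<Rightarrow> 'v \<times> 'u) \<Rightarrow> real" where
  "cost_functional P \<tau> w = (LINT s|lebesgue_on {0..\<tau>}. cost P s (w s))"

definition pr :: "(real \<Rightarrow> 'v) \<Rightarrow> (real \<Rightarrow> 'u) \<Rightarrow> real \<Rightarrow> 'v \<times> 'u" where
  "pr x u = (\<lambda>s. (x s, u s))"

definition ocp_regular ::
  "('v::{banach,second_countable_topology}, 'h::{real_inner,banach}, 'u::{real_inner,banach}) ocp
     \<Rightarrow> real \<Rightarrow> bool" where
  "ocp_regular P T \<longleftrightarrow>
     force P \<in> L2 0 T \<and>
     (AE s in lebesgue_on {0..T}. C2_frechet (cost P s)) \<and>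
     (\<forall>w\<in>L2 0 T. integrable (lebesgue_on {0..T}) (\<lambda>s. cost P s (w s))) \<and>
     L2_C2 T (cost_functional P T) \<and>
     (\<forall>w\<in>L2 0 T. \<forall>v\<in>L2 0 T. \<forall>q\<in>L2 0 T.
        L2_deriv2 T (cost_functional P T) w (pr v (\<lambda>_. 0)) (pr (\<lambda>_. 0) q) = 0 \<and>
        L2_deriv2 T (cost_functional P T) w (pr (\<lambda>_. 0) q) (pr v (\<lambda>_. 0)) = 0)"

definition feasible ::
  "('v::{banach,second_countable_topology}, 'h::{real_inner,banach}, 'u::{real_inner,banach}) ocp
     \<Rightarrow> real \<Rightarrow> (real \<Rightarrow> 'v) \<Rightarrow> (real \<Rightarrow> 'u) \<Rightarrow> bool" where
  "feasible P T x u \<longleftrightarrow> x \<in> W (emb P) 0 T \<and> u \<in> L2 0 T \<and>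
     (AE s in lebesgue_on {0..T}.
        weak_deriv (emb P) 0 T x s = drift P (x s) + blinfun_apply (ctrl P) (u s) + force P s) \<and>
     H_value (emb P) 0 T x 0 = init P"

definition optimal ::
  "('v::{banach,second_countable_topology}, 'h::{real_inner,banach}, 'u::{real_inner,banach}) ocp
     \<Rightarrow> real \<Rightarrow> (real \<Rightarrow> 'v) \<Rightarrow> (real \<Rightarrow> 'u) \<Rightarrow> bool" where
  "optimal P T x u \<longleftrightarrow> feasible P T x u \<and>
     (\<forall>y p. feasible P T y p \<longrightarrow> cost_functional P T (pr x u) \<le> cost_functional P T (pr y p))"

text \<open>Partial derivatives of \<open>I\<^sup>\<tau>\<close> on \<open>L\<^sub>2(0,T;V) \<times> L\<^sub>2(0,T;U)\<close> (and of \<open>J\<close>, for \<open>\<tau> = T\<close>).\<close>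

definition I_x ::
  "('v::{banach,second_countable_topology}, 'h::{real_inner,banach}, 'u::{real_inner,banach}) ocp
     \<Rightarrow> real \<Rightarrow> real \<Rightarrow> (real \<Rightarrow> 'v) \<Rightarrow> (real \<Rightarrow> 'u) \<Rightarrow> (real \<Rightarrow> 'v) \<Rightarrow> real" where
  "I_x P T \<tau> x u v = L2_deriv T (cost_functional P \<tau>) (pr x u) (pr v (\<lambda>_. 0))"

definition I_u ::
  "('v::{banach,second_countable_topology}, 'h::{real_inner,banach}, 'u::{real_inner,banach}) ocp
     \<Rightarrow> real \<Rightarrow> real \<Rightarrow> (real \<Rightarrow> 'v) \<Rightarrow> (real \<Rightarrow> 'u) \<Rightarrow> (real \<Rightarrow> 'u) \<Rightarrow> real" where
  "I_u P T \<tau> x u q = L2_deriv T (cost_functional P \<tau>) (pr x u) (pr (\<lambda>_. 0) q)"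

definition J_xx ::
  "('v::{banach,second_countable_topology}, 'h::{real_inner,banach}, 'u::{real_inner,banach}) ocp
     \<Rightarrow> real \<Rightarrow> (real \<Rightarrow> 'v) \<Rightarrow> (real \<Rightarrow> 'u) \<Rightarrow> (real \<Rightarrow> 'v) \<Rightarrow> (real \<Rightarrow> 'v) \<Rightarrow> real" where
  "J_xx P T x u v w =
     L2_deriv2 T (cost_functional P T) (pr x u) (pr v (\<lambda>_. 0)) (pr w (\<lambda>_. 0))"

definition J_uu ::
  "('v::{banach,second_countable_topology}, 'h::{real_inner,banach}, 'u::{real_inner,banach}) ocp
     \<Rightarrow> real \<Rightarrow> (real \<Rightarrow> 'v) \<Rightarrow> (real \<Rightarrow> 'u) \<Rightarrow> (real \<Rightarrow> 'u) \<Rightarrow> (real \<Rightarrow> 'u) \<Rightarrow> real" where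
  "J_uu P T x u q p =
     L2_deriv2 T (cost_functional P T) (pr x u) (pr (\<lambda>_. 0) q) (pr (\<lambda>_. 0) p)"

text \<open>\<open>A'(x)\<close> and \<open>A''(x)\<close> are the operators induced pointwise by the derivatives of \<open>drift P\<close>
  at \<open>x(t)\<close>, not Frechet derivatives of the superposition operator on \<open>L\<^sub>2(0,T;V)\<close>.\<close>

definition A_lin ::
  "('v::{banach,second_countable_topology}, 'h::{real_inner,banach}, 'u::{real_inner,banach}) ocp
     \<Rightarrow> (real \<Rightarrow> 'v) \<Rightarrow> (real \<Rightarrow> 'v) \<Rightarrow> real \<Rightarrow> 'v \<Rightarrow>\<^sub>L real" where
  "A_lin P x v = (\<lambda>s. blinfun_apply (fderiv (drift P) (x s)) (v s))"

definition A_second ::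
  "('v::{banach,second_countable_topology}, 'h::{real_inner,banach}, 'u::{real_inner,banach}) ocp
     \<Rightarrow> (real \<Rightarrow> 'v) \<Rightarrow> (real \<Rightarrow> 'v) \<Rightarrow> (real \<Rightarrow> 'v) \<Rightarrow> real \<Rightarrow> 'v \<Rightarrow>\<^sub>L real" where
  "A_second P x v w =
     (\<lambda>s. blinfun_apply (blinfun_apply (fderiv (fderiv (drift P)) (x s)) (v s)) (w s))"

definition B_op ::
  "('v::{banach,second_countable_topology}, 'h::{real_inner,banach}, 'u::{real_inner,banach}) ocp
     \<Rightarrow> (real \<Rightarrow> 'u) \<Rightarrow> real \<Rightarrow> 'v \<Rightarrow>\<^sub>L real" where
  "B_op P q = (\<lambda>s. blinfun_apply (ctrl P) (q s))"

definition pairing :: "real \<Rightarrow> real \<Rightarrow> (real \<Rightarrow> 'v::real_normed_vector \<Rightarrow>\<^sub>L real) \<Rightarrow> (real \<Rightarrow> 'v) \<Rightarrow> real" where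
  "pairing a b g v = (LINT s|lebesgue_on {a..b}. blinfun_apply (g s) (v s))"

text \<open>\<open>B\<^sup>*z\<close> as a functional on \<open>L\<^sub>2(0,T;U)\<close>.\<close>

definition B_adj ::
  "('v::{banach,second_countable_topology}, 'h::{real_inner,banach}, 'u::{real_inner,banach}) ocp
     \<Rightarrow> real \<Rightarrow> (real \<Rightarrow> 'v) \<Rightarrow> (real \<Rightarrow> 'u) \<Rightarrow> real" where
  "B_adj P T z p = pairing 0 T (B_op P p) z"

definition adjoint_state ::
  "('v::{banach,second_countable_topology}, 'h::{real_inner,banach}, 'u::{real_inner,banach}) ocp
     \<Rightarrow> real \<Rightarrow> (real \<Rightarrow> 'v) \<Rightarrow> (real \<Rightarrow> 'u) \<Rightarrow> (real \<Rightarrow> 'v) \<Rightarrow> bool" where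
  "adjoint_state P T x u lam \<longleftrightarrow> lam \<in> W (emb P) 0 T \<and>
     (\<forall>v\<in>L2 0 T. I_x P T T x u v - pairing 0 T (weak_deriv (emb P) 0 T lam) v
        - pairing 0 T (A_lin P x v) lam = 0) \<and>
     H_value (emb P) 0 T lam T = 0 \<and>
     (\<forall>q\<in>L2 0 T. I_u P T T x u q - B_adj P T lam q = 0)"

definition L_xx ::
  "('v::{banach,second_countable_topology}, 'h::{real_inner,banach}, 'u::{real_inner,banach}) ocp
     \<Rightarrow> real \<Rightarrow> (real \<Rightarrow> 'v) \<Rightarrow> (real \<Rightarrow> 'u) \<Rightarrow> (real \<Rightarrow> 'v) \<Rightarrow> (real \<Rightarrow> 'v) \<Rightarrow> (real \<Rightarrow> 'v) \<Rightarrow> real" where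
  "L_xx P T x u lam v w = J_xx P T x u v w - pairing 0 T (A_second P x v w) lam"

definition J_uu_inv ::
  "('v::{banach,second_countable_topology}, 'h::{real_inner,banach}, 'u::{real_inner,banach}) ocp
     \<Rightarrow> real \<Rightarrow> (real \<Rightarrow> 'v) \<Rightarrow> (real \<Rightarrow> 'u) \<Rightarrow> ((real \<Rightarrow> 'u) \<Rightarrow> real) \<Rightarrow> real \<Rightarrow> 'u" where
  "J_uu_inv P T x u l = (SOME q. q \<in> L2 0 T \<and> (\<forall>p\<in>L2 0 T. J_uu P T x u q p = l p))"

text \<open>Assumption (S), with the bound \<open>K\<close> on the operator norms and the coercivity constant \<open>\<alpha>\<close>.
  The composition \<open>C\<^sup>*C\<close> needs an identification of \<open>Y\<close> with its dual; \<open>\<rho>\<close> is this isometric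
  identification (the Riesz map, if \<open>Y\<close> is given as a Hilbert space).  Integrability of the second
  derivative term says that \<open>L\<^sub>x\<^sub>x\<close> is well defined on \<open>L\<^sub>2(0,T;V)\<close>.\<close>

definition assumption_S ::
  "('v::{banach,second_countable_topology}, 'h::{real_inner,banach}, 'u::{real_inner,banach}) ocp
     \<Rightarrow> real \<Rightarrow> (real \<Rightarrow> 'v) \<Rightarrow> (real \<Rightarrow> 'u) \<Rightarrow> (real \<Rightarrow> 'v)
     \<Rightarrow> ((real \<Rightarrow> 'v) \<Rightarrow> real \<Rightarrow> 'y::banach) \<Rightarrow> ((real \<Rightarrow> 'u) \<Rightarrow> real \<Rightarrow> 'u) \<Rightarrow> real \<Rightarrow> real \<Rightarrow> bool" where
  "assumption_S P T x u lam C R K \<alpha> \<longleftrightarrow>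
     L2_operator 0 T K C \<and>
     (\<exists>\<rho> :: 'y \<Rightarrow>\<^sub>L ('y \<Rightarrow>\<^sub>L real).
        (\<forall>y. norm (blinfun_apply \<rho> y) = norm y \<and>
             blinfun_apply (blinfun_apply \<rho> y) y = (norm y)\<^sup>2) \<and>
        (\<forall>v\<in>L2 0 T. \<forall>w\<in>L2 0 T.
           integrable (lebesgue_on {0..T}) (\<lambda>s. blinfun_apply (A_second P x v w s) (lam s)) \<and>
           L_xx P T x u lam v w = pairing 0 T (\<lambda>s. blinfun_apply \<rho> (C v s)) (C w))) \<and>
     L2_operator 0 T K R \<and>
     (\<forall>q\<in>L2 0 T. L2norm 0 T (R q) \<ge> \<alpha> * L2norm 0 T q) \<and>
     (\<forall>q\<in>L2 0 T. \<forall>p\<in>L2 0 T.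
        J_uu P T x u q p = (LINT s|lebesgue_on {0..T}. inner (R q s) (R p s))) \<and>
     L2_operator 0 T K (A_lin P x) \<and>
     L2_operator 0 T K (B_op P) \<and>
     (\<exists>K_C :: (real \<Rightarrow> 'y) \<Rightarrow> real \<Rightarrow> 'v \<Rightarrow>\<^sub>L real. (\<exists>k. L2_operator 0 T k K_C) \<and>
        (\<forall>v\<in>L2 0 T. - pairing 0 T (\<lambda>s. A_lin P x v s + K_C (C v) s) v \<ge> \<alpha> * (L2norm 0 T v)\<^sup>2)) \<and>
     (\<exists>K_B :: (real \<Rightarrow> 'v) \<Rightarrow> real \<Rightarrow> 'u. (\<exists>k. L2_operator 0 T k K_B) \<and>
        (\<forall>v\<in>L2 0 T. - pairing 0 T (\<lambda>s. A_lin P x v s + B_op P (K_B v) s) v \<ge> \<alpha> * (L2norm 0 T v)\<^sup>2))"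

definition time_grid :: "(nat \<Rightarrow> real) \<Rightarrow> nat \<Rightarrow> real \<Rightarrow> bool" where
  "time_grid t M T \<longleftrightarrow> t 0 = 0 \<and> t M = T \<and> (\<forall>m<M. t m < t (Suc m))"

text \<open>An element \<open>v \<in> W\<^sup>M([0,T])\<close> is a pair: its class in \<open>L\<^sub>2(0,T;V)\<close>, and the value \<open>v(0) \<in> H\<close>,
  which is independent of the class since \<open>t\<^sub>0 \<notin> I\<^sub>1\<close>.\<close>

definition WM ::
  "('v::real_normed_vector \<Rightarrow> 'h::real_inner) \<Rightarrow> (nat \<Rightarrow> real) \<Rightarrow> nat \<Rightarrow> ((real \<Rightarrow> 'v) \<times> 'h) set" where
  "WM j t M = {v. fst v \<in> L2 0 (t M) \<and> (\<forall>m\<in>{1..M}. fst v \<in> W j (t (m - 1)) (t m))}"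

definition right_lim ::
  "('v::real_normed_vector \<Rightarrow> 'h::real_inner) \<Rightarrow> (nat \<Rightarrow> real) \<Rightarrow> (real \<Rightarrow> 'v) \<times> 'h \<Rightarrow> nat \<Rightarrow> 'h" where
  "right_lim j t v m = H_value j (t m) (t (m + 1)) (fst v) (t m)"

definition left_lim ::
  "('v::real_normed_vector \<Rightarrow> 'h::real_inner) \<Rightarrow> (nat \<Rightarrow> real) \<Rightarrow> (real \<Rightarrow> 'v) \<times> 'h \<Rightarrow> nat \<Rightarrow> 'h" where
  "left_lim j t v m = (if m = 0 then snd v else H_value j (t (m - 1)) (t m) (fst v) (t m))"

definition jump ::
  "('v::real_normed_vector \<Rightarrow> 'h::real_inner) \<Rightarrow> (nat \<Rightarrow> real) \<Rightarrow> (real \<Rightarrow> 'v) \<times> 'h \<Rightarrow> nat \<Rightarrow> 'h" where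
  "jump j t v m = right_lim j t v m - left_lim j t v m"

definition WM_norm ::
  "('v::real_normed_vector \<Rightarrow> 'h::real_inner) \<Rightarrow> (nat \<Rightarrow> real) \<Rightarrow> nat \<Rightarrow> (real \<Rightarrow> 'v) \<times> 'h \<Rightarrow> real" where
  "WM_norm j t M v = (\<Sum>m=1..M. W_norm j (t (m - 1)) (t m) (fst v)
      + norm (left_lim j t v (m - 1) - right_lim j t v (m - 1))) + norm (snd v)"

definition Lam ::
  "('v::{banach,second_countable_topology}, 'h::{real_inner,banach}, 'u::{real_inner,banach}) ocp
     \<Rightarrow> (real \<Rightarrow> 'v) \<Rightarrow> (nat \<Rightarrow> real) \<Rightarrow> nat \<Rightarrow> (real \<Rightarrow> 'v) \<times> 'h \<Rightarrow> (real \<Rightarrow> 'v) \<times> 'h \<Rightarrow> real" where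
  "Lam P x t M v \<phi> =
     (\<Sum>m=1..M. pairing (t (m - 1)) (t m) (weak_deriv (emb P) (t (m - 1)) (t m) (fst v)) (fst \<phi>)
        + inner (jump (emb P) t v (m - 1)) (right_lim (emb P) t \<phi> (m - 1)))
     - pairing 0 (t M) (A_lin P x (fst v)) (fst \<phi>)
     + inner (left_lim (emb P) t v 0) (left_lim (emb P) t \<phi> 0)"

definition Lam_minus ::
  "('v::{banach,second_countable_topology}, 'h::{real_inner,banach}, 'u::{real_inner,banach}) ocp
     \<Rightarrow> (real \<Rightarrow> 'v) \<Rightarrow> (nat \<Rightarrow> real) \<Rightarrow> nat \<Rightarrow> (real \<Rightarrow> 'v) \<times> 'h \<Rightarrow> (real \<Rightarrow> 'v) \<times> 'h \<Rightarrow> real" where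
  "Lam_minus P x t M v \<phi> =
     - (\<Sum>m=1..M. pairing (t (m - 1)) (t m) (weak_deriv (emb P) (t (m - 1)) (t m) (fst v)) (fst \<phi>)
        + inner (jump (emb P) t v (m - 1)) (left_lim (emb P) t \<phi> (m - 1)))
     - pairing 0 (t M) (A_lin P x (fst \<phi>)) (fst v)
     + inner (left_lim (emb P) t v M) (left_lim (emb P) t \<phi> M)"

text \<open>\<open>(v, q, z)\<close> solves the discrete-time system for the secondary variables.  The rows are equations
  in \<open>W\<^sup>M([0,T])\<^sup>*\<close>, in \<open>L\<^sub>2(0,T;U)\<close>, and in \<open>W\<^sup>M([0,T])\<^sup>*\<close>.\<close>

definition secondary_solution ::
  "('v::{banach,second_countable_topology}, 'h::{real_inner,banach}, 'u::{real_inner,banach}) ocp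
     \<Rightarrow> real \<Rightarrow> real \<Rightarrow> (real \<Rightarrow> 'v) \<Rightarrow> (real \<Rightarrow> 'u) \<Rightarrow> (real \<Rightarrow> 'v) \<Rightarrow> (nat \<Rightarrow> real) \<Rightarrow> nat
     \<Rightarrow> (real \<Rightarrow> 'v) \<times> 'h \<Rightarrow> (real \<Rightarrow> 'u) \<Rightarrow> (real \<Rightarrow> 'v) \<times> 'h \<Rightarrow> bool" where
  "secondary_solution P T \<tau> x u lam t M v q z \<longleftrightarrow>
     v \<in> WM (emb P) t M \<and> q \<in> L2 0 T \<and> z \<in> WM (emb P) t M \<and>
     (\<forall>\<phi>\<in>WM (emb P) t M.
        L_xx P T x u lam (fst v) (fst \<phi>) + Lam_minus P x t M z \<phi> = - I_x P T \<tau> x u (fst \<phi>)) \<and>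
     (\<forall>p\<in>L2 0 T. J_uu P T x u q p - B_adj P T (fst z) p = - I_u P T \<tau> x u p) \<and>
     (\<forall>\<phi>\<in>WM (emb P) t M. Lam P x t M v \<phi> - pairing 0 T (B_op P q) (fst \<phi>) = 0)"

text \<open>\<open>M\<^sup>k(v, z) = ((l\<^sub>1, z\<^sub>T), (l\<^sub>2, v\<^sub>0))\<close>\<close>

definition Mk_eq ::
  "('v::{banach,second_countable_topology}, 'h::{real_inner,banach}, 'u::{real_inner,banach}) ocp
     \<Rightarrow> real \<Rightarrow> (real \<Rightarrow> 'v) \<Rightarrow> (real \<Rightarrow> 'u) \<Rightarrow> (real \<Rightarrow> 'v) \<Rightarrow> (nat \<Rightarrow> real) \<Rightarrow> nat
     \<Rightarrow> (real \<Rightarrow> 'v) \<times> 'h \<Rightarrow> (real \<Rightarrow> 'v) \<times> 'h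
     \<Rightarrow> (real \<Rightarrow> 'v \<Rightarrow>\<^sub>L real) \<Rightarrow> 'h \<Rightarrow> (real \<Rightarrow> 'v \<Rightarrow>\<^sub>L real) \<Rightarrow> 'h \<Rightarrow> bool" where
  "Mk_eq P T x u lam t M v z l1 zT l2 v0 \<longleftrightarrow>
     (\<forall>\<phi>\<in>WM (emb P) t M.
        L_xx P T x u lam (fst v) (fst \<phi>) + Lam_minus P x t M z \<phi>
          = pairing 0 T l1 (fst \<phi>) + inner zT (left_lim (emb P) t \<phi> M)) \<and>
     (\<forall>\<phi>\<in>WM (emb P) t M.
        Lam P x t M v \<phi> - pairing 0 T (B_op P (J_uu_inv P T x u (B_adj P T (fst z)))) (fst \<phi>)
          = pairing 0 T l2 (fst \<phi>) + inner v0 (left_lim (emb P) t \<phi> 0))"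

text \<open>Operator norm of \<open>(M\<^sup>k)\<^sup>-\<^sup>1\<close>.  In \<^typ>\<open>ennreal\<close>, \<open>c / 0 = \<infinity>\<close> for \<open>c > 0\<close>, so the value is
  infinite if \<open>M\<^sup>k\<close> has a nontrivial kernel.\<close>

definition Mk_inv_norm ::
  "('v::{banach,second_countable_topology}, 'h::{real_inner,banach}, 'u::{real_inner,banach}) ocp
     \<Rightarrow> real \<Rightarrow> (real \<Rightarrow> 'v) \<Rightarrow> (real \<Rightarrow> 'u) \<Rightarrow> (real \<Rightarrow> 'v) \<Rightarrow> (nat \<Rightarrow> real) \<Rightarrow> nat \<Rightarrow> ennreal" where
  "Mk_inv_norm P T x u lam t M =
     (SUP (v, z, l1, zT, l2, v0) \<in> {(v, z, l1, zT, l2, v0).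
          v \<in> WM (emb P) t M \<and> z \<in> WM (emb P) t M \<and> l1 \<in> L2 0 T \<and> l2 \<in> L2 0 T \<and>
          Mk_eq P T x u lam t M v z l1 zT l2 v0}.
        ennreal (WM_norm (emb P) t M v + WM_norm (emb P) t M z)
          / ennreal ((L2norm 0 T l1 + norm zT) + (L2norm 0 T l2 + norm v0)))"

definition exp_weight :: "real \<Rightarrow> (real \<Rightarrow> 'e::real_vector) \<Rightarrow> real \<Rightarrow> 'e" where
  "exp_weight \<mu> f = (\<lambda>s. exp (\<mu> * s) *\<^sub>R f s)"

definition exp_weight_WM ::
  "real \<Rightarrow> (real \<Rightarrow> 'v::real_vector) \<times> 'h \<Rightarrow> (real \<Rightarrow> 'v) \<times> 'h" where
  "exp_weight_WM \<mu> v = (exp_weight \<mu> (fst v), snd v)"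

end

theory Submission
  imports Defs
begin

text \<open>All operators in the system for the secondary variables, except the time derivative, act pointwise
in time.  Multiplying the solution by \<open>e\<^sup>\<mu>\<^sup>t\<close> therefore gives a solution
of the same system with two changes.  The right-hand side, which lives on \<open>(0,\<tau>)\<close>, is multiplied by
\<open>e\<^sup>\<mu>\<^sup>t \<le> e\<^sup>\<mu>\<^sup>\<tau>\<close>, so it stays bounded independently of \<open>T\<close>; and the product rule
\<open>(e\<^sup>\<mu>\<^sup>t v)' = e\<^sup>\<mu>\<^sup>t v' + \<mu> e\<^sup>\<mu>\<^sup>t v\<close> adds the perturbations \<open>\<plusminus> \<mu> e\<^sup>\<mu>\<^sup>t v\<close>, \<open>\<plusminus> \<mu> e\<^sup>\<mu>\<^sup>t z\<close> in \<open>V\<^sup>*\<close>.  Eliminating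
the control by \<open>J\<^sub>u\<^sub>u\<^sup>-\<^sup>1\<close> leaves an equation \<open>M\<^sup>k (e\<^sup>\<mu>\<^sup>t v, e\<^sup>\<mu>\<^sup>t z) = (l\<^sub>1, l\<^sub>2)\<close>, in which \<open>l\<^sub>1, l\<^sub>2\<close> contain
the weighted data and the two perturbations.  Applying \<open>(M\<^sup>k)\<^sup>-\<^sup>1\<close> and absorbing the perturbations,
whose total factor \<open>N \<mu> \<parallel>V \<hookrightarrow> V\<^sup>*\<parallel>\<close> is below 1, yields the estimate
(\<open>weighted_secondary_variables_bound\<close>).

Several facts make this rigorous.
\<^item> \<open>L\<^sub>x\<^sub>x\<close> and \<open>J\<^sub>u\<^sub>u\<close> do act pointwise in time, although they are only given as second derivatives on
  \<open>L\<^sub>2\<close>.  Since \<open>J\<close> is an integral over time, perturbations with disjoint supports do not interact, so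
  the second derivative vanishes on them (\<open>L2_deriv2_disjoint\<close>); a bounded form with this property
  commutes with multiplication by step functions, hence by bounded weights
  (\<open>local_form_commutes_weight\<close>).  The same principle identifies the derivative of \<open>I\<^sup>\<tau>\<close> as the
  derivative of \<open>J\<close> cut off at \<open>\<tau>\<close> (\<open>cost_deriv_truncate\<close>).
\<^item> The product rule requires that weak derivatives are unique, which is the fundamental lemma of the
  calculus of variations (\<open>fundamental_lemma\<close>, \<open>weak_deriv_unique\<close>).  The one-sided limits at the grid
  points scale as well, because continuous representatives are unique (\<open>H_value_exp_weight\<close>).
\<^item> The data enter through representatives of \<open>J\<^sub>x\<close> and \<open>J\<^sub>u\<close>.  A representative of \<open>J\<^sub>x\<close> in \<open>L\<^sub>2(0,T;V\<^sup>*)\<close>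
  is read off from the adjoint equation (\<open>adjoint_state_represents_I_x\<close>).  A representative of \<open>J\<^sub>u\<close> and the inverse of \<open>J\<^sub>u\<^sub>u\<close> come from the
  Lax-Milgram theorem on \<open>L\<^sub>2(0,T;U)\<close> (\<open>L2_Lax_Milgram\<close>), which rests on completeness (\<open>L2_complete\<close>).\<close>

section \<open>Strongly measurable functions\<close>

text \<open>Borel functions into a nonseparable space need not be closed under addition.  An essentially
separable range repairs this, and it is exactly the extra condition in \<open>L2\<close>.\<close>

definition strongly_measurable :: "'a measure \<Rightarrow> ('a \<Rightarrow> 'e::topological_space) \<Rightarrow> bool" where
  "strongly_measurable M f \<longleftrightarrow> f \<in> borel_measurable M
     \<and> (\<exists>D. countable D \<and> (AE s in M. f s \<in> closure D))"

lemma strongly_measurableD: "strongly_measurable M f \<Longrightarrow> f \<in> borel_measurable M"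
  by (simp add: strongly_measurable_def)

lemma strongly_measurable_iff_measurable:
  fixes f :: "'a \<Rightarrow> 'e::{second_countable_topology, metric_space}"
  shows "strongly_measurable M f \<longleftrightarrow> f \<in> borel_measurable M"
proof -
  obtain D :: "'e set" where D: "countable D" "\<And>X. open X \<Longrightarrow> X \<noteq> {} \<Longrightarrow> \<exists>d\<in>D. d \<in> X"
    using countable_dense_setE by blast
  have "closure D = UNIV"
    using D(2) by (auto simp: closure_iff_nhds_not_empty) (metis disjoint_iff empty_iff subsetD)
  with D(1) show ?thesis by (auto simp: strongly_measurable_def)
qed

text \<open>On the product of a separable metric space with an arbitrary one, every open set is a countable union
of open rectangles, with the balls around a countable dense set in the first factor.  So separability
of the range of \<open>f\<close> reduces measurability of the pair to that of its components, up to a null set that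
completeness absorbs.\<close>

lemma strongly_measurable_Pair:
  fixes f :: "'a \<Rightarrow> 'e::metric_space" and g :: "'a \<Rightarrow> 'f::metric_space"
  assumes M: "complete_measure M" and f: "strongly_measurable M f" and g: "strongly_measurable M g"
  shows "strongly_measurable M (\<lambda>s. (f s, g s))"
proof -
  obtain D E where D: "countable D" "AE s in M. f s \<in> closure D"
    and E: "countable E" "AE s in M. g s \<in> closure E"
    using f g by (auto simp: strongly_measurable_def)
  have [measurable]: "f \<in> borel_measurable M" "g \<in> borel_measurable M"
    using f g by (auto simp: strongly_measurable_def)
  define S where "S = {s\<in>space M. f s \<in> closure D}"
  have "f -` closure D \<inter> space M \<in> sets M"
    by (rule measurable_sets[of f M borel]) auto
  moreover have "f -` closure D \<inter> space M = S" by (auto simp: S_def)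
  ultimately have S [measurable]: "S \<in> sets M" by simp
  have null: "space M - S \<in> null_sets M"
  proof -
    have "AE s in M. s \<notin> space M - S"
      using D(2) AE_space by eventually_elim (simp add: S_def)
    then show ?thesis using S AE_iff_null_sets sets.compl_sets by blast
  qed
  have "(\<lambda>s. (f s, g s)) \<in> borel_measurable M"
  proof (rule borel_measurableI)
    fix X :: "('e \<times> 'f) set" assume X: "open X"
    define r where "r n = 1 / (real n + 1)" for n
    define O' where "O' d n = \<Union>{Q. open Q \<and> ball d (r n) \<times> Q \<subseteq> X}" for d n
    have O': "open (O' d n)" for d n by (auto simp: O'_def)
    let ?G = "(\<Union>d\<in>D. \<Union>n. (f -` ball d (r n) \<inter> space M) \<inter> (g -` O' d n \<inter> space M)) \<inter> S"
    let ?V = "(\<lambda>s. (f s, g s)) -` X \<inter> space M"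
    have G: "?G \<in> sets M"
      by (intro sets.Int S sets.countable_UN'' D(1) sets.countable_UN measurable_sets[of f M borel]
        measurable_sets[of g M borel] image_subsetI) (auto simp: O')
    have "?V \<inter> S \<subseteq> ?G"
    proof
      fix s assume s: "s \<in> ?V \<inter> S"
      then have "(f s, g s) \<in> X" by auto
      then obtain A B where AB: "open A" "open B" "f s \<in> A" "g s \<in> B" "A \<times> B \<subseteq> X"
        using X by (metis mem_Times_iff fst_conv snd_conv open_prod_elim)
      obtain e where e: "e > 0" "ball (f s) e \<subseteq> A" using AB openE by blast
      obtain n where n: "r n < e / 2"
        using e(1) reals_Archimedean[of "e/2"] by (auto simp: r_def inverse_eq_divide add.commute)
      have rn: "0 < r n" by (simp add: r_def)
      have "f s \<in> closure D" using s by (auto simp: S_def)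
      then obtain d where d: "d \<in> D" "dist d (f s) < r n" using rn by (meson closure_approachable)
      have "ball d (r n) \<subseteq> ball (f s) e"
      proof
        fix y assume "y \<in> ball d (r n)"
        then have "dist (f s) y < r n + r n"
          using d(2) dist_triangle[of "f s" y d] by (auto simp: dist_commute)
        then show "y \<in> ball (f s) e" using n by simp
      qed
      then have "ball d (r n) \<times> B \<subseteq> X" using e(2) AB(5) by blast
      then have "g s \<in> O' d n" using AB by (auto simp: O'_def)
      then show "s \<in> ?G" using s d by auto
    qed
    moreover have "?G \<subseteq> ?V \<inter> S" unfolding O'_def by blast
    ultimately have VG: "?V \<inter> S = ?G" by (intro subset_antisym)
    have V: "?V = ?V \<inter> S \<union> (?V \<inter> (space M - S))" by auto
    have "?V \<inter> (space M - S) \<in> sets M"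
      by (rule complete_measure.complete[OF M _ null]) (rule Int_lower2)
    then show "?V \<in> sets M" by (subst V, subst VG) (rule sets.Un[OF G])
  qed
  moreover have "AE s in M. (f s, g s) \<in> closure (D \<times> E)"
    using D(2) E(2) by eventually_elim (simp add: closure_Times)
  ultimately show ?thesis
    using D E by (auto simp: strongly_measurable_def)
qed

lemma strongly_measurable_compose:
  fixes F :: "'e::topological_space \<Rightarrow> 'f::topological_space"
  assumes F: "continuous_on UNIV F" and f: "strongly_measurable M f"
  shows "strongly_measurable M (\<lambda>s. F (f s))"
proof -
  obtain D where D: "countable D" "AE s in M. f s \<in> closure D" and m: "f \<in> borel_measurable M"
    using f by (auto simp: strongly_measurable_def)
  have "F ` closure D \<subseteq> closure (F ` D)"
    by (meson F closed_closure closure_subset continuous_on_subset image_closure_subset top_greatest)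
  then have "AE s in M. F (f s) \<in> closure (F ` D)"
    using D(2) by (auto elim: eventually_mono)
  moreover have "(\<lambda>s. F (f s)) \<in> borel_measurable M"
    using measurable_compose[OF m borel_measurable_continuous_onI[OF F]] .
  ultimately show ?thesis using D(1) by (auto simp: strongly_measurable_def)
qed

lemma strongly_measurable_compose2:
  fixes F :: "'e::metric_space \<Rightarrow> 'f::metric_space \<Rightarrow> 'g::topological_space"
  assumes M: "complete_measure M" and F: "continuous_on UNIV (\<lambda>p. F (fst p) (snd p))"
    and f: "strongly_measurable M f" and g: "strongly_measurable M g"
  shows "strongly_measurable M (\<lambda>s. F (f s) (g s))"
  using strongly_measurable_compose[OF F strongly_measurable_Pair[OF M f g]] by simp

lemma complete_lebesgue_on: "complete_measure (lebesgue_on {a..b::real})"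
proof
  fix A B assume "B \<subseteq> A" "A \<in> null_sets (lebesgue_on {a..b})"
  then show "B \<in> sets (lebesgue_on {a..b})"
    by (simp add: null_sets_restrict_space sets_restrict_space_iff)
       (meson completion.complete2 null_setsD2 subset_trans)
qed

section \<open>Calculus in the spaces \<open>L\<^sub>2(a,b;E)\<close>\<close>

lemma L2_iff: "f \<in> L2 a b \<longleftrightarrow>
    strongly_measurable (lebesgue_on {a..b}) f \<and> integrable (lebesgue_on {a..b}) (\<lambda>s. (norm (f s))\<^sup>2)"
  by (auto simp: L2_def strongly_measurable_def)

lemma L2_strongly_measurable: "f \<in> L2 a b \<Longrightarrow> strongly_measurable (lebesgue_on {a..b}) f"
  by (simp add: L2_iff)

lemma L2_integrable_norm2: "f \<in> L2 a b \<Longrightarrow> integrable (lebesgue_on {a..b}) (\<lambda>s. (norm (f s))\<^sup>2)"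
  by (simp add: L2_iff)

lemma L2_norm_measurable: "f \<in> L2 a b \<Longrightarrow> (\<lambda>s. norm (f s)) \<in> borel_measurable (lebesgue_on {a..b})"
  by (rule strongly_measurable_compose[THEN strongly_measurableD])
     (auto simp: continuous_on_norm_id intro: L2_strongly_measurable)

lemma L2norm_nonneg [simp]: "0 \<le> L2norm a b f"
  by (simp add: L2norm_def)

lemma L2norm_power2: "(L2norm a b f)\<^sup>2 = (LINT s|lebesgue_on {a..b}. (norm (f s))\<^sup>2)"
  by (simp add: L2norm_def)

lemma L2I_bound:
  fixes f :: "real \<Rightarrow> 'e::real_normed_vector"
  assumes "strongly_measurable (lebesgue_on {a..b}) f" "integrable (lebesgue_on {a..b}) h"
    and "AE s in lebesgue_on {a..b}. (norm (f s))\<^sup>2 \<le> h s"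
  shows "f \<in> L2 a b"
proof -
  have [measurable]: "(\<lambda>s. norm (f s)) \<in> borel_measurable (lebesgue_on {a..b})"
    using strongly_measurable_compose[of norm, OF _ assms(1)]
    by (auto simp: continuous_on_norm_id strongly_measurable_def)
  show ?thesis
    unfolding L2_iff using assms
    by (auto intro!: Bochner_Integration.integrable_bound[OF assms(2)] elim!: eventually_mono)
qed

lemma L2norm_le_sqrt:
  assumes "f \<in> L2 a b" "integrable (lebesgue_on {a..b}) h"
    and "AE s in lebesgue_on {a..b}. (norm (f s))\<^sup>2 \<le> h s"
  shows "L2norm a b f \<le> sqrt (LINT s|lebesgue_on {a..b}. h s)"
  unfolding L2norm_def using assms
  by (auto intro!: integral_mono_AE L2_integrable_norm2)

lemma L2_linear_image:
  fixes F :: "'e::real_normed_vector \<Rightarrow> 'f::real_normed_vector"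
  assumes F: "bounded_linear F" and f: "f \<in> L2 a b"
    and C: "0 \<le> C" "\<And>y. norm (F y) \<le> C * norm y"
  shows "(\<lambda>s. F (f s)) \<in> L2 a b" and "L2norm a b (\<lambda>s. F (f s)) \<le> C * L2norm a b f"
proof -
  have 1: "(norm (F y))\<^sup>2 \<le> C\<^sup>2 * (norm y)\<^sup>2" for y
    using power_mono[OF C(2), of y 2] by (simp add: power_mult_distrib)
  have i: "integrable (lebesgue_on {a..b}) (\<lambda>s. C\<^sup>2 * (norm (f s))\<^sup>2)"
    using L2_integrable_norm2[OF f] by simp
  show 2: "(\<lambda>s. F (f s)) \<in> L2 a b"
    by (rule L2I_bound[OF strongly_measurable_compose[OF _ L2_strongly_measurable[OF f]] i])
       (use 1 F in \<open>auto simp: linear_continuous_on\<close>)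
  have "L2norm a b (\<lambda>s. F (f s)) \<le> sqrt (LINT s|lebesgue_on {a..b}. C\<^sup>2 * (norm (f s))\<^sup>2)"
    by (rule L2norm_le_sqrt[OF 2 i]) (use 1 in auto)
  also have "\<dots> = C * L2norm a b f"
    using C by (simp add: L2norm_def real_sqrt_mult)
  finally show "L2norm a b (\<lambda>s. F (f s)) \<le> C * L2norm a b f" .
qed

lemma L2_add:
  assumes f: "f \<in> L2 a b" and g: "g \<in> L2 a b"
  shows "(\<lambda>s. f s + g s) \<in> L2 a b"
proof (rule L2I_bound)
  show "strongly_measurable (lebesgue_on {a..b}) (\<lambda>s. f s + g s)"
    by (rule strongly_measurable_compose2[OF complete_lebesgue_on _ L2_strongly_measurable[OF f]
          L2_strongly_measurable[OF g]]) (intro continuous_intros)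
  show "integrable (lebesgue_on {a..b}) (\<lambda>s. 2 * (norm (f s))\<^sup>2 + 2 * (norm (g s))\<^sup>2)"
    by (intro Bochner_Integration.integrable_add integrable_mult_right L2_integrable_norm2 f g)
  have "(norm (x + y))\<^sup>2 \<le> 2 * (norm x)\<^sup>2 + 2 * (norm y)\<^sup>2" for x y :: 'a
  proof -
    have "(norm (x + y))\<^sup>2 \<le> (norm x + norm y)\<^sup>2" by (intro power_mono norm_triangle_ineq) auto
    then show ?thesis using sum_squares_bound[of "norm x" "norm y"] by (simp add: power2_sum)
  qed
  then show "AE s in lebesgue_on {a..b}. (norm (f s + g s))\<^sup>2 \<le> 2 * (norm (f s))\<^sup>2 + 2 * (norm (g s))\<^sup>2"
    by auto
qed

lemma L2_scaleR: "f \<in> L2 a b \<Longrightarrow> (\<lambda>s. c *\<^sub>R f s) \<in> L2 a b"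
  by (rule L2_linear_image(1)[of "\<lambda>y. c *\<^sub>R y" f a b "\<bar>c\<bar>"]) (auto intro: bounded_linear_scaleR_right)

lemma L2_uminus: "f \<in> L2 a b \<Longrightarrow> (\<lambda>s. - f s) \<in> L2 a b"
  using L2_scaleR[of f a b "-1"] by simp

lemma L2_diff: "f \<in> L2 a b \<Longrightarrow> g \<in> L2 a b \<Longrightarrow> (\<lambda>s. f s - g s) \<in> L2 a b"
  using L2_add[of f a b "\<lambda>s. - g s"] L2_uminus[of g a b] by simp

lemma L2_zero [simp]: "(\<lambda>_. 0) \<in> L2 a b"
  by (auto simp: L2_def intro!: exI[of _ "{0}"])

lemma L2norm_scaleR: "L2norm a b (\<lambda>s. c *\<^sub>R f s) = \<bar>c\<bar> * L2norm a b f"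
  by (simp add: L2norm_def power_mult_distrib real_sqrt_mult)

lemma L2norm_uminus: "L2norm a b (\<lambda>s. - f s) = L2norm a b f"
  by (simp add: L2norm_def)

lemma L2norm_eq_0_iff:
  assumes "f \<in> L2 a b"
  shows "L2norm a b f = 0 \<longleftrightarrow> (AE s in lebesgue_on {a..b}. f s = 0)"
  using integral_nonneg_eq_0_iff_AE[OF L2_integrable_norm2[OF assms]] by (auto simp: L2norm_def)

lemma L2_weight:
  fixes f :: "real \<Rightarrow> 'e::real_normed_vector" and \<omega> :: "real \<Rightarrow> real"
  assumes w: "\<omega> \<in> borel_measurable (lebesgue_on {a..b})" and f: "f \<in> L2 a b"
    and C: "0 \<le> C" "\<And>s. s \<in> {a..b} \<Longrightarrow> \<bar>\<omega> s\<bar> \<le> C"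
  shows "(\<lambda>s. \<omega> s *\<^sub>R f s) \<in> L2 a b" and "L2norm a b (\<lambda>s. \<omega> s *\<^sub>R f s) \<le> C * L2norm a b f"
proof -
  have 1: "(norm (\<omega> s *\<^sub>R f s))\<^sup>2 \<le> C\<^sup>2 * (norm (f s))\<^sup>2" if "s \<in> {a..b}" for s
    using power_mono[OF C(2)[OF that], of 2] by (simp add: power_mult_distrib mult_right_mono)
  then have ae: "AE s in lebesgue_on {a..b}. (norm (\<omega> s *\<^sub>R f s))\<^sup>2 \<le> C\<^sup>2 * (norm (f s))\<^sup>2"
    by (auto intro: AE_I2)
  have i: "integrable (lebesgue_on {a..b}) (\<lambda>s. C\<^sup>2 * (norm (f s))\<^sup>2)"
    using L2_integrable_norm2[OF f] by simp
  have "strongly_measurable (lebesgue_on {a..b}) (\<lambda>s. \<omega> s *\<^sub>R f s)"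
    by (rule strongly_measurable_compose2[OF complete_lebesgue_on _ _ L2_strongly_measurable[OF f]])
       (use w in \<open>auto intro!: continuous_intros simp: strongly_measurable_iff_measurable\<close>)
  then show 2: "(\<lambda>s. \<omega> s *\<^sub>R f s) \<in> L2 a b"
    by (rule L2I_bound[OF _ i ae])
  have "L2norm a b (\<lambda>s. \<omega> s *\<^sub>R f s) \<le> sqrt (LINT s|lebesgue_on {a..b}. C\<^sup>2 * (norm (f s))\<^sup>2)"
    by (rule L2norm_le_sqrt[OF 2 i ae])
  also have "\<dots> = C * L2norm a b f"
    using C by (simp add: L2norm_def real_sqrt_mult)
  finally show "L2norm a b (\<lambda>s. \<omega> s *\<^sub>R f s) \<le> C * L2norm a b f" .
qed

text \<open>The discriminant of the nonnegative quadratic polynomial \<open>t \<mapsto> \<integral> (t f + g)\<^sup>2\<close> is not positive.\<close>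

lemma square_integrable_Cauchy_Schwarz:
  fixes f g :: "'a \<Rightarrow> real"
  assumes [measurable]: "f \<in> borel_measurable M" "g \<in> borel_measurable M"
    and f2: "integrable M (\<lambda>s. (f s)\<^sup>2)" and g2: "integrable M (\<lambda>s. (g s)\<^sup>2)"
  shows "integrable M (\<lambda>s. f s * g s)"
    and "\<bar>LINT s|M. f s * g s\<bar> \<le> sqrt (LINT s|M. (f s)\<^sup>2) * sqrt (LINT s|M. (g s)\<^sup>2)"
proof -
  have b: "\<bar>x * y\<bar> \<le> x\<^sup>2 + y\<^sup>2" for x y :: real
    using sum_squares_bound[of x y] sum_squares_bound[of x "-y"] zero_le_power2[of x] zero_le_power2[of y]
    by (simp add: abs_if)
  show fg: "integrable M (\<lambda>s. f s * g s)"
    by (rule Bochner_Integration.integrable_bound[OF Bochner_Integration.integrable_add[OF f2 g2]])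
       (use b in auto)
  define A B C where "A = (LINT s|M. (f s)\<^sup>2)" and "B = (LINT s|M. (g s)\<^sup>2)" and "C = (LINT s|M. f s * g s)"
  have AB: "0 \<le> A" "0 \<le> B" by (auto simp: A_def B_def)
  have quad: "0 \<le> A * t\<^sup>2 + 2 * C * t + B" for t
  proof -
    have "0 \<le> (LINT s|M. (t * f s + g s)\<^sup>2)" by simp
    also have "\<dots> = (LINT s|M. t\<^sup>2 * (f s)\<^sup>2 + (2 * t) * (f s * g s) + (g s)\<^sup>2)"
      by (simp add: power2_sum power_mult_distrib mult.assoc algebra_simps)
    also have "\<dots> = t\<^sup>2 * A + (2 * t) * C + B"
      using f2 g2 fg by (simp add: A_def B_def C_def)
    finally show ?thesis by (simp add: algebra_simps)
  qed
  have "C\<^sup>2 \<le> A * B"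
  proof (cases "A = 0")
    case True
    have "C = 0"
    proof (rule ccontr)
      assume "C \<noteq> 0"
      then show False using quad[of "- (B + 1) / (2 * C)"] True by simp
    qed
    then show ?thesis using True by simp
  next
    case False
    then have A: "A > 0" using AB by simp
    have "0 \<le> A * (A * (- C / A)\<^sup>2 + 2 * C * (- C / A) + B)"
      using quad[of "- C / A"] A by simp
    also have "\<dots> = A * B - C\<^sup>2" using A by (simp add: field_simps power2_eq_square)
    finally show ?thesis by simp
  qed
  then have "\<bar>C\<bar> \<le> sqrt (A * B)" by (metis real_sqrt_abs real_sqrt_le_iff)
  then show "\<bar>LINT s|M. f s * g s\<bar> \<le> sqrt (LINT s|M. (f s)\<^sup>2) * sqrt (LINT s|M. (g s)\<^sup>2)"
    by (simp add: A_def B_def C_def real_sqrt_mult)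
qed

lemma L2_bilinear:
  fixes F :: "'e::real_normed_vector \<Rightarrow> 'f::real_normed_vector \<Rightarrow> real"
  assumes F: "bounded_bilinear F" and C: "0 \<le> C" "\<And>x y. \<bar>F x y\<bar> \<le> C * (norm x * norm y)"
    and f: "f \<in> L2 a b" and g: "g \<in> L2 a b"
  shows "integrable (lebesgue_on {a..b}) (\<lambda>s. F (f s) (g s))"
    and "\<bar>LINT s|lebesgue_on {a..b}. F (f s) (g s)\<bar> \<le> C * (L2norm a b f * L2norm a b g)"
proof -
  note m [measurable] = L2_norm_measurable[OF f] L2_norm_measurable[OF g]
  note CS = square_integrable_Cauchy_Schwarz[OF m L2_integrable_norm2[OF f] L2_integrable_norm2[OF g]]
  have "strongly_measurable (lebesgue_on {a..b}) (\<lambda>s. F (f s) (g s))"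
    by (rule strongly_measurable_compose2[OF complete_lebesgue_on _ L2_strongly_measurable[OF f]
          L2_strongly_measurable[OF g]])
       (intro bounded_bilinear.continuous_on[OF F] continuous_intros)
  then have [measurable]: "(\<lambda>s. F (f s) (g s)) \<in> borel_measurable (lebesgue_on {a..b})"
    by (rule strongly_measurableD)
  have i: "integrable (lebesgue_on {a..b}) (\<lambda>s. C * (norm (f s) * norm (g s)))" using CS(1) by simp
  show I: "integrable (lebesgue_on {a..b}) (\<lambda>s. F (f s) (g s))"
    by (rule Bochner_Integration.integrable_bound[OF i]) (use C in \<open>auto intro!: AE_I2\<close>)
  have "\<bar>LINT s|lebesgue_on {a..b}. F (f s) (g s)\<bar> \<le> (LINT s|lebesgue_on {a..b}. \<bar>F (f s) (g s)\<bar>)"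
    using integral_abs_bound by blast
  also have "\<dots> \<le> (LINT s|lebesgue_on {a..b}. C * (norm (f s) * norm (g s)))"
    by (rule integral_mono) (use I i C in auto)
  also have "\<dots> = C * (LINT s|lebesgue_on {a..b}. norm (f s) * norm (g s))" by simp
  also have "\<dots> \<le> C * (L2norm a b f * L2norm a b g)"
    using CS(2) C by (auto simp: L2norm_def intro!: mult_left_mono)
  finally show "\<bar>LINT s|lebesgue_on {a..b}. F (f s) (g s)\<bar> \<le> C * (L2norm a b f * L2norm a b g)" .
qed

lemma L2_pairing:
  assumes "g \<in> L2 a b" "f \<in> L2 a b"
  shows "integrable (lebesgue_on {a..b}) (\<lambda>s. blinfun_apply (g s) (f s))"
    and "\<bar>pairing a b g f\<bar> \<le> L2norm a b g * L2norm a b f"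
proof -
  have "\<bar>blinfun_apply x y\<bar> \<le> 1 * (norm x * norm y)" for x :: "'a \<Rightarrow>\<^sub>L real" and y
    using norm_blinfun[of x y] by simp
  note L2_bilinear[OF bounded_bilinear_blinfun_apply zero_le_one this assms]
  then show "integrable (lebesgue_on {a..b}) (\<lambda>s. blinfun_apply (g s) (f s))"
    and "\<bar>pairing a b g f\<bar> \<le> L2norm a b g * L2norm a b f"
    by (auto simp: pairing_def)
qed

lemma L2_inner:
  fixes f g :: "real \<Rightarrow> 'u::real_inner"
  assumes "f \<in> L2 a b" "g \<in> L2 a b"
  shows "integrable (lebesgue_on {a..b}) (\<lambda>s. inner (f s) (g s))"
    and "\<bar>LINT s|lebesgue_on {a..b}. inner (f s) (g s)\<bar> \<le> L2norm a b f * L2norm a b g"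
  using L2_bilinear[OF bounded_bilinear_inner _ _ assms, of 1] Cauchy_Schwarz_ineq2
  by auto

lemma L2norm_triangle:
  assumes f: "f \<in> L2 a b" and g: "g \<in> L2 a b"
  shows "L2norm a b (\<lambda>s. f s + g s) \<le> L2norm a b f + L2norm a b g"
proof (rule power2_le_imp_le)
  note m = L2_norm_measurable[OF f] L2_norm_measurable[OF g]
  note CS = square_integrable_Cauchy_Schwarz[OF m L2_integrable_norm2[OF f] L2_integrable_norm2[OF g]]
  have "(L2norm a b (\<lambda>s. f s + g s))\<^sup>2 \<le>
      (LINT s|lebesgue_on {a..b}. (norm (f s))\<^sup>2 + 2 * (norm (f s) * norm (g s)) + (norm (g s))\<^sup>2)"
    unfolding L2norm_power2
  proof (rule integral_mono)
    show "integrable (lebesgue_on {a..b}) (\<lambda>s. (norm (f s + g s))\<^sup>2)"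
      using L2_integrable_norm2[OF L2_add[OF f g]] .
    show "integrable (lebesgue_on {a..b}) (\<lambda>s. (norm (f s))\<^sup>2 + 2 * (norm (f s) * norm (g s)) + (norm (g s))\<^sup>2)"
      using L2_integrable_norm2[OF f] L2_integrable_norm2[OF g] CS(1) by simp
    fix s
    have "(norm (f s + g s))\<^sup>2 \<le> (norm (f s) + norm (g s))\<^sup>2" by (intro power_mono norm_triangle_ineq) auto
    then show "(norm (f s + g s))\<^sup>2 \<le> (norm (f s))\<^sup>2 + 2 * (norm (f s) * norm (g s)) + (norm (g s))\<^sup>2"
      by (simp add: power2_sum)
  qed
  also have "\<dots> = (L2norm a b f)\<^sup>2 + 2 * (LINT s|lebesgue_on {a..b}. norm (f s) * norm (g s)) + (L2norm a b g)\<^sup>2"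
    using L2_integrable_norm2[OF f] L2_integrable_norm2[OF g] CS(1) by (simp add: L2norm_power2)
  also have "\<dots> \<le> (L2norm a b f + L2norm a b g)\<^sup>2"
    using CS(2) by (simp add: power2_sum L2norm_def)
  finally show "(L2norm a b (\<lambda>s. f s + g s))\<^sup>2 \<le> (L2norm a b f + L2norm a b g)\<^sup>2" .
qed simp

lemma L2norm_triangle_diff:
  assumes f: "f \<in> L2 a b" and g: "g \<in> L2 a b"
  shows "L2norm a b (\<lambda>s. f s - g s) \<le> L2norm a b f + L2norm a b g"
  using L2norm_triangle[OF f L2_uminus[OF g]] by (simp add: L2norm_uminus)

lemma lebesgue_on_restrict:
  assumes "{a..b} \<subseteq> {c..d::real}"
  shows "lebesgue_on {a..b} = restrict_space (lebesgue_on {c..d}) {a..b}"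
proof -
  have "restrict_space (lebesgue_on {c..d}) {a..b} = lebesgue_on ({c..d} \<inter> {a..b})"
    by (rule restrict_restrict_space) auto
  then show ?thesis using assms by (metis Int_absorb1)
qed

lemma lebesgue_on_subinterval:
  fixes f :: "real \<Rightarrow> 'e::{banach,second_countable_topology}"
  assumes "{a..b} \<subseteq> {c..d::real}" and i: "integrable (lebesgue_on {c..d}) f"
  shows "integrable (lebesgue_on {a..b}) f"
    and "(LINT s|lebesgue_on {a..b}. f s) = (LINT s|lebesgue_on {c..d}. indicator {a..b} s *\<^sub>R f s)"
proof -
  have r: "lebesgue_on {a..b} = restrict_space (lebesgue_on {c..d}) {a..b}"
    by (rule lebesgue_on_restrict[OF assms(1)])
  have m: "{a..b} \<in> sets (lebesgue_on {c..d})"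
    using sets.top[of "lebesgue_on {a..b}"] unfolding sets_restrict_space using Int_absorb1[OF assms(1)]
    by (intro image_eqI[of _ _ "{a..b}"]) (simp_all only: lmeasurable_interval fmeasurableD)
  then have m': "{a..b} \<inter> space (lebesgue_on {c..d}) \<in> sets (lebesgue_on {c..d})"
    by (metis sets.Int_space_eq2)
  show "integrable (lebesgue_on {a..b}) f"
    unfolding r integrable_restrict_space[OF m'] by (rule integrable_mult_indicator[OF m i])
  show "(LINT s|lebesgue_on {a..b}. f s) = (LINT s|lebesgue_on {c..d}. indicator {a..b} s *\<^sub>R f s)"
    unfolding r integral_restrict_space[OF m'] ..
qed

lemma AE_lebesgue_on_subinterval:
  assumes "{a..b} \<subseteq> {c..d::real}" and "AE s in lebesgue_on {c..d}. P s"
  shows "AE s in lebesgue_on {a..b}. P s"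
  using assms by (auto simp: AE_restrict_space_iff elim!: eventually_mono)

lemma L2_subinterval:
  assumes s: "{a..b} \<subseteq> {c..d::real}" and f: "f \<in> L2 c d"
  shows "f \<in> L2 a b" and "L2norm a b f \<le> L2norm c d f"
proof -
  have r: "lebesgue_on {a..b} = restrict_space (lebesgue_on {c..d}) {a..b}"
    by (rule lebesgue_on_restrict[OF s])
  have "f \<in> borel_measurable (lebesgue_on {a..b})"
    unfolding r by (rule measurable_restrict_space1) (use f in \<open>simp add: L2_def\<close>)
  then show 1: "f \<in> L2 a b"
    using f AE_lebesgue_on_subinterval[OF s] lebesgue_on_subinterval(1)[OF s]
    unfolding L2_def by blast
  show "L2norm a b f \<le> L2norm c d f"
    unfolding L2norm_def using s L2_integrable_norm2[OF f]
    by (auto intro!: integral_mono_lebesgue_on_AE)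
qed

section \<open>Completeness of \<open>L\<^sub>2(a,b;E)\<close> and the Lax-Milgram theorem\<close>

text \<open>Fatou's lemma for the squared norms.  Applied to distances, it turns pointwise convergence of a
Cauchy sequence into membership of the limit and a rate of convergence.\<close>

lemma L2_Fatou:
  assumes u: "\<And>k. u k \<in> L2 a b" "\<And>k. L2norm a b (u k) \<le> C"
    and g: "strongly_measurable (lebesgue_on {a..b}) g"
    and lim: "AE s in lebesgue_on {a..b}. (\<lambda>k. u k s) \<longlonglongrightarrow> g s"
  shows "g \<in> L2 a b" and "L2norm a b g \<le> C"
proof -
  let ?M = "lebesgue_on {a..b}"
  have C: "0 \<le> C" using u(2)[of 0] L2norm_nonneg[of a b "u 0"] by linarith
  note m = borel_measurable_integrable[OF L2_integrable_norm2[OF u(1)], measurable]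
  have gm: "(\<lambda>s. norm (g s)) \<in> borel_measurable ?M"
    by (rule strongly_measurable_compose[THEN strongly_measurableD, OF _ g]) (auto simp: continuous_on_norm_id)
  then have [measurable]: "(\<lambda>s. (norm (g s))\<^sup>2) \<in> borel_measurable ?M" by simp
  have "(\<integral>\<^sup>+s. ennreal ((norm (g s))\<^sup>2) \<partial>?M) = (\<integral>\<^sup>+s. liminf (\<lambda>k. ennreal ((norm (u k s))\<^sup>2)) \<partial>?M)"
  proof (rule nn_integral_cong_AE)
    show "AE s in ?M. ennreal ((norm (g s))\<^sup>2) = liminf (\<lambda>k. ennreal ((norm (u k s))\<^sup>2))"
      using lim
    proof eventually_elim
      case (elim s)
      then have "(\<lambda>k. ennreal ((norm (u k s))\<^sup>2)) \<longlonglongrightarrow> ennreal ((norm (g s))\<^sup>2)"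
        by (intro tendsto_intros)
      from lim_imp_Liminf[OF trivial_limit_sequentially this]
      show ?case by (rule sym)
    qed
  qed
  also have "\<dots> \<le> liminf (\<lambda>k. \<integral>\<^sup>+s. ennreal ((norm (u k s))\<^sup>2) \<partial>?M)"
    by (rule nn_integral_liminf) simp
  also have "\<dots> \<le> liminf (\<lambda>k::nat. ennreal (C\<^sup>2))"
  proof (rule Liminf_mono, rule always_eventually, rule allI)
    fix k
    have "(\<integral>\<^sup>+s. ennreal ((norm (u k s))\<^sup>2) \<partial>?M) = ennreal ((L2norm a b (u k))\<^sup>2)"
      unfolding L2norm_power2 by (rule nn_integral_eq_integral[OF L2_integrable_norm2[OF u(1)]]) auto
    also have "\<dots> \<le> ennreal (C\<^sup>2)" using u(2)[of k] by (intro ennreal_leI power_mono) auto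
    finally show "(\<integral>\<^sup>+s. ennreal ((norm (u k s))\<^sup>2) \<partial>?M) \<le> ennreal (C\<^sup>2)" .
  qed
  also have "\<dots> = ennreal (C\<^sup>2)" by (simp add: Liminf_const)
  finally have le: "(\<integral>\<^sup>+s. ennreal ((norm (g s))\<^sup>2) \<partial>?M) \<le> ennreal (C\<^sup>2)" .
  have i: "integrable ?M (\<lambda>s. (norm (g s))\<^sup>2)"
    by (rule integrableI_nonneg) (use le in \<open>auto simp: less_top[symmetric] top_unique\<close>)
  then show gL: "g \<in> L2 a b" using g by (simp add: L2_iff)
  have "ennreal ((L2norm a b g)\<^sup>2) \<le> ennreal (C\<^sup>2)"
    unfolding L2norm_power2 using le by (subst (asm) nn_integral_eq_integral[OF i]) auto
  then have "(L2norm a b g)\<^sup>2 \<le> C\<^sup>2" by (simp add: ennreal_le_iff)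
  then show "L2norm a b g \<le> C" using C power2_le_imp_le by blast
qed

text \<open>The proof of Riesz and Fischer: along a subsequence whose consecutive distances are at most \<open>2\<^sup>-\<^sup>k\<close>, the
series of the pointwise distances has a finite integral, so the subsequence converges almost
everywhere.  Fatou's lemma turns this into convergence in norm.\<close>

lemma L2_complete:
  fixes f :: "nat \<Rightarrow> real \<Rightarrow> 'e::banach"
  assumes f: "\<And>n. f n \<in> L2 a b"
    and Cauchy: "\<And>\<epsilon>. 0 < \<epsilon> \<Longrightarrow> \<exists>N. \<forall>m\<ge>N. \<forall>n\<ge>N. L2norm a b (\<lambda>s. f m s - f n s) \<le> \<epsilon>"
  shows "\<exists>g\<in>L2 a b. (\<lambda>n. L2norm a b (\<lambda>s. f n s - g s)) \<longlonglongrightarrow> 0"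
proof -
  let ?M = "lebesgue_on {a..b}"
  have "\<forall>k. \<exists>N. \<forall>m\<ge>N. \<forall>n\<ge>N. L2norm a b (\<lambda>s. f m s - f n s) \<le> (1/2)^k"
    using Cauchy by simp
  then obtain N where N: "\<And>k m n. N k \<le> m \<Longrightarrow> N k \<le> n \<Longrightarrow> L2norm a b (\<lambda>s. f m s - f n s) \<le> (1/2)^k"
    by metis
  \<comment> \<open>partial sums give monotone indices with \<open>N k \<le> r k\<close>, so \<open>h k = f (r k)\<close> has gaps at most \<open>2\<^sup>-\<^sup>k\<close>\<close>
  define r where "r k = (\<Sum>i\<le>k. N i)" for k
  have r: "N k \<le> r k'" if "k \<le> k'" for k k'
    unfolding r_def using that by (intro member_le_sum) auto
  define h where "h k = f (r k)" for k
  have h: "h k \<in> L2 a b" for k using f by (simp add: h_def)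
  define d where "d k s = norm (h (Suc k) s - h k s)" for k s
  have dL: "(\<lambda>s. h (Suc k) s - h k s) \<in> L2 a b" for k by (rule L2_diff[OF h h])
  have dm [measurable]: "d k \<in> borel_measurable ?M" for k
    unfolding d_def by (rule L2_norm_measurable[OF dL])
  have one: "(\<lambda>s. 1::real) \<in> L2 a b" by (auto simp: L2_iff strongly_measurable_iff_measurable)
  define one_norm where "one_norm = L2norm a b (\<lambda>s. 1::real)"
  have int_d: "integrable ?M (d k)" and d_le: "(LINT s|?M. d k s) \<le> (1/2)^k * one_norm" for k
  proof -
    have L: "d k \<in> L2 a b" "L2norm a b (d k) = L2norm a b (\<lambda>s. h (Suc k) s - h k s)"
      using L2_integrable_norm2[OF dL[of k]]
      by (auto simp: L2_iff strongly_measurable_iff_measurable d_def L2norm_def L2_norm_measurable[OF dL])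
    have b: "\<bar>x * y\<bar> \<le> 1 * (norm x * norm y)" for x y :: real by (simp add: abs_mult)
    note * = L2_bilinear[OF bounded_bilinear_mult zero_le_one b L(1) one]
    show "integrable ?M (d k)" using *(1) by simp
    have "(LINT s|?M. d k s) \<le> L2norm a b (d k) * one_norm"
      using *(2) by (simp add: one_norm_def)
    also have "\<dots> \<le> (1/2)^k * one_norm"
      unfolding L(2) h_def by (intro mult_right_mono N r) (auto simp: one_norm_def)
    finally show "(LINT s|?M. d k s) \<le> (1/2)^k * one_norm" .
  qed
  have "(\<integral>\<^sup>+s. (\<Sum>k. ennreal (d k s)) \<partial>?M) = (\<Sum>k. \<integral>\<^sup>+s. ennreal (d k s) \<partial>?M)"
    by (rule nn_integral_suminf) simp
  also have "\<dots> = (\<Sum>k. ennreal (LINT s|?M. d k s))"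
    by (intro suminf_cong nn_integral_eq_integral int_d) (auto simp: d_def)
  also have "\<dots> \<le> (\<Sum>k. ennreal ((1/2)^k * one_norm))"
    by (intro suminf_le ennreal_leI d_le) auto
  also have "\<dots> < \<infinity>"
  proof -
    have "summable (\<lambda>k. (1/2)^k * one_norm)" by (intro summable_mult2 summable_geometric) simp
    then have "(\<Sum>k. ennreal ((1/2)^k * one_norm)) = ennreal (\<Sum>k. (1/2)^k * one_norm)"
      by (intro suminf_ennreal2) (auto simp: one_norm_def)
    then show ?thesis by simp
  qed
  finally have fin: "(\<integral>\<^sup>+s. (\<Sum>k. ennreal (d k s)) \<partial>?M) \<noteq> \<infinity>" by simp
  have "AE s in ?M. (\<Sum>k. ennreal (d k s)) \<noteq> \<infinity>"
    by (rule nn_integral_PInf_AE[OF _ fin]) simp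
  then have conv: "AE s in ?M. convergent (\<lambda>k. h k s)"
  proof eventually_elim
    case (elim s)
    then have "summable (\<lambda>k. d k s)"
      by (intro summable_suminf_not_top) (auto simp: d_def)
    then have "summable (\<lambda>k. h (Suc k) s - h k s)"
      unfolding d_def by (rule summable_norm_cancel)
    then show ?case
      by (simp only: summable_iff_convergent sum_lessThan_telescope[of "\<lambda>k. h k s"]
          convergent_diff_const_right_iff)
  qed
  then obtain Z where Z: "Z \<in> null_sets ?M" "\<And>s. s \<in> space ?M \<Longrightarrow> s \<notin> Z \<Longrightarrow> convergent (\<lambda>k. h k s)"
    using AE_E3[OF conv] by (metis DiffI)
  \<comment> \<open>setting the functions to 0 on \<open>Z\<close> gives convergence at every point, hence a Borel measurable limit\<close>
  define w where "w s = (if s \<in> Z then 0 else 1::real)" for s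
  have wm: "w \<in> borel_measurable ?M"
    using Z(1) unfolding w_def by (intro measurable_If_set) auto
  define g where "g s = lim (\<lambda>k. w s *\<^sub>R h k s)" for s
  have hw: "(\<lambda>s. w s *\<^sub>R h k s) \<in> L2 a b" for k
    by (rule L2_weight(1)[OF wm h, of 1]) (auto simp: w_def)
  have lim: "(\<lambda>k. w s *\<^sub>R h k s) \<longlonglongrightarrow> g s" if "s \<in> space ?M" for s
    using Z(2)[OF that] unfolding g_def
    by (auto simp: w_def convergent_LIMSEQ_iff)
  have w1: "AE s in ?M. w s = 1"
    using AE_not_in[OF Z(1)] by eventually_elim (simp add: w_def)
  have gm: "g \<in> borel_measurable ?M"
    by (rule borel_measurable_LIMSEQ_metric[OF strongly_measurableD[OF L2_strongly_measurable[OF hw]] lim])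
  have "\<exists>D. countable D \<and> (AE s in ?M. w s *\<^sub>R h k s \<in> closure D)" for k
    using L2_strongly_measurable[OF hw[of k]] by (simp add: strongly_measurable_def)
  then obtain D where D: "\<And>k. countable (D k)" "\<And>k. AE s in ?M. w s *\<^sub>R h k s \<in> closure (D k)"
    by metis
  have "AE s in ?M. \<forall>k. w s *\<^sub>R h k s \<in> closure (D k)" using D(2) by (simp add: AE_all_countable)
  then have "AE s in ?M. g s \<in> closure (\<Union>k. D k)"
    using AE_space
  proof eventually_elim
    case (elim s)
    have "w s *\<^sub>R h k s \<in> closure (\<Union>k. D k)" for k
      using elim(1) closure_mono[of "D k" "\<Union>k. D k"] by blast
    then show ?case by (intro closed_sequentially[OF closed_closure _ lim[OF elim(2)]])
  qed
  with gm D(1) have gs: "strongly_measurable ?M g"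
    unfolding strongly_measurable_def by (intro conjI exI[of _ "\<Union>k. D k"] countable_UN) auto
  have hg: "AE s in ?M. (\<lambda>k. h k s) \<longlonglongrightarrow> g s"
    using w1 AE_space
  proof eventually_elim
    case (elim s)
    then show ?case using lim[of s] by simp
  qed
  have close: "(\<lambda>s. f n s - g s) \<in> L2 a b \<and> L2norm a b (\<lambda>s. f n s - g s) \<le> \<epsilon>"
    if Nn: "\<And>m. M \<le> m \<Longrightarrow> L2norm a b (\<lambda>s. f n s - f m s) \<le> \<epsilon>" and k0: "M \<le> r k0" for M n k0 \<epsilon>
  proof -
    have mono: "r k0 \<le> r (k + k0)" for k
      unfolding r_def by (intro sum_mono2) auto
    note u = L2_diff[OF f h]
    have g: "strongly_measurable ?M (\<lambda>s. f n s - g s)"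
      by (rule strongly_measurable_compose2[OF complete_lebesgue_on _ L2_strongly_measurable[OF f] gs])
         (intro continuous_intros)
    have l: "AE s in ?M. (\<lambda>k. f n s - h (k + k0) s) \<longlonglongrightarrow> f n s - g s"
      using hg by eventually_elim (intro tendsto_diff tendsto_const LIMSEQ_ignore_initial_segment)
    have b: "L2norm a b (\<lambda>s. f n s - h (k + k0) s) \<le> \<epsilon>" for k
      unfolding h_def using mono[of k] k0 by (intro Nn) simp
    show ?thesis
      using L2_Fatou[where u = "\<lambda>k s. f n s - h (k + k0) s", OF u b g l] by blast
  qed
  have "\<exists>M. \<forall>n\<ge>M. (\<lambda>s. f n s - g s) \<in> L2 a b \<and> L2norm a b (\<lambda>s. f n s - g s) \<le> (1/2)^k" for k
    using close[OF N[of k] r[of k k]] by auto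
  then obtain M where M: "\<And>k n. M k \<le> n \<Longrightarrow> (\<lambda>s. f n s - g s) \<in> L2 a b"
      "\<And>k n. M k \<le> n \<Longrightarrow> L2norm a b (\<lambda>s. f n s - g s) \<le> (1/2)^k" by metis
  have "g \<in> L2 a b"
    using L2_diff[OF f[of "M 0"] M(1)[of 0 "M 0"]] by simp
  moreover have "(\<lambda>n. L2norm a b (\<lambda>s. f n s - g s)) \<longlonglongrightarrow> 0"
  proof (rule LIMSEQ_I)
    fix e :: real assume "0 < e"
    then obtain k where "(1/2)^k < e" using real_arch_pow_inv[of e "1/2"] by auto
    then show "\<exists>no. \<forall>n\<ge>no. norm (L2norm a b (\<lambda>s. f n s - g s) - 0) < e"
      using M(2)[of k] by (intro exI[of _ "M k"]) (auto intro: le_less_trans)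
  qed
  ultimately show ?thesis by blast
qed

lemma L2_functionalD:
  assumes "L2_functional a b l"
  shows "f \<in> L2 a b \<Longrightarrow> g \<in> L2 a b \<Longrightarrow> l (\<lambda>s. f s + g s) = l f + l g"
    and "f \<in> L2 a b \<Longrightarrow> l (\<lambda>s. c *\<^sub>R f s) = c * l f"
    and "f \<in> L2 a b \<Longrightarrow> g \<in> L2 a b \<Longrightarrow> l (\<lambda>s. f s - g s) = l f - l g"
    and "\<exists>K\<ge>0. \<forall>f\<in>L2 a b. \<bar>l f\<bar> \<le> K * L2norm a b f"
proof -
  show add: "l (\<lambda>s. f s + g s) = l f + l g" if "f \<in> L2 a b" "g \<in> L2 a b" for f g
    using assms that by (simp add: L2_functional_def)
  show sc: "l (\<lambda>s. c *\<^sub>R f s) = c * l f" if "f \<in> L2 a b" for f c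
    using assms that by (simp add: L2_functional_def)
  show "l (\<lambda>s. f s - g s) = l f - l g" if "f \<in> L2 a b" "g \<in> L2 a b"
    using add[OF that(1) L2_uminus[OF that(2)]] sc[OF that(2), of "-1"] by simp
  obtain K where K: "\<forall>f\<in>L2 a b. \<bar>l f\<bar> \<le> K * L2norm a b f" using assms by (auto simp: L2_functional_def)
  have "\<bar>l f\<bar> \<le> \<bar>K\<bar> * L2norm a b f" if "f \<in> L2 a b" for f
    using K that by (meson L2norm_nonneg abs_ge_self mult_right_mono order_trans)
  then show "\<exists>K\<ge>0. \<forall>f\<in>L2 a b. \<bar>l f\<bar> \<le> K * L2norm a b f" by (intro exI[of _ "\<bar>K\<bar>"]) auto
qed

lemma L2_bilinear_formD:
  assumes "L2_bilinear_form a b B"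
  shows "f \<in> L2 a b \<Longrightarrow> L2_functional a b (B f)"
    and "g \<in> L2 a b \<Longrightarrow> L2_functional a b (\<lambda>f. B f g)"
    and "\<exists>K\<ge>0. \<forall>f\<in>L2 a b. \<forall>g\<in>L2 a b. \<bar>B f g\<bar> \<le> K * L2norm a b f * L2norm a b g"
proof -
  obtain K where K: "\<forall>f\<in>L2 a b. \<forall>g\<in>L2 a b. \<bar>B f g\<bar> \<le> K * L2norm a b f * L2norm a b g"
    using assms by (auto simp: L2_bilinear_form_def)
  have "\<bar>B f g\<bar> \<le> \<bar>K\<bar> * L2norm a b f * L2norm a b g" if "f \<in> L2 a b" "g \<in> L2 a b" for f g
    using K that by (meson L2norm_nonneg abs_ge_self mult_right_mono order_trans)
  then show "\<exists>K\<ge>0. \<forall>f\<in>L2 a b. \<forall>g\<in>L2 a b. \<bar>B f g\<bar> \<le> K * L2norm a b f * L2norm a b g"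
    by (intro exI[of _ "\<bar>K\<bar>"]) auto
qed (use assms in \<open>auto simp: L2_bilinear_form_def\<close>)

text \<open>For a symmetric form the solution is the minimizer of the energy \<open>E f = B f f - 2 l f\<close>.  By the
parallelogram identity and coercivity, a minimizing sequence is a Cauchy sequence.  The variational
equation is obtained by passing to the limit in the approximate minimality of the members of the
sequence.\<close>

lemma L2_Lax_Milgram:
  fixes B :: "(real \<Rightarrow> 'e::banach) \<Rightarrow> (real \<Rightarrow> 'e) \<Rightarrow> real"
  assumes B: "L2_bilinear_form a b B"
    and sym: "\<And>f g. f \<in> L2 a b \<Longrightarrow> g \<in> L2 a b \<Longrightarrow> B f g = B g f"
    and c: "0 < c" "\<And>f. f \<in> L2 a b \<Longrightarrow> c * (L2norm a b f)\<^sup>2 \<le> B f f"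
    and l: "L2_functional a b l"
  shows "\<exists>q\<in>L2 a b. \<forall>p\<in>L2 a b. B q p = l p"
proof -
  obtain K where K: "0 \<le> K" "\<And>f. f \<in> L2 a b \<Longrightarrow> \<bar>l f\<bar> \<le> K * L2norm a b f"
    using L2_functionalD(4)[OF l] by auto
  obtain k where k: "0 \<le> k" "\<And>f g. f \<in> L2 a b \<Longrightarrow> g \<in> L2 a b \<Longrightarrow> \<bar>B f g\<bar> \<le> k * L2norm a b f * L2norm a b g"
    using L2_bilinear_formD(3)[OF B] by auto
  define E where "E f = B f f - 2 * l f" for f
  define m where "m = Inf (E ` L2 a b)"
  have lower: "- (K\<^sup>2 / c) \<le> E f" if f: "f \<in> L2 a b" for f
  proof -
    let ?n = "L2norm a b f"
    have "0 \<le> (c * ?n - K)\<^sup>2 / c" using c by simp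
    also have "\<dots> = c * ?n\<^sup>2 - 2 * (K * ?n) + K\<^sup>2 / c"
      using c by (simp add: field_simps power2_eq_square)
    finally show ?thesis using c(2)[OF f] K(2)[OF f] by (simp add: E_def)
  qed
  have m: "m \<le> E f" if "f \<in> L2 a b" for f
    unfolding m_def using that lower by (intro cInf_lower) (auto intro!: bdd_belowI[of _ "- (K\<^sup>2 / c)"])
  have L2_ne: "L2 a b \<noteq> ({} :: (real \<Rightarrow> 'e) set)"
    using L2_zero by (rule ex_in_conv[THEN iffD1, OF exI])
  have "\<exists>f\<in>L2 a b. E f < m + 1 / (real n + 1)" for n
    using cInf_lessD[of "E ` L2 a b" "m + 1 / (real n + 1)"] L2_ne
    by (auto simp: m_def)
  then obtain f where f: "\<And>n. f n \<in> L2 a b" "\<And>n. E (f n) < m + 1 / (real n + 1)" by metis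
  have expand: "E (\<lambda>s. f s + t *\<^sub>R p s) = E f + 2 * t * (B f p - l p) + t\<^sup>2 * B p p"
    if f: "f \<in> L2 a b" and p: "p \<in> L2 a b" for f p t
  proof -
    note tp = L2_scaleR[OF p, of t] and ftp = L2_add[OF f L2_scaleR[OF p, of t]]
    note R = L2_functionalD(1,2)[OF L2_bilinear_formD(1)[OF B]]
    note L = L2_functionalD(1,2)[OF L2_bilinear_formD(2)[OF B]]
    have "B (\<lambda>s. f s + t *\<^sub>R p s) (\<lambda>s. f s + t *\<^sub>R p s)
        = B f f + t * B f p + (t * B p f + t * (t * B p p))"
      using L(1)[OF ftp f tp] R(1)[OF f f tp] R(2)[OF f p] R(1)[OF tp f tp] R(2)[OF tp p]
        L(2)[OF f p] L(2)[OF p p] by simp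
    moreover have "l (\<lambda>s. f s + t *\<^sub>R p s) = l f + t * l p"
      using L2_functionalD(1,2)[OF l] f p tp by simp
    ultimately show ?thesis
      using sym[OF f p] by (simp add: E_def power2_eq_square algebra_simps)
  qed
  have gap: "c * (L2norm a b (\<lambda>s. f i s - f j s))\<^sup>2 \<le> 2 / (real i + 1) + 2 / (real j + 1)" for i j
  proof -
    let ?d = "\<lambda>s. f i s - f j s"
    have d: "?d \<in> L2 a b" by (rule L2_diff[OF f(1) f(1)])
    \<comment> \<open>steps 1 and 1/2 from \<open>f j\<close> lead to \<open>f i\<close> and to the midpoint; together they give the parallelogram identity\<close>
    have e1: "E (\<lambda>s. f j s + 1 *\<^sub>R ?d s) = E (f j) + 2 * 1 * (B (f j) ?d - l ?d) + 1\<^sup>2 * B ?d ?d"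
      by (rule expand[OF f(1) d])
    have e2: "E (\<lambda>s. f j s + (1/2) *\<^sub>R ?d s) = E (f j) + 2 * (1/2) * (B (f j) ?d - l ?d) + (1/2)\<^sup>2 * B ?d ?d"
      by (rule expand[OF f(1) d])
    have "m \<le> E (\<lambda>s. f j s + (1/2) *\<^sub>R ?d s)"
      by (intro m L2_add L2_scaleR d f(1))
    with e1 e2 have "B ?d ?d \<le> 2 * E (f i) + 2 * E (f j) - 4 * m"
      by (simp add: power2_eq_square)
    also have "\<dots> \<le> 2 / (real i + 1) + 2 / (real j + 1)" using f(2)[of i] f(2)[of j] by simp
    finally show ?thesis using c(2)[OF d] by linarith
  qed
  have "\<exists>N. \<forall>i\<ge>N. \<forall>j\<ge>N. L2norm a b (\<lambda>s. f i s - f j s) \<le> \<epsilon>" if e: "0 < \<epsilon>" for \<epsilon>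
  proof -
    obtain N where N: "inverse (real (Suc N)) < c * \<epsilon>\<^sup>2 / 4"
      using reals_Archimedean[of "c * \<epsilon>\<^sup>2 / 4"] c e by auto
    show ?thesis
    proof (intro exI allI impI)
      fix i j assume ij: "N \<le> i" "N \<le> j"
      have "2 / (real i + 1) \<le> 2 * inverse (real (Suc N))" "2 / (real j + 1) \<le> 2 * inverse (real (Suc N))"
        using ij by (auto simp: field_simps)
      then have "c * (L2norm a b (\<lambda>s. f i s - f j s))\<^sup>2 \<le> c * \<epsilon>\<^sup>2" using gap[of i j] N by linarith
      then have "(L2norm a b (\<lambda>s. f i s - f j s))\<^sup>2 \<le> \<epsilon>\<^sup>2" using c by simp
      then show "L2norm a b (\<lambda>s. f i s - f j s) \<le> \<epsilon>" using e power2_le_imp_le by fastforce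
    qed
  qed
  from L2_complete[OF f(1) this] obtain q where q: "q \<in> L2 a b"
    "(\<lambda>n. L2norm a b (\<lambda>s. f n s - q s)) \<longlonglongrightarrow> 0" by auto
  have "B q p = l p" if p: "p \<in> L2 a b" for p
  proof -
    have "(\<lambda>n. B (f n) p - B q p) \<longlonglongrightarrow> 0"
    proof (rule Lim_null_comparison)
      show "(\<lambda>n. k * L2norm a b (\<lambda>s. f n s - q s) * L2norm a b p) \<longlonglongrightarrow> 0"
        using q(2) by (auto intro!: tendsto_eq_intros)
      have "\<bar>B (f n) p - B q p\<bar> \<le> k * L2norm a b (\<lambda>s. f n s - q s) * L2norm a b p" for n
        using L2_functionalD(3)[OF L2_bilinear_formD(2)[OF B p] f(1) q(1)] k(2)[OF L2_diff[OF f(1) q(1)] p]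
        by simp
      then show "\<forall>\<^sub>F n in sequentially. norm (B (f n) p - B q p) \<le> k * L2norm a b (\<lambda>s. f n s - q s) * L2norm a b p"
        by simp
    qed
    then have lim: "(\<lambda>n. B (f n) p) \<longlonglongrightarrow> B q p" by (rule Lim_null[THEN iffD2])
    define X Y where "X = B q p - l p" and "Y = B p p"
    have Y: "0 \<le> Y" using c(2)[OF p] c(1) unfolding Y_def
      by (meson mult_nonneg_nonneg order_trans less_imp_le zero_le_power2)
    have quad: "0 \<le> 2 * t * X + t\<^sup>2 * Y" for t
    proof (rule LIMSEQ_le_const)
      have L0: "(\<lambda>n. 1 / (real n + 1)) \<longlonglongrightarrow> 0"
        using LIMSEQ_inverse_real_of_nat by (simp add: inverse_eq_divide add.commute)
      have "(\<lambda>n. 2 * t * (B (f n) p - l p) + t\<^sup>2 * Y + 1 / (real n + 1)) \<longlonglongrightarrow> 2 * t * X + t\<^sup>2 * Y + 0"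
        unfolding X_def by (rule tendsto_add[OF _ L0]) (intro tendsto_intros lim)
      then show "(\<lambda>n. 2 * t * (B (f n) p - l p) + t\<^sup>2 * Y + 1 / (real n + 1)) \<longlonglongrightarrow> 2 * t * X + t\<^sup>2 * Y"
        by simp
      have "0 \<le> 2 * t * (B (f n) p - l p) + t\<^sup>2 * Y + 1 / (real n + 1)" for n
        using m[OF L2_add[OF f(1)[of n] L2_scaleR[OF p, of t]]] expand[OF f(1)[of n] p, of t] f(2)[of n]
        by (simp add: Y_def)
      then show "\<exists>N. \<forall>n\<ge>N. 0 \<le> 2 * t * (B (f n) p - l p) + t\<^sup>2 * Y + 1 / (real n + 1)" by auto
    qed
    \<comment> \<open>the step \<open>t = - X / (Y + 1)\<close> violates the inequality unless \<open>X = 0\<close>\<close>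
    define z where "z = X / (Y + 1)"
    have X: "X = z * (Y + 1)" using Y by (simp add: z_def)
    have "z\<^sup>2 * (Y + 2) \<le> 0"
      using quad[of "- z"] unfolding X by (simp add: power2_eq_square algebra_simps)
    then have "X = 0" using Y by (simp add: mult_le_0_iff X)
    then show ?thesis by (simp add: X_def)
  qed
  then show ?thesis using q(1) by auto
qed

section \<open>Smooth functions and the fundamental lemma of the calculus of variations\<close>

text \<open>Testing \<open>k\<close>-fold differentiability by choosing one derivative after the other, instead of iterating
\<open>deriv\<close>, makes the Leibniz rule a plain induction.\<close>

fun times_differentiable :: "nat \<Rightarrow> (real \<Rightarrow> real) \<Rightarrow> bool" where
  "times_differentiable 0 f \<longleftrightarrow> True"
| "times_differentiable (Suc n) f \<longleftrightarrow>
     (\<exists>f'. (\<forall>s. (f has_field_derivative f' s) (at s)) \<and> times_differentiable n f')"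

lemma times_differentiable_pred: "times_differentiable (Suc n) f \<Longrightarrow> times_differentiable n f"
  by (induction n arbitrary: f) auto

lemma times_differentiable_const: "times_differentiable n (\<lambda>_. c)"
proof (induction n arbitrary: c)
  case (Suc n)
  show ?case unfolding times_differentiable.simps using Suc.IH by (intro exI[of _ "\<lambda>_. 0"]) simp
qed simp

lemma times_differentiable_SucI:
  "(\<And>s. (f has_field_derivative f' s) (at s)) \<Longrightarrow> times_differentiable n f' \<Longrightarrow> times_differentiable (Suc n) f"
  by (simp only: times_differentiable.simps) blast

lemma times_differentiable_SucE:
  assumes "times_differentiable (Suc n) f"
  obtains f' where "\<forall>s. (f has_field_derivative f' s) (at s)" "times_differentiable n f'"
  using assms unfolding times_differentiable.simps by blast

lemma times_differentiable_add:
  "times_differentiable n f \<Longrightarrow> times_differentiable n g \<Longrightarrow> times_differentiable n (\<lambda>s. f s + g s)"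
proof (induction n arbitrary: f g)
  case (Suc n)
  obtain f' where f: "\<forall>s. (f has_field_derivative f' s) (at s)" "times_differentiable n f'"
    using Suc.prems(1) by (rule times_differentiable_SucE)
  obtain g' where g: "\<forall>s. (g has_field_derivative g' s) (at s)" "times_differentiable n g'"
    using Suc.prems(2) by (rule times_differentiable_SucE)
  show ?case
    by (rule times_differentiable_SucI[OF DERIV_add[OF f(1)[rule_format] g(1)[rule_format]] Suc.IH[OF f(2) g(2)]])
qed simp

lemma times_differentiable_mult:
  "times_differentiable n f \<Longrightarrow> times_differentiable n g \<Longrightarrow> times_differentiable n (\<lambda>s. f s * g s)"
proof (induction n arbitrary: f g)
  case (Suc n)
  obtain f' where f: "\<forall>s. (f has_field_derivative f' s) (at s)" "times_differentiable n f'"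
    using Suc.prems(1) by (rule times_differentiable_SucE)
  obtain g' where g: "\<forall>s. (g has_field_derivative g' s) (at s)" "times_differentiable n g'"
    using Suc.prems(2) by (rule times_differentiable_SucE)
  have "times_differentiable n (\<lambda>s. f' s * g s + g' s * f s)"
    by (intro times_differentiable_add Suc.IH f(2) g(2) Suc.prems[THEN times_differentiable_pred])
  with DERIV_mult[OF f(1)[rule_format] g(1)[rule_format]] show ?case by (rule times_differentiable_SucI)
qed simp

lemma times_differentiable_affine:
  "times_differentiable n f \<Longrightarrow> times_differentiable n (\<lambda>s. f (c * s + d))"
proof (induction n arbitrary: f)
  case (Suc n)
  obtain f' where f': "\<forall>s. (f has_field_derivative f' s) (at s)" "times_differentiable n f'"
    using Suc.prems(1) by (rule times_differentiable_SucE)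
  have "((\<lambda>s. f (c * s + d)) has_field_derivative f' (c * s + d) * c) (at s)" for s
    by (rule DERIV_chain2[OF f'(1)[rule_format]]) (auto intro!: derivative_eq_intros)
  moreover have "times_differentiable n (\<lambda>s. f' (c * s + d) * c)"
    by (intro times_differentiable_mult times_differentiable_const Suc.IH f'(2))
  ultimately show ?case by (rule times_differentiable_SucI)
qed simp

lemma times_differentiable_exp: "times_differentiable n (\<lambda>s. c * exp (\<mu> * s))"
proof (induction n arbitrary: c)
  case (Suc n)
  have "((\<lambda>s. c * exp (\<mu> * s)) has_field_derivative c * \<mu> * exp (\<mu> * s)) (at s)" for s
    by (auto intro!: derivative_eq_intros)
  then show ?case using Suc.IH by (rule times_differentiable_SucI)
qed simp

lemma smooth_iff_times_differentiable:
  "(\<forall>n s. (deriv ^^ n) \<phi> field_differentiable (at s)) \<longleftrightarrow> (\<forall>n. times_differentiable n \<phi>)"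
proof
  assume "\<forall>n s. (deriv ^^ n) \<phi> field_differentiable (at s)"
  then have "\<forall>k. times_differentiable n ((deriv ^^ k) \<phi>)" for n
  proof (induction n)
    case (Suc n)
    have "((deriv ^^ k) \<phi> has_field_derivative (deriv ^^ Suc k) \<phi> s) (at s)" for k s
      using Suc.prems by (simp add: DERIV_deriv_iff_field_differentiable)
    moreover have "times_differentiable n ((deriv ^^ Suc k) \<phi>)" for k using Suc by blast
    ultimately show ?case by (intro allI times_differentiable_SucI)
  qed simp
  then show "\<forall>n. times_differentiable n \<phi>" by (metis funpow_0)
next
  assume *: "\<forall>n. times_differentiable n \<phi>"
  have "(deriv ^^ n) \<phi> field_differentiable (at s)" if "times_differentiable (Suc n) \<phi>" for n s \<phi>
    using that
  proof (induction n arbitrary: \<phi>)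
    case 0
    then show ?case by (auto simp: field_differentiable_def elim!: times_differentiable_SucE)
  next
    case (Suc n)
    then obtain f' where f': "\<forall>s. (\<phi> has_field_derivative f' s) (at s)" "times_differentiable (Suc n) f'"
      by (metis times_differentiable_SucE)
    then have "deriv \<phi> = f'" using DERIV_imp_deriv by blast
    then show ?case using Suc.IH[OF f'(2)] by (simp add: funpow_Suc_right del: funpow.simps)
  qed
  with * show "\<forall>n s. (deriv ^^ n) \<phi> field_differentiable (at s)" by blast
qed

lemma test_functions_mult:
  assumes "\<phi> \<in> test_functions a b" and "\<And>n. times_differentiable n f"
  shows "(\<lambda>s. \<phi> s * f s) \<in> test_functions a b"
proof -
  obtain c d where cd: "a < c" "d < b" "\<And>s. s \<notin> {c..d} \<Longrightarrow> \<phi> s = 0" and "\<And>n. times_differentiable n \<phi>"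
    using assms(1) unfolding test_functions_def smooth_iff_times_differentiable by blast
  then have "\<forall>n. times_differentiable n (\<lambda>s. \<phi> s * f s)"
    using assms(2) by (intro allI times_differentiable_mult)
  moreover have "\<forall>s. s \<notin> {c..d} \<longrightarrow> \<phi> s * f s = 0" using cd by simp
  ultimately show ?thesis
    using cd(1,2) unfolding test_functions_def smooth_iff_times_differentiable by blast
qed

lemma test_functions_deriv:
  assumes "\<phi> \<in> test_functions a b"
  shows "(\<phi> has_field_derivative deriv \<phi> s) (at s)"
    and "continuous_on UNIV \<phi>" and "continuous_on UNIV (deriv \<phi>)"
proof -
  have *: "(deriv ^^ n) \<phi> field_differentiable (at s)" for n s
    using assms by (simp add: test_functions_def)
  show "(\<phi> has_field_derivative deriv \<phi> s) (at s)"
    using *[of 0] by (simp add: DERIV_deriv_iff_field_differentiable)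
  show "continuous_on UNIV \<phi>"
    using *[of 0] by (auto intro!: continuous_at_imp_continuous_on field_differentiable_imp_continuous_at)
  show "continuous_on UNIV (deriv \<phi>)"
    using *[of 1] by (auto intro!: continuous_at_imp_continuous_on field_differentiable_imp_continuous_at)
qed

text \<open>The functions \<open>p(1/x) e\<^sup>-\<^sup>1\<^sup>/\<^sup>x\<close>, extended by 0 to \<open>x \<le> 0\<close>, with polynomials \<open>p\<close>.  The family is closed
under differentiation, so each member, and in particular the one with \<open>p = 1\<close>, is smooth.\<close>

definition flat :: "real poly \<Rightarrow> real \<Rightarrow> real" where
  "flat p x = (if 0 < x then poly p (1 / x) * exp (- (1 / x)) else 0)"

lemma poly_times_exp_tendsto_0: "((\<lambda>y. poly p y * exp (- y)) \<longlongrightarrow> 0) (at_top :: real filter)"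
proof -
  have "((\<lambda>y. \<Sum>i\<le>degree p. coeff p i * (y ^ i / exp y)) \<longlongrightarrow> (\<Sum>i\<le>degree p. coeff p i * 0)) (at_top :: real filter)"
    by (intro tendsto_sum tendsto_mult tendsto_const tendsto_power_div_exp_0)
  then show ?thesis by (simp add: poly_altdef sum_distrib_right exp_minus divide_inverse mult.assoc)
qed

lemma flat_tendsto_0: "(flat p \<longlongrightarrow> 0) (at 0)"
proof -
  have "((\<lambda>x. poly p (inverse x) * exp (- inverse x)) \<longlongrightarrow> 0) (at_right (0::real))"
    by (rule filterlim_compose[OF poly_times_exp_tendsto_0 filterlim_inverse_at_top_right])
  then have "(flat p \<longlongrightarrow> 0) (at_right 0)"
    by (rule Lim_transform_eventually)
       (auto simp: flat_def eventually_at_right_field inverse_eq_divide intro!: exI[of _ 1])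
  moreover have "(flat p \<longlongrightarrow> 0) (at_left 0)"
    by (rule Lim_transform_eventually[OF tendsto_const])
       (auto simp: flat_def eventually_at_left_field intro!: exI[of _ "-1"])
  ultimately show ?thesis by (simp add: filterlim_split_at)
qed

lemma flat_has_derivative: "(flat p has_field_derivative flat ([:0, 0, 1:] * (p - pderiv p)) x) (at x)"
proof -
  consider "x < 0" | "x = 0" | "0 < x" by linarith
  then show ?thesis
  proof cases
    case 1
    have "((\<lambda>_. 0) has_field_derivative 0) (at x)" by simp
    then have "(flat p has_field_derivative 0) (at x)"
      by (rule has_field_derivative_transform_within_open[where S = "{..<0}"]) (use 1 in \<open>auto simp: flat_def\<close>)
    then show ?thesis using 1 by (simp add: flat_def)
  next
    case 2
    have "((\<lambda>h. flat ([:0, 1:] * p) h) \<longlongrightarrow> 0) (at 0)" by (rule flat_tendsto_0)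
    then have "((\<lambda>h. flat p h / h) \<longlongrightarrow> 0) (at 0)"
      by (rule Lim_transform_eventually) (auto simp: flat_def intro!: always_eventually)
    then show ?thesis using 2 by (simp add: DERIV_def flat_def)
  next
    case 3
    have "((\<lambda>x. poly p (1 / x) * exp (- (1 / x))) has_field_derivative
        poly ([:0, 0, 1:] * (p - pderiv p)) (1 / x) * exp (- (1 / x))) (at x)"
      using 3 by (auto intro!: derivative_eq_intros poly_DERIV[THEN DERIV_chain2]
          simp: field_simps power2_eq_square)
    then have "(flat p has_field_derivative poly ([:0, 0, 1:] * (p - pderiv p)) (1 / x) * exp (- (1 / x))) (at x)"
      by (rule has_field_derivative_transform_within_open[where S = "{0<..}"]) (use 3 in \<open>auto simp: flat_def\<close>)
    then show ?thesis using 3 by (simp add: flat_def)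
  qed
qed

lemma times_differentiable_flat: "times_differentiable n (flat p)"
proof (induction n arbitrary: p)
  case (Suc n)
  show ?case by (rule times_differentiable_SucI[OF flat_has_derivative Suc.IH])
qed simp

text \<open>The two factors are positive precisely for \<open>s > c + 1/(n+1)\<close> and for \<open>s < d - 1/(n+1)\<close>.  So the support
lies strictly inside \<open>(c,d)\<close>, even if \<open>c\<close> and \<open>d\<close> are the end points of the time interval, and
increases to \<open>(c,d)\<close> as \<open>n \<rightarrow> \<infinity>\<close>.\<close>

definition bump :: "real \<Rightarrow> real \<Rightarrow> nat \<Rightarrow> real \<Rightarrow> real" where
  "bump c d n s = flat 1 (real (Suc n) * s + (- real (Suc n) * c - 1)) * flat 1 (- real (Suc n) * s + (real (Suc n) * d - 1))"

lemma bump_test_function: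
  assumes "a \<le> c" "d \<le> b"
  shows "bump c d n \<in> test_functions a b"
proof -
  have "bump c d n s = 0" if "s \<notin> {c + 1 / real (Suc n) .. d - 1 / real (Suc n)}" for s
  proof -
    have "s < c + 1 / real (Suc n) \<or> d - 1 / real (Suc n) < s" using that by auto
    then have "real (Suc n) * s + (- real (Suc n) * c - 1) \<le> 0 \<or> - real (Suc n) * s + (real (Suc n) * d - 1) \<le> 0"
      by (auto simp: field_simps)
    then show ?thesis by (auto simp: bump_def flat_def)
  qed
  moreover have "times_differentiable k (bump c d n)" for k
    unfolding bump_def by (intro times_differentiable_mult times_differentiable_affine times_differentiable_flat)
  moreover have "0 < 1 / real (Suc n)" by simp
  then have "a < c + 1 / real (Suc n)" "d - 1 / real (Suc n) < b" using assms by linarith+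
  ultimately show ?thesis
    unfolding test_functions_def smooth_iff_times_differentiable by blast
qed

lemma flat_1_bounds: "0 \<le> flat 1 x" "flat 1 x \<le> 1"
  by (auto simp: flat_def)

lemma bump_bound: "\<bar>bump c d n s\<bar> \<le> 1"
  unfolding bump_def abs_mult
  by (intro mult_le_one abs_ge_zero) (simp_all only: abs_of_nonneg flat_1_bounds)

lemma bump_tendsto_indicator: "(\<lambda>n. bump c d n s) \<longlonglongrightarrow> indicator {c<..<d} s"
proof (cases "s \<in> {c<..<d}")
  case True
  have one: "(flat 1 \<longlongrightarrow> 1) at_top"
  proof -
    have "((\<lambda>x::real. exp (- inverse x)) \<longlongrightarrow> exp (- 0)) at_top"
      by (intro tendsto_intros tendsto_inverse_0_at_top filterlim_ident)
    then have "((\<lambda>x::real. exp (- inverse x)) \<longlongrightarrow> 1) at_top" by simp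
    then show ?thesis
      by (rule Lim_transform_eventually)
         (use eventually_gt_at_top[of 0] in eventually_elim, auto simp: flat_def inverse_eq_divide)
  qed
  have lim: "filterlim (\<lambda>n. real (Suc n) * y - 1) at_top sequentially" if "0 < y" for y
    using that
    by (intro filterlim_tendsto_add_at_top[of "\<lambda>_. -1" "-1", simplified] filterlim_at_top_mult_tendsto_pos[OF tendsto_const]
        filterlim_compose[OF filterlim_real_sequentially filterlim_Suc]) auto
  have "(\<lambda>n. flat 1 (real (Suc n) * (s - c) - 1) * flat 1 (real (Suc n) * (d - s) - 1)) \<longlonglongrightarrow> 1 * 1"
    using True by (intro tendsto_mult filterlim_compose[OF one] lim) auto
  moreover have "real (Suc n) * (s - c) - 1 = real (Suc n) * s + (- real (Suc n) * c - 1)"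
    "real (Suc n) * (d - s) - 1 = - real (Suc n) * s + (real (Suc n) * d - 1)" for n by (simp_all add: algebra_simps)
  ultimately show ?thesis using True by (simp only: bump_def) simp
next
  case False
  have "bump c d n s = 0" for n
  proof -
    have "real (Suc n) * (s - c) \<le> 0 \<or> real (Suc n) * (d - s) \<le> 0"
      using False by (auto simp: mult_le_0_iff)
    then have "real (Suc n) * s + (- real (Suc n) * c - 1) \<le> 0 \<or> - real (Suc n) * s + (real (Suc n) * d - 1) \<le> 0"
      by (auto simp: algebra_simps)
    then show ?thesis by (auto simp: bump_def flat_def)
  qed
  then show ?thesis using False by simp
qed


lemma measurable_lebesgue_onI: "f \<in> borel_measurable borel \<Longrightarrow> f \<in> borel_measurable (lebesgue_on {a..b::real})"
  by (intro measurable_restrict_space1 measurable_completion) simp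

lemma AE_lebesgue_on_noteq: "AE s in lebesgue_on {a..b::real}. s \<noteq> c"
proof -
  have "AE s in lebesgue. s \<noteq> c" by (rule AE_completion[OF AE_lborel_singleton])
  then show ?thesis by (auto simp: AE_restrict_space_iff elim: eventually_mono)
qed

text \<open>By dominated convergence along the bump functions, the integral of \<open>f\<close> over every open interval
vanishes.  Intervals generate the Borel sets and are stable under intersection, so the integral of \<open>f\<close>
over every Borel set vanishes.\<close>

lemma fundamental_lemma:
  fixes f :: "real \<Rightarrow> real"
  assumes f: "integrable (lebesgue_on {a..b}) f"
    and zero: "\<And>\<phi>. \<phi> \<in> test_functions a b \<Longrightarrow> (LINT s|lebesgue_on {a..b}. \<phi> s * f s) = 0"
  shows "AE s in lebesgue_on {a..b}. f s = 0"
proof -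
  let ?M = "lebesgue_on {a..b}"
  note [measurable] = borel_measurable_integrable[OF f]
  have inner: "(LINT s|?M. indicator {c<..<d} s * f s) = 0" if cd: "a \<le> c" "d \<le> b" for c d
  proof -
    have bm: "bump c d n \<in> borel_measurable ?M" for n
      by (intro measurable_lebesgue_onI borel_measurable_continuous_onI
          test_functions_deriv(2)[OF bump_test_function[OF cd]])
    have "(\<lambda>n. LINT s|?M. bump c d n s * f s) \<longlonglongrightarrow> (LINT s|?M. indicator {c<..<d} s * f s)"
    proof (rule integral_dominated_convergence[where w = "\<lambda>s. norm (f s)"])
      show "(\<lambda>s. indicator {c<..<d} s * f s) \<in> borel_measurable ?M"
        by (intro borel_measurable_times measurable_lebesgue_onI[of "indicator _"]) auto
      show "(\<lambda>s. bump c d n s * f s) \<in> borel_measurable ?M" for n using bm by simp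
      show "integrable ?M (\<lambda>s. norm (f s))" using f by simp
      show "AE s in ?M. (\<lambda>n. bump c d n s * f s) \<longlonglongrightarrow> indicator {c<..<d} s * f s"
        by (intro AE_I2 tendsto_mult bump_tendsto_indicator tendsto_const)
      show "AE s in ?M. norm (bump c d n s * f s) \<le> norm (f s)" for n
        by (intro AE_I2) (simp add: abs_mult mult_left_le_one_le bump_bound)
    qed
    then show ?thesis
      using zero[OF bump_test_function[OF cd]] by (simp add: LIMSEQ_const_iff)
  qed
  \<comment> \<open>extension by 0, so that all Borel sets of the line can be used\<close>
  define F where "F s = (if s \<in> {a..b} then f s else 0)" for s
  have F: "integrable lebesgue F" unfolding F_def using f by (subst Lebesgue_Measure.integrable_restrict_UNIV) auto
  have interval: "(LINT s:{c<..<d}|lebesgue. F s) = 0" for c d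
  proof -
    have "(LINT s:{c<..<d}|lebesgue. F s) = (LINT s|lebesgue. (if s \<in> {a..b} then indicator {c<..<d} s * f s else 0))"
      unfolding set_lebesgue_integral_def by (intro Bochner_Integration.integral_cong) (auto simp: F_def)
    also have "\<dots> = (LINT s|?M. indicator {c<..<d} s * f s)"
      by (rule Lebesgue_Measure.integral_restrict_UNIV) simp
    also have "\<dots> = (LINT s|?M. indicator {max a c<..<min b d} s * f s)"
    proof (rule integral_cong_AE)
      show "AE s in ?M. indicator {c<..<d} s * f s = indicator {max a c<..<min b d} s * f s"
        using AE_lebesgue_on_noteq[where a=a and b=b and c=a] AE_lebesgue_on_noteq[where a=a and b=b and c=b] AE_space
        by eventually_elim (auto simp: indicator_def)
    qed (auto intro!: borel_measurable_times measurable_lebesgue_onI[of "indicator _"])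
    also have "\<dots> = 0" by (rule inner) auto
    finally show ?thesis .
  qed
  have total: "(LINT s|lebesgue. F s) = 0"
  proof -
    have "(LINT s|lebesgue. F s) = (LINT s:{a-1<..<b+1}|lebesgue. F s)"
      unfolding set_lebesgue_integral_def
      by (intro Bochner_Integration.integral_cong) (auto simp: F_def indicator_def)
    then show ?thesis using interval by simp
  qed
  have si: "set_integrable lebesgue A F" if "A \<in> sets lebesgue" for A
    using integrable_mult_indicator[OF that F] by (simp add: set_integrable_def)
  have beq: "sets borel = sigma_sets UNIV (range (\<lambda>(c, d). {c<..<d::real}))"
    using arg_cong[OF borel_eq_box[where 'a=real], of sets] by simp
  have borel: "(LINT s:A|lebesgue. F s) = 0" if "A \<in> sets borel" for A
  proof -
    have "Int_stable (range (\<lambda>(c, d). {c<..<d::real}))"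
      by (auto simp: Int_stable_def)
    moreover have "range (\<lambda>(c, d). {c<..<d::real}) \<subseteq> Pow UNIV" by simp
    moreover have "A \<in> sigma_sets UNIV (range (\<lambda>(c, d). {c<..<d::real}))"
      using that by (simp only: beq)
    ultimately show ?thesis
    proof (induction rule: sigma_sets_induct_disjoint)
      case (basic A)
      then show ?case using interval by auto
    next
      case empty
      then show ?case by (simp add: set_lebesgue_integral_def)
    next
      case (compl A)
      then have "A \<in> sets lebesgue"
        by (simp add: beq[symmetric])
      then have "(LINT s:A \<union> (UNIV - A)|lebesgue. F s) = (LINT s:A|lebesgue. F s) + (LINT s:UNIV - A|lebesgue. F s)"
        by (intro set_integral_Un si) auto
      then show ?case using compl total by (simp add: set_lebesgue_integral_def)
    next
      case (union A)
      then have "A i \<in> sets lebesgue" for i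
        by (auto simp: beq[symmetric])
      then have "(LINT s:(\<Union>i. A i)|lebesgue. F s) = (\<Sum>i. LINT s:A i|lebesgue. F s)"
        using union by (intro lebesgue_integral_countable_add si) (auto simp: disjoint_family_on_def)
      then show ?case using union by simp
    qed
  qed
  have "AE s in lebesgue. F s = 0"
  proof (rule density_unique_real[OF F])
    fix A :: "real set" assume A: "A \<in> sets lebesgue"
    have fsigma_borel: "C \<in> sets borel" if "fsigma C" for C :: "real set"
      using that by (induction rule: fsigma.induct) (auto intro!: sets.countable_UN)
    obtain C T where CT: "fsigma C" "T \<in> null_sets lebesgue" "C \<union> T = A" "disjnt C T"
      using lebesgue_set_almost_fsigma[OF A] by metis
    \<comment> \<open>a Lebesgue set is a Borel set up to a null set\<close>
    have Cl: "C \<in> sets lebesgue" using fsigma_borel[OF CT(1)] by simp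
    note [measurable] = borel_measurable_integrable[OF F]
    have "(LINT s:A|lebesgue. F s) = (LINT s:C|lebesgue. F s)"
      unfolding set_lebesgue_integral_def
    proof (rule integral_cong_AE)
      have "AE s in lebesgue. s \<notin> T"
        using CT(2) by (simp add: AE_not_in)
      then show "AE s in lebesgue. indicator A s *\<^sub>R F s = indicator C s *\<^sub>R F s"
        by eventually_elim (use CT(3) in \<open>auto simp: indicator_def\<close>)
    qed (use A Cl in simp_all)
    also have "\<dots> = 0" using CT(1) by (simp add: borel fsigma_borel)
    finally show "(LINT s:A|lebesgue. F s) = (LINT s:A|lebesgue. 0)" by (simp add: set_lebesgue_integral_def)
  qed simp
  then show ?thesis
    by (auto simp: AE_restrict_space_iff F_def elim!: eventually_mono)
qed

section \<open>Weak derivatives and traces under an exponential weight\<close>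

lemma Hdual_apply [simp]:
  assumes "bounded_linear j"
  shows "blinfun_apply (Hdual j h) w = inner h (j w)"
proof -
  have "bounded_linear (\<lambda>v. inner h (j v))"
    by (rule bounded_linear_inner_right_comp[OF assms])
  then show ?thesis by (simp add: Hdual_def bounded_linear_Blinfun_apply)
qed

text \<open>Boundedness of \<open>Vdual j\<close> is needed here because \<open>Blinfun\<close> is specified only on bounded linear maps.\<close>

lemma Vdual_apply [simp]:
  assumes j: "bounded_linear j"
  shows "blinfun_apply (blinfun_apply (Vdual j) v) w = inner (j v) (j w)"
proof -
  obtain c where c: "0 < c" "\<And>v. norm (j v) \<le> norm v * c"
    using bounded_linear.pos_bounded[OF j] by auto
  have "bounded_linear (\<lambda>v. Hdual j (j v))"
  proof (rule bounded_linear_intro)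
    show "Hdual j (j (x + y)) = Hdual j (j x) + Hdual j (j y)" for x y
      by (rule blinfun_eqI) (simp add: j bounded_linear.linear linear_add blinfun.add_left inner_add_left)
    show "Hdual j (j (r *\<^sub>R x)) = r *\<^sub>R Hdual j (j x)" for r x
      by (rule blinfun_eqI) (simp add: j bounded_linear.linear linear_scale blinfun.scaleR_left)
    show "norm (Hdual j (j x)) \<le> norm x * (c * c)" for x
    proof (rule norm_blinfun_bound)
      fix w
      have "norm (blinfun_apply (Hdual j (j x)) w) \<le> norm (j x) * norm (j w)"
        using j Cauchy_Schwarz_ineq2 by simp
      also have "\<dots> \<le> (norm x * c) * (norm w * c)" using c by (intro mult_mono) auto
      finally show "norm (blinfun_apply (Hdual j (j x)) w) \<le> norm x * (c * c) * norm w" by (simp add: mult_ac)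
    qed (use c in auto)
  qed
  then show ?thesis by (simp add: Vdual_def bounded_linear_Blinfun_apply j)
qed

lemma L2_const: "(\<lambda>_. w) \<in> L2 a b"
proof -
  have "strongly_measurable (lebesgue_on {a..b}) (\<lambda>_::real. w)"
    by (auto simp: strongly_measurable_def intro!: exI[of _ "{w}"])
  then show ?thesis by (simp add: L2_iff)
qed

lemma integrable_mult_continuous:
  fixes f :: "real \<Rightarrow> real"
  assumes \<phi>: "continuous_on {a..b} \<phi>" and f: "integrable (lebesgue_on {a..b}) f"
  shows "integrable (lebesgue_on {a..b}) (\<lambda>s. \<phi> s * f s)"
proof -
  have "compact (\<phi> ` {a..b})" by (intro compact_continuous_image \<phi>) simp
  then obtain C where C: "\<And>s. s \<in> {a..b} \<Longrightarrow> \<bar>\<phi> s\<bar> \<le> C"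
    by (metis bounded_iff compact_imp_bounded imageI real_norm_def)
  have [measurable]: "\<phi> \<in> borel_measurable (lebesgue_on {a..b})"
    by (rule continuous_imp_measurable_on_sets_lebesgue[OF \<phi>]) simp
  note [measurable] = borel_measurable_integrable[OF f]
  show ?thesis
  proof (rule Bochner_Integration.integrable_bound)
    show "integrable (lebesgue_on {a..b}) (\<lambda>s. C * \<bar>f s\<bar>)" using f by simp
    have "norm (\<phi> s * f s) \<le> norm (C * \<bar>f s\<bar>)" if "s \<in> {a..b}" for s
      using mult_right_mono[OF order_trans[OF C[OF that] abs_ge_self] abs_ge_zero[of "f s"]]
      by (simp add: abs_mult)
    then show "AE s in lebesgue_on {a..b}. norm (\<phi> s * f s) \<le> norm (C * \<bar>f s\<bar>)"
      by (intro AE_I2) simp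
  qed simp
qed

text \<open>Tested with a fixed \<open>w \<in> V\<close>, the difference of two weak derivatives vanishes outside a null set by the
fundamental lemma.  A countable dense set of \<open>w\<close> makes the null set independent of \<open>w\<close>.\<close>

lemma weak_deriv_unique:
  fixes j :: "'v::{real_normed_vector,second_countable_topology} \<Rightarrow> 'h::real_inner"
  assumes g: "g \<in> L2 a b" "is_weak_deriv j a b v g" and h: "h \<in> L2 a b" "is_weak_deriv j a b v h"
  shows "AE s in lebesgue_on {a..b}. g s = h s"
proof -
  obtain D :: "'v set" where D: "countable D" "\<And>X. open X \<Longrightarrow> X \<noteq> {} \<Longrightarrow> \<exists>d\<in>D. d \<in> X"
    using countable_dense_setE by blast
  have dense: "x \<in> closure D" for x
    using D(2) unfolding closure_iff_nhds_not_empty by (metis disjoint_iff empty_iff subsetD)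
  have "AE s in lebesgue_on {a..b}. blinfun_apply (g s - h s) w = 0" for w
  proof (rule fundamental_lemma)
    note i = L2_pairing(1)[OF _ L2_const[of w a b]]
    show "integrable (lebesgue_on {a..b}) (\<lambda>s. blinfun_apply (g s - h s) w)"
      by (rule i[OF L2_diff[OF g(1) h(1)]])
    fix \<phi> assume \<phi>: "\<phi> \<in> test_functions a b"
    have c: "continuous_on {a..b} \<phi>"
      using continuous_on_subset[OF test_functions_deriv(2)[OF \<phi>]] by auto
    show "(LINT s|lebesgue_on {a..b}. \<phi> s * blinfun_apply (g s - h s) w) = 0"
      using g(2) h(2) \<phi> integrable_mult_continuous[OF c i[OF g(1)]] integrable_mult_continuous[OF c i[OF h(1)]]
      by (simp add: is_weak_deriv_def blinfun.diff_left right_diff_distrib)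
  qed
  then have "AE s in lebesgue_on {a..b}. \<forall>w\<in>D. blinfun_apply (g s - h s) w = 0"
    by (simp add: AE_ball_countable[OF D(1)])
  then show ?thesis
  proof eventually_elim
    case (elim s)
    have "blinfun_apply (g s - h s) w = 0" for w
    proof (rule continuous_constant_on_closure[OF _ _ dense])
      show "continuous_on (closure D) (\<lambda>w. blinfun_apply (g s - h s) w)" by (intro continuous_intros)
    qed (use elim in auto)
    then have "g s - h s = 0" by (intro blinfun_eqI) simp
    then show ?case by simp
  qed
qed

lemma weak_deriv_in:
  assumes "v \<in> W j a b"
  shows "weak_deriv j a b v \<in> L2 a b" "is_weak_deriv j a b v (weak_deriv j a b v)"
  using assms someI_ex[of "\<lambda>g. g \<in> L2 a b \<and> is_weak_deriv j a b v g"]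
  by (auto simp: W_def weak_deriv_def)

lemma exp_weight_L2:
  assumes "f \<in> L2 a b"
  shows "exp_weight \<mu> f \<in> L2 a b"
proof -
  have "\<bar>exp (\<mu> * s)\<bar> \<le> exp (\<bar>\<mu>\<bar> * (\<bar>a\<bar> + \<bar>b\<bar>))" if "s \<in> {a..b}" for s
  proof -
    have "\<mu> * s \<le> \<bar>\<mu>\<bar> * \<bar>s\<bar>" by (metis abs_ge_self abs_mult)
    also have "\<dots> \<le> \<bar>\<mu>\<bar> * (\<bar>a\<bar> + \<bar>b\<bar>)" using that by (intro mult_left_mono) auto
    finally show ?thesis by simp
  qed
  then show ?thesis
    unfolding exp_weight_def using assms
    by (intro L2_weight(1)[of _ a b f "exp (\<bar>\<mu>\<bar> * (\<bar>a\<bar> + \<bar>b\<bar>))"] measurable_lebesgue_onI) auto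
qed

lemma exp_weight_exp_weight [simp]: "exp_weight (- \<mu>) (exp_weight \<mu> f) = f"
  by (simp add: exp_weight_def mult_exp_exp)

text \<open>The weight is moved to the test function: \<open>\<phi> e\<^sup>\<mu>\<^sup>t\<close> is a test function with derivative
\<open>\<phi>' e\<^sup>\<mu>\<^sup>t + \<mu> \<phi> e\<^sup>\<mu>\<^sup>t\<close>, and the second summand produces the perturbation \<open>\<mu> e\<^sup>\<mu>\<^sup>t v\<close>, which acts on \<open>V\<close>
through the inner product of \<open>H\<close>.\<close>

lemma is_weak_deriv_exp_weight:
  fixes j :: "'v::real_normed_vector \<Rightarrow> 'h::real_inner"
  assumes j: "bounded_linear j" and v: "v \<in> L2 a b" and g: "g \<in> L2 a b" "is_weak_deriv j a b v g"
  shows "is_weak_deriv j a b (exp_weight \<mu> v)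
    (\<lambda>s. exp_weight \<mu> g s + \<mu> *\<^sub>R blinfun_apply (Vdual j) (exp_weight \<mu> v s))"
  unfolding is_weak_deriv_def
proof (intro ballI allI)
  fix \<phi> :: "real \<Rightarrow> real" and w :: 'v
  assume \<phi>: "\<phi> \<in> test_functions a b"
  let ?M = "lebesgue_on {a..b}" and ?e = "\<lambda>s. exp (\<mu> * s)"
  let ?\<psi> = "\<lambda>s. \<phi> s * ?e s"
  have \<psi>: "?\<psi> \<in> test_functions a b"
    using times_differentiable_exp[of _ 1 \<mu>] by (intro test_functions_mult[OF \<phi>]) simp
  have d\<psi>: "deriv ?\<psi> s = deriv \<phi> s * ?e s + \<mu> * (\<phi> s * ?e s)" for s
    by (rule DERIV_imp_deriv)
       (auto intro!: derivative_eq_intros test_functions_deriv(1)[OF \<phi>])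
  note c\<phi> = continuous_on_subset[OF test_functions_deriv(2)[OF \<phi>], of "{a..b}"]
    and cd\<phi> = continuous_on_subset[OF test_functions_deriv(3)[OF \<phi>], of "{a..b}"]
  have ig: "integrable ?M (\<lambda>s. blinfun_apply (g s) w)"
    by (rule L2_pairing(1)[OF g(1) L2_const])
  have iv: "integrable ?M (\<lambda>s. inner (j (v s)) (j w))"
  proof -
    obtain c where "0 < c" "\<And>v. norm (j v) \<le> c * norm v"
      using bounded_linear.pos_bounded[OF j] by (auto simp: mult.commute)
    then show ?thesis
      using L2_inner(1)[OF L2_linear_image(1)[OF j v] L2_const] by (meson less_imp_le)
  qed
  have 1: "integrable ?M (\<lambda>s. ?\<psi> s * blinfun_apply (g s) w)"
    by (rule integrable_mult_continuous[OF _ ig]) (intro continuous_intros c\<phi>, auto)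
  have 2: "integrable ?M (\<lambda>s. ?\<psi> s * inner (j (v s)) (j w))"
    by (rule integrable_mult_continuous[OF _ iv]) (intro continuous_intros c\<phi>, auto)
  have 3: "integrable ?M (\<lambda>s. (deriv \<phi> s * ?e s) * inner (j (v s)) (j w))"
    by (rule integrable_mult_continuous[OF _ iv]) (intro continuous_intros cd\<phi>, auto)
  have "(LINT s|?M. \<phi> s * blinfun_apply (exp_weight \<mu> g s + \<mu> *\<^sub>R blinfun_apply (Vdual j) (exp_weight \<mu> v s)) w)
      = (LINT s|?M. ?\<psi> s * blinfun_apply (g s) w + \<mu> * (?\<psi> s * inner (j (v s)) (j w)))"
    by (intro Bochner_Integration.integral_cong)
       (simp_all add: exp_weight_def blinfun.add_left blinfun.scaleR_left j bounded_linear.linear linear_scale algebra_simps)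
  also have "\<dots> = (LINT s|?M. ?\<psi> s * blinfun_apply (g s) w) + \<mu> * (LINT s|?M. ?\<psi> s * inner (j (v s)) (j w))"
    using 1 2 by simp
  also have "(LINT s|?M. ?\<psi> s * blinfun_apply (g s) w) = - (LINT s|?M. deriv ?\<psi> s * inner (j (v s)) (j w))"
    using g(2)[unfolded is_weak_deriv_def, rule_format, OF \<psi>] .
  also have "(LINT s|?M. deriv ?\<psi> s * inner (j (v s)) (j w))
      = (LINT s|?M. (deriv \<phi> s * ?e s) * inner (j (v s)) (j w)) + \<mu> * (LINT s|?M. ?\<psi> s * inner (j (v s)) (j w))"
    unfolding d\<psi> using 2 3 by (simp add: distrib_right mult.assoc)
  also have "(LINT s|?M. (deriv \<phi> s * ?e s) * inner (j (v s)) (j w))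
      = (LINT s|?M. deriv \<phi> s * inner (j (exp_weight \<mu> v s)) (j w))"
    by (intro Bochner_Integration.integral_cong)
       (simp_all add: exp_weight_def j bounded_linear.linear linear_scale)
  finally show "(LINT s|?M. \<phi> s * blinfun_apply (exp_weight \<mu> g s + \<mu> *\<^sub>R blinfun_apply (Vdual j) (exp_weight \<mu> v s)) w)
      = - (LINT s|?M. deriv \<phi> s * inner (j (exp_weight \<mu> v s)) (j w))" by simp
qed

lemma blinfun_image_L2: "f \<in> L2 a b \<Longrightarrow> (\<lambda>s. blinfun_apply F (f s)) \<in> L2 a b"
  using L2_linear_image(1)[OF blinfun.bounded_linear_right, of f a b "norm F" F] norm_blinfun by auto

lemma exp_weight_W:
  fixes j :: "'v::{real_normed_vector,second_countable_topology} \<Rightarrow> 'h::real_inner"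
  assumes j: "bounded_linear j" and v: "v \<in> W j a b"
  shows "exp_weight \<mu> v \<in> W j a b"
    and "AE s in lebesgue_on {a..b}. weak_deriv j a b (exp_weight \<mu> v) s
      = exp_weight \<mu> (weak_deriv j a b v) s + \<mu> *\<^sub>R blinfun_apply (Vdual j) (exp_weight \<mu> v s)"
proof -
  have vL: "v \<in> L2 a b" using v by (simp add: W_def)
  let ?g = "\<lambda>s. exp_weight \<mu> (weak_deriv j a b v) s + \<mu> *\<^sub>R blinfun_apply (Vdual j) (exp_weight \<mu> v s)"
  have g: "?g \<in> L2 a b"
    by (intro L2_add L2_scaleR blinfun_image_L2 exp_weight_L2 weak_deriv_in(1) v vL)
  note wd = is_weak_deriv_exp_weight[OF j vL weak_deriv_in[OF v], of \<mu>]
  show W: "exp_weight \<mu> v \<in> W j a b"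
    using exp_weight_L2[OF vL] g wd unfolding W_def by blast
  show "AE s in lebesgue_on {a..b}. weak_deriv j a b (exp_weight \<mu> v) s = ?g s"
    by (rule weak_deriv_unique[OF weak_deriv_in[OF W] g wd])
qed

text \<open>Two continuous functions that differ at a point differ on an interval of positive measure around it.\<close>

lemma H_repr_unique:
  assumes "H_repr j a b v w1" "H_repr j a b v w2" "a < b" "s \<in> {a..b}"
  shows "w1 s = w2 s"
proof (rule ccontr)
  assume ne: "w1 s \<noteq> w2 s"
  have c: "continuous_on {a..b} (\<lambda>r. dist (w1 r) (w2 r))"
    using assms(1,2) by (intro continuous_intros) (auto simp: H_repr_def)
  then obtain \<delta> where \<delta>: "\<delta> > 0"
    "\<And>r. r \<in> {a..b} \<Longrightarrow> dist r s < \<delta> \<Longrightarrow> dist (dist (w1 r) (w2 r)) (dist (w1 s) (w2 s)) < dist (w1 s) (w2 s)"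
    using assms(4) ne unfolding continuous_on_iff by (metis zero_less_dist_iff)
  have ne': "w1 r \<noteq> w2 r" if "r \<in> {a..b}" "dist r s < \<delta>" for r
    using \<delta>(2)[OF that] by auto
  define c d where "c = max a (s - \<delta> / 2)" and "d = min b (s + \<delta> / 2)"
  have cd: "c < d" "{c..d} \<subseteq> {a..b}"
    using assms(3,4) \<delta>(1) by (auto simp: c_def d_def)
  have "AE r in lebesgue_on {a..b}. w1 r = w2 r"
    using assms(1,2) unfolding H_repr_def by auto
  then have "AE r in lebesgue_on {c..d}. w1 r = w2 r"
    by (rule AE_lebesgue_on_subinterval[OF cd(2)])
  then have "AE r in lebesgue_on {c..d}. False"
    using AE_space
  proof eventually_elim
    case (elim r)
    then have "r \<in> {a..b}" "dist r s < \<delta>" using cd \<delta>(1) by (auto simp: c_def d_def dist_real_def)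
    then show ?case using ne' elim by blast
  qed
  then have "space (lebesgue_on {c..d}) \<in> null_sets (lebesgue_on {c..d})"
    by (subst AE_iff_null_sets) auto
  then have "emeasure (lebesgue_on {c..d}) {c..d} = 0" by (simp add: null_sets_def)
  then show False using cd by (simp add: emeasure_restrict_space)
qed

text \<open>Multiplication by the weight and its inverse maps continuous representatives to continuous
representatives, so either both sides have one or both values are the default 0.\<close>

lemma H_value_exp_weight:
  assumes j: "bounded_linear j" and ab: "a < b" and s: "s \<in> {a..b}"
  shows "H_value j a b (exp_weight \<mu> v) s = exp (\<mu> * s) *\<^sub>R H_value j a b v s"
proof -
  have repr: "H_repr j a b (exp_weight \<mu> v) (exp_weight \<mu> w)" if "H_repr j a b v w" for v w \<mu>
    using that unfolding H_repr_def exp_weight_def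
    by (auto intro!: continuous_intros elim!: eventually_mono simp: linear_scale bounded_linear.linear[OF j])
  show ?thesis
  proof (cases "\<exists>w. H_repr j a b v w")
    case True
    then obtain w where w: "H_repr j a b v w" by blast
    have *: "H_value j a b v s = w s" if "H_repr j a b v w" for v w
      using H_repr_unique[OF someI[of "H_repr j a b v", OF that] that ab s] that
      by (auto simp: H_value_def)
    show ?thesis using *[OF w] *[OF repr[OF w]] by (simp add: exp_weight_def)
  next
    case False
    then have "\<nexists>w. H_repr j a b (exp_weight \<mu> v) w"
      using repr[of "exp_weight \<mu> v" _ "- \<mu>"] by auto
    with False show ?thesis by (simp add: H_value_def)
  qed
qed

section \<open>Locality in time of the derivatives of the cost functional\<close>

text \<open>A directional derivative depends only on the increments along the direction.  With \<open>w1 = w2\<close> this is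
uniqueness of the derivative; with different base points it expresses that a perturbation elsewhere
in time does not change the derivative.\<close>

lemma L2_deriv_cong_direction:
  assumes D1: "L2_has_derivative T F w1 D1" and D2: "L2_has_derivative T F w2 D2" and g: "g \<in> L2 0 T"
    and eq: "\<And>t. F (\<lambda>s. w1 s + t *\<^sub>R g s) - F w1 = F (\<lambda>s. w2 s + t *\<^sub>R g s) - F w2"
  shows "D1 g = D2 g"
proof -
  let ?n = "L2norm 0 T g"
  have le: "\<bar>D1 g - D2 g\<bar> \<le> 2 * \<epsilon> * ?n" if e: "0 < \<epsilon>" for \<epsilon>
  proof -
    have rem: "\<exists>\<delta>>0. \<forall>h\<in>L2 0 T. L2norm 0 T h < \<delta> \<longrightarrow> \<bar>F (\<lambda>s. w s + h s) - F w - D h\<bar> \<le> \<epsilon> * L2norm 0 T h"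
      if "L2_has_derivative T F w D" for w D
      using that e unfolding L2_has_derivative_def by simp
    obtain \<delta>1 where d1: "0 < \<delta>1" "\<And>h. h \<in> L2 0 T \<Longrightarrow> L2norm 0 T h < \<delta>1 \<Longrightarrow>
        \<bar>F (\<lambda>s. w1 s + h s) - F w1 - D1 h\<bar> \<le> \<epsilon> * L2norm 0 T h"
      using rem[OF D1] by auto
    obtain \<delta>2 where d2: "0 < \<delta>2" "\<And>h. h \<in> L2 0 T \<Longrightarrow> L2norm 0 T h < \<delta>2 \<Longrightarrow>
        \<bar>F (\<lambda>s. w2 s + h s) - F w2 - D2 h\<bar> \<le> \<epsilon> * L2norm 0 T h"
      using rem[OF D2] by auto
    note d = d1(1) d2(1) d1(2) d2(2)
    define t where "t = min \<delta>1 \<delta>2 / (?n + 1)"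
    have np: "0 < ?n + 1" by (simp add: add_nonneg_pos)
    have t: "0 < t" using d np by (simp add: t_def)
    have "t * ?n < t * (?n + 1)" using t by simp
    also have "\<dots> = min \<delta>1 \<delta>2" using np by (simp add: t_def)
    finally have small: "L2norm 0 T (\<lambda>s. t *\<^sub>R g s) < \<delta>1" "L2norm 0 T (\<lambda>s. t *\<^sub>R g s) < \<delta>2"
      using t by (simp_all add: L2norm_scaleR)
    have fn: "L2_functional 0 T D1" "L2_functional 0 T D2"
      using D1 D2 unfolding L2_has_derivative_def by simp_all
    note lin = L2_functionalD(2)[OF fn(1) g, of t] L2_functionalD(2)[OF fn(2) g, of t]
    have "\<bar>t * D1 g - t * D2 g\<bar> \<le> \<epsilon> * (t * ?n) + \<epsilon> * (t * ?n)"
      using d(3)[OF L2_scaleR[OF g] small(1)] d(4)[OF L2_scaleR[OF g] small(2)] eq[of t] t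
      unfolding lin L2norm_scaleR by (simp add: abs_le_iff)
    moreover have "\<bar>t * D1 g - t * D2 g\<bar> = t * \<bar>D1 g - D2 g\<bar>"
      using t by (simp add: abs_mult flip: right_diff_distrib)
    ultimately have "t * \<bar>D1 g - D2 g\<bar> \<le> t * (2 * \<epsilon> * ?n)" by (simp add: algebra_simps)
    then show ?thesis using t by simp
  qed
  have "\<bar>D1 g - D2 g\<bar> \<le> 0 + e" if "0 < e" for e
  proof -
    have np: "0 < ?n + 1" by (simp add: add_nonneg_pos)
    have "\<bar>D1 g - D2 g\<bar> \<le> 2 * (e / (2 * (?n + 1))) * ?n"
      using that np by (intro le) simp
    also have "\<dots> \<le> e" using that np by (simp add: field_simps)
    finally show ?thesis by simp
  qed
  then have "\<bar>D1 g - D2 g\<bar> \<le> 0" by (rule field_le_epsilon)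
  then show ?thesis by simp
qed

lemma L2_deriv_has_derivative:
  "L2_has_derivative T F w D \<Longrightarrow> L2_has_derivative T F w (L2_deriv T F w)"
  unfolding L2_deriv_def by (rule someI[of "L2_has_derivative T F w"])

lemma L2_deriv_eq:
  assumes "L2_has_derivative T F w D" "g \<in> L2 0 T"
  shows "L2_deriv T F w g = D g"
  by (rule L2_deriv_cong_direction[OF L2_deriv_has_derivative[OF assms(1)] assms]) simp

lemma L2_C2D:
  assumes "L2_C2 T F" "w \<in> L2 0 T"
  shows "L2_has_derivative T F w (L2_deriv T F w)" "L2_has_derivative2 T F w (L2_deriv2 T F w)"
  using assms L2_deriv_has_derivative someI_ex[of "L2_has_derivative2 T F w"]
  unfolding L2_C2_def L2_deriv2_def by blast+

text \<open>By the assumption on the increments, moving the base point along \<open>f\<close> does not change the derivative in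
direction \<open>g\<close>.  So the difference quotient that defines the second derivative vanishes, and only the
remainder term is left, which is of higher order in \<open>f\<close>.\<close>

lemma L2_deriv2_disjoint:
  assumes C2: "L2_C2 T F" and w: "w \<in> L2 0 T" and f: "f \<in> L2 0 T" and g: "g \<in> L2 0 T"
    and local: "\<And>t r. F (\<lambda>s. (w s + t *\<^sub>R f s) + r *\<^sub>R g s) - F (\<lambda>s. w s + t *\<^sub>R f s) = F (\<lambda>s. w s + r *\<^sub>R g s) - F w"
  shows "L2_deriv2 T F w f g = 0"
proof -
  let ?B = "L2_deriv2 T F w"
  have B: "L2_bilinear_form 0 T ?B"
    and rem: "\<And>\<epsilon>. 0 < \<epsilon> \<Longrightarrow> \<exists>\<delta>>0. \<forall>h\<in>L2 0 T. L2norm 0 T h < \<delta> \<longrightarrow> (\<forall>g\<in>L2 0 T.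
        \<bar>L2_deriv T F (\<lambda>s. w s + h s) g - L2_deriv T F w g - ?B h g\<bar> \<le> \<epsilon> * L2norm 0 T h * L2norm 0 T g)"
    using L2_C2D(2)[OF C2 w] unfolding L2_has_derivative2_def by auto
  let ?n = "L2norm 0 T f" and ?m = "L2norm 0 T g"
  have le: "\<bar>?B f g\<bar> \<le> \<epsilon> * ?n * ?m" if e: "0 < \<epsilon>" for \<epsilon>
  proof -
    obtain \<delta> where d: "0 < \<delta>" "\<And>h. h \<in> L2 0 T \<Longrightarrow> L2norm 0 T h < \<delta> \<Longrightarrow>
        \<bar>L2_deriv T F (\<lambda>s. w s + h s) g - L2_deriv T F w g - ?B h g\<bar> \<le> \<epsilon> * L2norm 0 T h * ?m"
      using rem[OF e] g by blast
    define t where "t = \<delta> / (?n + 1)"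
    have np: "0 < ?n + 1" by (simp add: add_nonneg_pos)
    have t: "0 < t" using d np by (simp add: t_def)
    have "t * ?n < t * (?n + 1)" using t by simp
    also have "\<dots> = \<delta>" using np by (simp add: t_def)
    finally have small: "L2norm 0 T (\<lambda>s. t *\<^sub>R f s) < \<delta>" using t by (simp add: L2norm_scaleR)
    have "L2_deriv T F (\<lambda>s. w s + t *\<^sub>R f s) g = L2_deriv T F w g"
      by (rule L2_deriv_cong_direction[OF L2_C2D(1)[OF C2 L2_add[OF w L2_scaleR[OF f]]] L2_C2D(1)[OF C2 w] g local])
    moreover have "?B (\<lambda>s. t *\<^sub>R f s) g = t * ?B f g"
      by (rule L2_functionalD(2)[OF L2_bilinear_formD(2)[OF B g] f])
    ultimately have "\<bar>t * ?B f g\<bar> \<le> \<epsilon> * (t * ?n) * ?m"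
      using d(2)[OF L2_scaleR[OF f] small] t by (simp add: L2norm_scaleR)
    then have "t * \<bar>?B f g\<bar> \<le> t * (\<epsilon> * ?n * ?m)" using t by (simp add: abs_mult mult_ac)
    then show ?thesis using t by simp
  qed
  have "\<bar>?B f g\<bar> \<le> 0 + e" if "0 < e" for e
  proof -
    have np: "0 < ?n * ?m + 1" by (simp add: add_nonneg_pos)
    have "\<bar>?B f g\<bar> \<le> (e / (?n * ?m + 1)) * ?n * ?m"
      using that np by (intro le) simp
    also have "\<dots> \<le> e" using that np by (simp add: field_simps)
    finally show ?thesis by simp
  qed
  then have "\<bar>?B f g\<bar> \<le> 0" by (rule field_le_epsilon)
  then show ?thesis by simp
qed

lemma L2_indicator:
  assumes "f \<in> L2 a b" "A \<in> sets borel"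
  shows "(\<lambda>s. indicator A s *\<^sub>R f s) \<in> L2 a b"
    and "L2norm a b (\<lambda>s. indicator A s *\<^sub>R f s) \<le> L2norm a b f"
  using L2_weight[of "indicator A" a b f 1] assms
  by (auto simp: measurable_lebesgue_onI)

text \<open>Both sides equal the form evaluated at the two restrictions to \<open>A\<close>, because the restrictions to \<open>A\<close> and
to its complement do not interact.\<close>

lemma local_form_commutes_indicator:
  fixes B :: "(real \<Rightarrow> 'e::real_normed_vector) \<Rightarrow> (real \<Rightarrow> 'e) \<Rightarrow> real"
  assumes B: "L2_bilinear_form a b B"
    and local: "\<And>f g. f \<in> L2 a b \<Longrightarrow> g \<in> L2 a b \<Longrightarrow> (\<forall>s. f s = 0 \<or> g s = 0) \<Longrightarrow> B f g = 0"
    and f: "f \<in> L2 a b" and g: "g \<in> L2 a b" and A: "A \<in> sets borel"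
  shows "B (\<lambda>s. indicator A s *\<^sub>R f s) g = B f (\<lambda>s. indicator A s *\<^sub>R g s)"
proof -
  have nA: "- A \<in> sets borel" using A by (simp add: Compl_eq_Diff_UNIV)
  note L = L2_indicator(1)[OF _ A] L2_indicator(1)[OF _ nA]
  have split: "(\<lambda>s. indicator A s *\<^sub>R h s + indicator (- A) s *\<^sub>R h s) = h" for h :: "real \<Rightarrow> 'e"
    by (auto simp: indicator_def)
  have "B (\<lambda>s. indicator A s *\<^sub>R f s) g
      = B (\<lambda>s. indicator A s *\<^sub>R f s) (\<lambda>s. indicator A s *\<^sub>R g s)
        + B (\<lambda>s. indicator A s *\<^sub>R f s) (\<lambda>s. indicator (- A) s *\<^sub>R g s)"
    using L2_functionalD(1)[OF L2_bilinear_formD(1)[OF B L(1)[OF f]] L(1)[OF g] L(2)[OF g]]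
    by (simp only: split)
  also have "B (\<lambda>s. indicator A s *\<^sub>R f s) (\<lambda>s. indicator (- A) s *\<^sub>R g s) = 0"
    by (rule local[OF L(1)[OF f] L(2)[OF g]]) (auto simp: indicator_def)
  finally have 1: "B (\<lambda>s. indicator A s *\<^sub>R f s) g = B (\<lambda>s. indicator A s *\<^sub>R f s) (\<lambda>s. indicator A s *\<^sub>R g s)"
    by simp
  have "B f (\<lambda>s. indicator A s *\<^sub>R g s)
      = B (\<lambda>s. indicator A s *\<^sub>R f s) (\<lambda>s. indicator A s *\<^sub>R g s)
        + B (\<lambda>s. indicator (- A) s *\<^sub>R f s) (\<lambda>s. indicator A s *\<^sub>R g s)"
    using L2_functionalD(1)[OF L2_bilinear_formD(2)[OF B L(1)[OF g]] L(1)[OF f] L(2)[OF f]]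
    by (simp only: split)
  also have "B (\<lambda>s. indicator (- A) s *\<^sub>R f s) (\<lambda>s. indicator A s *\<^sub>R g s) = 0"
    by (rule local[OF L(2)[OF f] L(1)[OF g]]) (auto simp: indicator_def)
  finally show ?thesis using 1 by simp
qed

text \<open>The step functions are members of \<open>L\<^sub>2\<close> as well; this is part of the induction, since additivity of the
form is known only there.\<close>

lemma local_form_commutes_step:
  fixes A :: "'i \<Rightarrow> real set"
    and B :: "(real \<Rightarrow> 'e::real_normed_vector) \<Rightarrow> (real \<Rightarrow> 'e) \<Rightarrow> real"
  assumes B: "L2_bilinear_form a b B"
    and local: "\<And>f g. f \<in> L2 a b \<Longrightarrow> g \<in> L2 a b \<Longrightarrow> (\<forall>s. f s = 0 \<or> g s = 0) \<Longrightarrow> B f g = 0"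
    and f: "f \<in> L2 a b" and g: "g \<in> L2 a b" and fin: "finite I" and A: "\<And>i. A i \<in> sets borel"
  shows "(\<lambda>s. (\<Sum>i\<in>I. c i * indicator (A i) s) *\<^sub>R f s) \<in> L2 a b \<and>
    (\<lambda>s. (\<Sum>i\<in>I. c i * indicator (A i) s) *\<^sub>R g s) \<in> L2 a b \<and>
    B (\<lambda>s. (\<Sum>i\<in>I. c i * indicator (A i) s) *\<^sub>R f s) g = B f (\<lambda>s. (\<Sum>i\<in>I. c i * indicator (A i) s) *\<^sub>R g s)"
  using fin
proof induction
  case empty
  have "B (\<lambda>_. 0) g = 0" "B f (\<lambda>_. 0) = 0" by (auto intro!: local f g)
  then show ?case by simp
next
  case (insert i I)
  let ?S = "\<lambda>s. \<Sum>i\<in>I. c i * indicator (A i) s"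
  have eq: "(\<lambda>s. (\<Sum>i\<in>insert i I. c i * indicator (A i) s) *\<^sub>R h s)
      = (\<lambda>s. c i *\<^sub>R (indicator (A i) s *\<^sub>R h s) + ?S s *\<^sub>R h s)" for h :: "real \<Rightarrow> 'e"
    by (simp only: sum.insert[OF insert.hyps] scaleR_left_distrib scaleR_scaleR)
  note iL = L2_indicator(1)[OF _ A[of i]]
  note R = L2_functionalD(1,2)[OF L2_bilinear_formD(1)[OF B f]]
  note L = L2_functionalD(1,2)[OF L2_bilinear_formD(2)[OF B g]]
  have bf: "B (\<lambda>s. c i *\<^sub>R (indicator (A i) s *\<^sub>R f s) + ?S s *\<^sub>R f s) g
      = c i * B (\<lambda>s. indicator (A i) s *\<^sub>R f s) g + B (\<lambda>s. ?S s *\<^sub>R f s) g"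
    using L(1)[OF L2_scaleR[OF iL[OF f]]] L(2)[OF iL[OF f]] insert.IH by simp
  have bg: "B f (\<lambda>s. c i *\<^sub>R (indicator (A i) s *\<^sub>R g s) + ?S s *\<^sub>R g s)
      = c i * B f (\<lambda>s. indicator (A i) s *\<^sub>R g s) + B f (\<lambda>s. ?S s *\<^sub>R g s)"
    using R(1)[OF L2_scaleR[OF iL[OF g]]] R(2)[OF iL[OF g]] insert.IH by simp
  have ind: "B (\<lambda>s. indicator (A i) s *\<^sub>R f s) g = B f (\<lambda>s. indicator (A i) s *\<^sub>R g s)"
    by (rule local_form_commutes_indicator[OF B local f g A])
  show ?case
    unfolding eq bf bg ind
    using insert.IH L2_add[OF L2_scaleR[OF iL[OF f]]] L2_add[OF L2_scaleR[OF iL[OF g]]]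
    by (intro conjI) (blast, blast, simp)
qed

text \<open>The weight is approximated uniformly, within \<open>1/N\<close>, by the step function \<open>\<lfloor>N \<omega>\<rfloor> / N\<close>, and the form is
bounded.\<close>

lemma local_form_commutes_weight:
  fixes B :: "(real \<Rightarrow> 'e::real_normed_vector) \<Rightarrow> (real \<Rightarrow> 'e) \<Rightarrow> real"
  assumes B: "L2_bilinear_form a b B"
    and local: "\<And>f g. f \<in> L2 a b \<Longrightarrow> g \<in> L2 a b \<Longrightarrow> (\<forall>s. f s = 0 \<or> g s = 0) \<Longrightarrow> B f g = 0"
    and f: "f \<in> L2 a b" and g: "g \<in> L2 a b"
    and w: "\<omega> \<in> borel_measurable borel" "\<And>s. s \<in> {a..b} \<Longrightarrow> \<bar>\<omega> s\<bar> \<le> C"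
  shows "B (\<lambda>s. \<omega> s *\<^sub>R f s) g = B f (\<lambda>s. \<omega> s *\<^sub>R g s)"
proof -
  obtain k where k: "0 \<le> k" "\<And>f g. f \<in> L2 a b \<Longrightarrow> g \<in> L2 a b \<Longrightarrow> \<bar>B f g\<bar> \<le> k * L2norm a b f * L2norm a b g"
    using L2_bilinear_formD(3)[OF B] by auto
  have wL: "(\<lambda>s. \<omega> s *\<^sub>R h s) \<in> L2 a b" if "h \<in> L2 a b" for h :: "real \<Rightarrow> 'e"
    using w by (intro L2_weight(1)[of _ a b h "\<bar>C\<bar>"] measurable_lebesgue_onI that)
       (auto intro: order_trans[OF w(2) abs_ge_self])
  let ?X = "B (\<lambda>s. \<omega> s *\<^sub>R f s) g - B f (\<lambda>s. \<omega> s *\<^sub>R g s)"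
  let ?q = "2 * k * L2norm a b f * L2norm a b g"
  have le: "\<bar>?X\<bar> \<le> ?q * inverse (real (Suc n))" for n
  proof -
    define N where "N = real (Suc n)"
    have N: "0 < N" by (simp add: N_def)
    define A where "A i = {s. \<lfloor>N * \<omega> s\<rfloor> = i}" for i :: int
    have A: "A i \<in> sets borel" for i
    proof -
      have "(\<lambda>s. N * \<omega> s) \<in> borel_measurable borel" using w(1) by simp
      then have m: "(\<lambda>s. \<lfloor>N * \<omega> s\<rfloor>) \<in> measurable borel (count_space UNIV)" by measurable
      have "(\<lambda>s. \<lfloor>N * \<omega> s\<rfloor>) -` {i} \<inter> space borel \<in> sets borel"
        by (rule measurable_sets[OF m]) simp
      then show ?thesis by (simp add: A_def vimage_def)
    qed
    define I where "I = {- \<lceil>N * \<bar>C\<bar>\<rceil> - 1 .. \<lceil>N * \<bar>C\<bar>\<rceil> + 1}"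
    define \<sigma> where "\<sigma> s = (\<Sum>i\<in>I. (of_int i / N) * indicator (A i) s)" for s
    have close: "\<bar>\<omega> s - \<sigma> s\<bar> \<le> inverse N" if s: "s \<in> {a..b}" for s
    proof -
      have "\<bar>N * \<omega> s\<bar> \<le> N * \<bar>C\<bar>" using w(2)[OF s] N by (auto simp: abs_mult)
      then have mem: "\<lfloor>N * \<omega> s\<rfloor> \<in> I" unfolding I_def by (simp add: abs_le_iff) linarith
      have "\<sigma> s = (\<Sum>i\<in>I. if i = \<lfloor>N * \<omega> s\<rfloor> then of_int i / N else 0)"
        unfolding \<sigma>_def by (intro sum.cong) (auto simp: A_def)
      also have "\<dots> = of_int \<lfloor>N * \<omega> s\<rfloor> / N" using mem by (simp add: I_def)
      finally have "\<omega> s - \<sigma> s = (N * \<omega> s - of_int \<lfloor>N * \<omega> s\<rfloor>) / N" using N by (simp add: field_simps)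
      moreover have "0 \<le> N * \<omega> s - of_int \<lfloor>N * \<omega> s\<rfloor>" "N * \<omega> s - of_int \<lfloor>N * \<omega> s\<rfloor> \<le> 1" by linarith+
      ultimately show ?thesis using N by (simp add: field_simps)
    qed
    have fin: "finite I" by (simp add: I_def)
    have "(\<lambda>s. \<sigma> s *\<^sub>R f s) \<in> L2 a b \<and> (\<lambda>s. \<sigma> s *\<^sub>R g s) \<in> L2 a b \<and>
      B (\<lambda>s. \<sigma> s *\<^sub>R f s) g = B f (\<lambda>s. \<sigma> s *\<^sub>R g s)"
      unfolding \<sigma>_def by (rule local_form_commutes_step[OF B local f g fin A])
    then have \<sigma>: "(\<lambda>s. \<sigma> s *\<^sub>R f s) \<in> L2 a b" "(\<lambda>s. \<sigma> s *\<^sub>R g s) \<in> L2 a b"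
      "B (\<lambda>s. \<sigma> s *\<^sub>R f s) g = B f (\<lambda>s. \<sigma> s *\<^sub>R g s)" by auto
    have \<sigma>m: "\<sigma> \<in> borel_measurable borel" unfolding \<sigma>_def using A by (intro borel_measurable_sum) auto
    have n: "L2norm a b (\<lambda>s. (\<omega> s - \<sigma> s) *\<^sub>R h s) \<le> inverse N * L2norm a b h" if "h \<in> L2 a b" for h :: "real \<Rightarrow> 'e"
      using N w(1) \<sigma>m close by (intro L2_weight(2) measurable_lebesgue_onI that) auto
    have f': "\<bar>B (\<lambda>s. \<omega> s *\<^sub>R f s) g - B (\<lambda>s. \<sigma> s *\<^sub>R f s) g\<bar> \<le> k * (inverse N * L2norm a b f) * L2norm a b g"
    proof -
      have "B (\<lambda>s. \<omega> s *\<^sub>R f s) g - B (\<lambda>s. \<sigma> s *\<^sub>R f s) g = B (\<lambda>s. (\<omega> s - \<sigma> s) *\<^sub>R f s) g"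
        using L2_functionalD(3)[OF L2_bilinear_formD(2)[OF B g] wL[OF f] \<sigma>(1)] by (simp add: scaleR_left_diff_distrib)
      also have "\<bar>\<dots>\<bar> \<le> k * L2norm a b (\<lambda>s. (\<omega> s - \<sigma> s) *\<^sub>R f s) * L2norm a b g"
        using L2_diff[OF wL[OF f] \<sigma>(1)] by (intro k(2) g) (simp add: scaleR_left_diff_distrib)
      also have "\<dots> \<le> k * (inverse N * L2norm a b f) * L2norm a b g"
        by (intro mult_right_mono mult_left_mono n f k(1) L2norm_nonneg)
      finally show ?thesis .
    qed
    have g': "\<bar>B f (\<lambda>s. \<omega> s *\<^sub>R g s) - B f (\<lambda>s. \<sigma> s *\<^sub>R g s)\<bar> \<le> k * L2norm a b f * (inverse N * L2norm a b g)"
    proof -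
      have "B f (\<lambda>s. \<omega> s *\<^sub>R g s) - B f (\<lambda>s. \<sigma> s *\<^sub>R g s) = B f (\<lambda>s. (\<omega> s - \<sigma> s) *\<^sub>R g s)"
        using L2_functionalD(3)[OF L2_bilinear_formD(1)[OF B f] wL[OF g] \<sigma>(2)] by (simp add: scaleR_left_diff_distrib)
      also have "\<bar>\<dots>\<bar> \<le> k * L2norm a b f * L2norm a b (\<lambda>s. (\<omega> s - \<sigma> s) *\<^sub>R g s)"
        using L2_diff[OF wL[OF g] \<sigma>(2)] by (intro k(2) f) (simp add: scaleR_left_diff_distrib)
      also have "\<dots> \<le> k * L2norm a b f * (inverse N * L2norm a b g)"
        by (intro mult_left_mono n g mult_nonneg_nonneg k(1) L2norm_nonneg)
      finally show ?thesis .
    qed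
    have "\<bar>?X\<bar> \<le> k * (inverse N * L2norm a b f) * L2norm a b g + k * L2norm a b f * (inverse N * L2norm a b g)"
      using f' g' \<sigma>(3) by linarith
    also have "\<dots> = ?q * inverse N" by (simp add: algebra_simps)
    finally show ?thesis by (simp add: N_def)
  qed
  have "\<bar>?X\<bar> \<le> 0"
  proof (rule LIMSEQ_le_const)
    have "(\<lambda>n. ?q * inverse (real (Suc n))) \<longlonglongrightarrow> ?q * 0"
      by (intro tendsto_mult tendsto_const LIMSEQ_inverse_real_of_nat)
    then show "(\<lambda>n. ?q * inverse (real (Suc n))) \<longlonglongrightarrow> 0" by simp
  qed (use le in auto)
  then show ?thesis by simp
qed

lemma pr_L2:
  assumes "v \<in> L2 a b" "q \<in> L2 a b"
  shows "pr v q \<in> L2 a b"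
proof -
  have 1: "(\<lambda>s. (v s, 0 :: 'b)) \<in> L2 a b"
    by (rule L2_linear_image(1)[OF _ assms(1), of "\<lambda>y. (y, 0)" 1]) (auto intro: bounded_linear_Pair bounded_linear_ident bounded_linear_zero)
  have 2: "(\<lambda>s. (0 :: 'a, q s)) \<in> L2 a b"
    by (rule L2_linear_image(1)[OF _ assms(2), of "\<lambda>y. (0, y)" 1]) (auto intro: bounded_linear_Pair bounded_linear_ident bounded_linear_zero)
  show ?thesis using L2_add[OF 1 2] by (simp add: pr_def)
qed

lemma L2norm_pr [simp]: "L2norm a b (pr v (\<lambda>_. 0)) = L2norm a b v" "L2norm a b (pr (\<lambda>_. 0) q) = L2norm a b q"
  by (simp_all add: L2norm_def pr_def)

lemma exp_weight_pr: "exp_weight \<mu> (pr v q) = pr (exp_weight \<mu> v) (exp_weight \<mu> q)"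
  by (simp add: exp_weight_def pr_def)

lemma exp_weight_zero [simp]: "exp_weight \<mu> (\<lambda>_. 0) = (\<lambda>_. 0)"
  by (simp add: exp_weight_def)

text \<open>The identity already holds for the integrands at every time, because one of the two perturbations
vanishes there.\<close>

lemma cost_functional_local:
  assumes reg: "ocp_regular P T" and w: "w \<in> L2 0 T" and f: "f \<in> L2 0 T" and g: "g \<in> L2 0 T"
    and disj: "\<forall>s. f s = 0 \<or> g s = 0"
  shows "cost_functional P T (\<lambda>s. (w s + f s) + g s) - cost_functional P T (\<lambda>s. w s + f s)
    = cost_functional P T (\<lambda>s. w s + g s) - cost_functional P T w"
proof -
  have i: "integrable (lebesgue_on {0..T}) (\<lambda>s. cost P s (h s))" if "h \<in> L2 0 T" for h
    using reg that by (simp add: ocp_regular_def)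
  have "cost P s (w s + f s + g s) - cost P s (w s + f s) = cost P s (w s + g s) - cost P s (w s)" for s
    using disj[rule_format, of s] by auto
  then show ?thesis
    using i[OF L2_add[OF L2_add[OF w f] g]] i[OF L2_add[OF w f]] i[OF L2_add[OF w g]] i[OF w]
    unfolding cost_functional_def by (simp flip: Bochner_Integration.integral_diff)
qed

lemma cost_deriv2_exp_weight:
  assumes reg: "ocp_regular P T" and w: "w \<in> L2 0 T" and f: "f \<in> L2 0 T" and g: "g \<in> L2 0 T"
  shows "L2_deriv2 T (cost_functional P T) w (exp_weight \<mu> f) g
    = L2_deriv2 T (cost_functional P T) w f (exp_weight \<mu> g)"
proof -
  have C2: "L2_C2 T (cost_functional P T)" using reg by (simp add: ocp_regular_def)
  have B: "L2_bilinear_form 0 T (L2_deriv2 T (cost_functional P T) w)"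
    using L2_C2D(2)[OF C2 w] by (simp add: L2_has_derivative2_def)
  have local: "L2_deriv2 T (cost_functional P T) w f g = 0"
    if "f \<in> L2 0 T" "g \<in> L2 0 T" "\<forall>s. f s = 0 \<or> g s = 0" for f g
    by (rule L2_deriv2_disjoint[OF C2 w that(1,2)] cost_functional_local[OF reg w] L2_scaleR that(1,2))+
       (use that(3) in auto)
  have "\<bar>exp (\<mu> * s)\<bar> \<le> exp (\<bar>\<mu>\<bar> * T)" if "s \<in> {0..T}" for s
    using that by (auto intro!: mult_mono)
  then show ?thesis
    unfolding exp_weight_def by (intro local_form_commutes_weight[OF B local f g]) auto
qed

lemma cost_functional_truncate:
  assumes reg: "ocp_regular P T" and w: "w \<in> L2 0 T" and h: "h \<in> L2 0 T" and \<tau>: "\<tau> \<le> T"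
  shows "cost_functional P \<tau> (\<lambda>s. w s + h s) - cost_functional P \<tau> w
    = cost_functional P T (\<lambda>s. w s + indicator {0..\<tau>} s *\<^sub>R h s) - cost_functional P T w"
proof -
  have i: "integrable (lebesgue_on {0..T}) (\<lambda>s. cost P s (h s))" if "h \<in> L2 0 T" for h
    using reg that by (simp add: ocp_regular_def)
  have sub: "{0..\<tau>} \<subseteq> {0..T}" using \<tau> by auto
  note iw = i[OF w] and iwh = i[OF L2_add[OF w h]]
    and iwt = i[OF L2_add[OF w L2_indicator(1)[OF h]], of "{0..\<tau>}"]
  have "cost_functional P \<tau> (\<lambda>s. w s + h s) - cost_functional P \<tau> w
      = (LINT s|lebesgue_on {0..\<tau>}. cost P s (w s + h s) - cost P s (w s))"
    unfolding cost_functional_def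
    using lebesgue_on_subinterval(1)[OF sub iwh] lebesgue_on_subinterval(1)[OF sub iw] by simp
  also have "\<dots> = (LINT s|lebesgue_on {0..T}. indicator {0..\<tau>} s *\<^sub>R (cost P s (w s + h s) - cost P s (w s)))"
    using iwh iw by (intro lebesgue_on_subinterval(2)[OF sub]) simp
  also have "\<dots> = (LINT s|lebesgue_on {0..T}. cost P s (w s + indicator {0..\<tau>} s *\<^sub>R h s) - cost P s (w s))"
    by (intro Bochner_Integration.integral_cong) (auto simp: indicator_def)
  also have "\<dots> = cost_functional P T (\<lambda>s. w s + indicator {0..\<tau>} s *\<^sub>R h s) - cost_functional P T w"
    unfolding cost_functional_def using iwt iw by simp
  finally show ?thesis .
qed

text \<open>The increments of \<open>I\<^sup>\<tau>\<close> are those of \<open>J\<close> along truncated directions, so the truncated derivative of \<open>J\<close>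
is a derivative of \<open>I\<^sup>\<tau>\<close>, and the derivative is unique.\<close>

lemma cost_deriv_truncate:
  assumes reg: "ocp_regular P T" and w: "w \<in> L2 0 T" and h: "h \<in> L2 0 T" and \<tau>: "\<tau> \<le> T"
  shows "L2_deriv T (cost_functional P \<tau>) w h
    = L2_deriv T (cost_functional P T) w (\<lambda>s. indicator {0..\<tau>} s *\<^sub>R h s)"
proof -
  let ?D = "L2_deriv T (cost_functional P T) w" and ?c = "\<lambda>h s. indicator {0..\<tau>} s *\<^sub>R h s"
  have C2: "L2_C2 T (cost_functional P T)" using reg by (simp add: ocp_regular_def)
  have D: "L2_has_derivative T (cost_functional P T) w ?D" by (rule L2_C2D(1)[OF C2 w])
  then have fD: "L2_functional 0 T ?D" by (simp add: L2_has_derivative_def)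
  have cL: "?c h \<in> L2 0 T" "L2norm 0 T (?c h) \<le> L2norm 0 T h" if "h \<in> L2 0 T" for h :: "real \<Rightarrow> 'a \<times> 'c"
    using L2_indicator[OF that] by auto
  have "L2_has_derivative T (cost_functional P \<tau>) w (\<lambda>h. ?D (?c h))"
    unfolding L2_has_derivative_def
  proof (intro conjI allI impI)
    obtain k where k: "0 \<le> k" "\<And>f. f \<in> L2 0 T \<Longrightarrow> \<bar>?D f\<bar> \<le> k * L2norm 0 T f"
      using L2_functionalD(4)[OF fD] by auto
    show "L2_functional 0 T (\<lambda>h. ?D (?c h))"
      unfolding L2_functional_def
    proof (intro conjI ballI allI)
      fix f g :: "real \<Rightarrow> 'a \<times> 'c" and r :: real assume f: "f \<in> L2 0 T"
      show "?D (?c (\<lambda>r. f r + g r)) = ?D (?c f) + ?D (?c g)" if g: "g \<in> L2 0 T"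
        using L2_functionalD(1)[OF fD cL(1)[OF f] cL(1)[OF g]] by (simp add: scaleR_right_distrib)
      show "?D (?c (\<lambda>s. r *\<^sub>R f s)) = r * ?D (?c f)"
        using L2_functionalD(2)[OF fD cL(1)[OF f], of r] by (simp add: mult.commute)
    next
      have "\<bar>?D (?c f)\<bar> \<le> k * L2norm 0 T f" if "f \<in> L2 0 T" for f
        by (rule order_trans[OF k(2)[OF cL(1)[OF that]] mult_left_mono[OF cL(2)[OF that] k(1)]])
      then show "\<exists>K. \<forall>f\<in>L2 0 T. \<bar>?D (?c f)\<bar> \<le> K * L2norm 0 T f" by blast
    qed
    fix \<epsilon> :: real assume e: "0 < \<epsilon>"
    then obtain \<delta> where d: "0 < \<delta>" "\<And>h. h \<in> L2 0 T \<Longrightarrow> L2norm 0 T h < \<delta> \<Longrightarrow>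
        \<bar>cost_functional P T (\<lambda>s. w s + h s) - cost_functional P T w - ?D h\<bar> \<le> \<epsilon> * L2norm 0 T h"
      using D unfolding L2_has_derivative_def by blast
    have "\<bar>cost_functional P \<tau> (\<lambda>s. w s + h s) - cost_functional P \<tau> w - ?D (?c h)\<bar> \<le> \<epsilon> * L2norm 0 T h"
      if h: "h \<in> L2 0 T" and s: "L2norm 0 T h < \<delta>" for h
    proof -
      have "\<bar>cost_functional P T (\<lambda>s. w s + ?c h s) - cost_functional P T w - ?D (?c h)\<bar> \<le> \<epsilon> * L2norm 0 T (?c h)"
        by (rule d(2)[OF cL(1)[OF h] le_less_trans[OF cL(2)[OF h] s]])
      also have "\<dots> \<le> \<epsilon> * L2norm 0 T h" using e cL(2)[OF h] by simp
      finally show ?thesis using cost_functional_truncate[OF reg w h \<tau>] by simp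
    qed
    then show "\<exists>\<delta>>0. \<forall>h\<in>L2 0 T. L2norm 0 T h < \<delta> \<longrightarrow>
        \<bar>cost_functional P \<tau> (\<lambda>s. w s + h s) - cost_functional P \<tau> w - ?D (?c h)\<bar> \<le> \<epsilon> * L2norm 0 T h"
      using d(1) by blast
  qed
  from L2_deriv_eq[OF this h] show ?thesis .
qed

section \<open>Representatives of the first derivatives\<close>

text \<open>If a multiplication operator on \<open>L\<^sub>2\<close> has norm at most \<open>K\<close>, then applying it to a constant vector \<open>w\<close>
supported on the set where \<open>\<parallel>G(s) w\<parallel> > \<bar>K\<bar> \<parallel>w\<parallel>\<close> shows that this set is null.  A countable dense set
of vectors gives one null set for all \<open>w\<close>.\<close>

lemma multiplier_norm_bound:
  fixes G :: "real \<Rightarrow> 'v::{real_normed_vector,second_countable_topology} \<Rightarrow>\<^sub>L 'f::real_normed_vector"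
  assumes op: "L2_operator a b K (\<lambda>v s. blinfun_apply (G s) (v s))"
  shows "AE s in lebesgue_on {a..b}. norm (G s) \<le> \<bar>K\<bar>"
proof -
  let ?M = "lebesgue_on {a..b}"
  have image: "(\<lambda>s. blinfun_apply (G s) (v s)) \<in> L2 a b"
    "L2norm a b (\<lambda>s. blinfun_apply (G s) (v s)) \<le> K * L2norm a b v" if "v \<in> L2 a b" for v
    using op that by (auto simp: L2_operator_def)
  obtain D :: "'v set" where D: "countable D" "\<And>X. open X \<Longrightarrow> X \<noteq> {} \<Longrightarrow> \<exists>d\<in>D. d \<in> X"
    using countable_dense_setE by blast
  have dense: "x \<in> closure D" for x
    using D(2) unfolding closure_iff_nhds_not_empty by (metis disjoint_iff empty_iff subsetD)
  have pointwise: "AE s in ?M. norm (blinfun_apply (G s) w) \<le> \<bar>K\<bar> * norm w" for w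
  proof -
    have [measurable]: "(\<lambda>s. norm (blinfun_apply (G s) w)) \<in> borel_measurable ?M"
      by (rule L2_norm_measurable[OF image(1)[OF L2_const]])
    define E where "E = {s \<in> space ?M. \<bar>K\<bar> * norm w < norm (blinfun_apply (G s) w)}"
    have [measurable]: "E \<in> sets ?M" unfolding E_def by measurable
    have v: "(\<lambda>s. indicator E s *\<^sub>R w) \<in> L2 a b"
      by (rule L2_weight(1)[OF _ L2_const, of _ _ _ 1]) auto
    have "(L2norm a b (\<lambda>s. blinfun_apply (G s) (indicator E s *\<^sub>R w)))\<^sup>2 \<le> (\<bar>K\<bar> * L2norm a b (\<lambda>s. indicator E s *\<^sub>R w))\<^sup>2"
      using image(2)[OF v] by (intro power_mono order_trans[OF image(2)[OF v] mult_right_mono]) auto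
    then have le: "(LINT s|?M. (norm (blinfun_apply (G s) (indicator E s *\<^sub>R w)))\<^sup>2) \<le> K\<^sup>2 * (LINT s|?M. (norm (indicator E s *\<^sub>R w))\<^sup>2)"
      by (simp add: power_mult_distrib L2norm_power2)
    let ?f = "\<lambda>s. (norm (blinfun_apply (G s) (indicator E s *\<^sub>R w)))\<^sup>2 - K\<^sup>2 * (norm (indicator E s *\<^sub>R w))\<^sup>2"
    have i: "integrable ?M ?f"
      using L2_integrable_norm2[OF image(1)[OF v]] L2_integrable_norm2[OF v] by simp
    have f: "?f s = indicator E s * ((norm (blinfun_apply (G s) w))\<^sup>2 - (\<bar>K\<bar> * norm w)\<^sup>2)" for s
      by (simp add: indicator_def power_mult_distrib)
    have pos: "0 < (norm (blinfun_apply (G s) w))\<^sup>2 - (\<bar>K\<bar> * norm w)\<^sup>2" if "s \<in> E" for s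
    proof -
      have "(\<bar>K\<bar> * norm w)\<^sup>2 < (norm (blinfun_apply (G s) w))\<^sup>2"
        using that by (intro power_strict_mono) (auto simp: E_def)
      then show ?thesis by (simp only: diff_gt_0_iff_gt)
    qed
    have nn: "0 \<le> ?f s" for s
      unfolding f by (cases "s \<in> E", rule mult_nonneg_nonneg[OF _ less_imp_le[OF pos]]) simp_all
    have "(LINT s|?M. ?f s) \<le> 0"
      using le L2_integrable_norm2[OF image(1)[OF v]] L2_integrable_norm2[OF v] by simp
    then have "(LINT s|?M. ?f s) = 0"
      using integral_nonneg_AE[of ?f ?M] nn by (intro antisym) auto
    then have "AE s in ?M. ?f s = 0"
      using integral_nonneg_eq_0_iff_AE[OF i] nn by auto
    then show ?thesis
      using AE_space
    proof eventually_elim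
      case (elim s)
      have "s \<notin> E"
      proof
        assume s: "s \<in> E"
        have "0 < ?f s" unfolding f using mult_pos_pos[OF zero_less_one pos[OF s]] s by (simp only: indicator_simps)
        then show False using elim by (simp only: less_irrefl)
      qed
      then show ?case using elim by (auto simp: E_def)
    qed
  qed
  then have "AE s in ?M. \<forall>w\<in>D. norm (blinfun_apply (G s) w) \<le> \<bar>K\<bar> * norm w"
    by (simp add: AE_ball_countable[OF D(1)])
  then show ?thesis
  proof eventually_elim
    case (elim s)
    have "norm (blinfun_apply (G s) w) - \<bar>K\<bar> * norm w \<le> 0" for w
      by (rule continuous_le_on_closure[OF _ dense])
         (use elim in \<open>auto intro!: continuous_intros\<close>)
    then show ?case by (intro norm_blinfun_bound) (auto simp: algebra_simps)
  qed
qed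

definition blinfun_transpose ::
  "('v::real_normed_vector \<Rightarrow>\<^sub>L ('w::real_normed_vector \<Rightarrow>\<^sub>L 'f::real_normed_vector)) \<Rightarrow> 'w \<Rightarrow> 'v \<Rightarrow>\<^sub>L 'f" where
  "blinfun_transpose F y = bounded_bilinear.prod_left blinfun_apply y o\<^sub>L F"

lemma blinfun_transpose_apply [simp]: "blinfun_apply (blinfun_transpose F y) w = blinfun_apply (blinfun_apply F w) y"
  by (simp add: blinfun_transpose_def bounded_bilinear.prod_left.rep_eq[OF bounded_bilinear_blinfun_apply])

lemma norm_blinfun_transpose: "norm (blinfun_transpose F y) \<le> norm F * norm y"
proof (rule norm_blinfun_bound)
  fix w
  have "norm (blinfun_apply (blinfun_apply F w) y) \<le> (norm F * norm w) * norm y"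
    by (rule order_trans[OF norm_blinfun mult_right_mono[OF norm_blinfun]]) simp
  then show "norm (blinfun_apply (blinfun_transpose F y) w) \<le> norm F * norm y * norm w" by (simp add: mult_ac)
qed simp

lemma continuous_on_blinfun_transpose:
  assumes "continuous_on S F" "continuous_on S y"
  shows "continuous_on S (\<lambda>s. blinfun_transpose (F s) (y s))"
  unfolding blinfun_transpose_def
  by (intro bounded_bilinear.continuous_on[OF bounded_bilinear_blinfun_compose] assms
      bounded_linear.continuous_on[OF bounded_bilinear.bounded_linear_prod_left[OF bounded_bilinear_blinfun_apply]])

text \<open>The adjoint equation expresses \<open>J\<^sub>x\<close> as \<open>\<lambda>' + A'(x)\<^sup>*\<lambda>\<close>.  The first summand is in \<open>L\<^sub>2(0,T;V\<^sup>*)\<close> because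
\<open>\<lambda> \<in> W\<close>.  The second one is the pointwise transpose of \<open>A'(x(s))\<close> applied to \<open>\<lambda>(s)\<close>; it is strongly
measurable because it depends continuously on \<open>(x(s), \<lambda>(s))\<close>, and square integrable because the
multiplier \<open>A'(x(s))\<close> is essentially bounded.\<close>

lemma adjoint_state_represents_I_x:
  fixes P :: "('v::{banach,second_countable_topology}, 'h::{real_inner,banach}, 'u::{real_inner,banach}) ocp"
  assumes drift: "C2_frechet (drift P)" and x: "x \<in> L2 0 T" and adj: "adjoint_state P T x u lam"
    and A: "L2_operator 0 T K (A_lin P x)"
  shows "\<exists>g\<in>L2 0 T. \<forall>v\<in>L2 0 T. I_x P T T x u v = pairing 0 T g v"
proof -
  have lW: "lam \<in> W (emb P) 0 T" using adj by (simp add: adjoint_state_def)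
  then have l: "lam \<in> L2 0 T" by (simp add: W_def)
  let ?M = "lebesgue_on {0..T}"
  define G where "G s = fderiv (drift P) (x s)" for s
  have bound: "AE s in ?M. norm (G s) \<le> \<bar>K\<bar>"
  proof (rule multiplier_norm_bound)
    show "L2_operator 0 T K (\<lambda>v s. blinfun_apply (G s) (v s))"
      using A by (simp add: A_lin_def[abs_def] G_def)
  qed
  define a where "a s = blinfun_transpose (G s) (lam s)" for s
  have cont: "continuous_on UNIV (fderiv (drift P))"
    using drift unfolding C2_frechet_def
    by (auto intro!: continuous_at_imp_continuous_on differentiable_imp_continuous_within)
  have "strongly_measurable ?M a"
    unfolding a_def G_def
    by (rule strongly_measurable_compose2[OF complete_lebesgue_on _ L2_strongly_measurable[OF x] L2_strongly_measurable[OF l]])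
       (intro continuous_on_blinfun_transpose continuous_on_compose2[OF cont] continuous_intros, auto)
  moreover have "integrable ?M (\<lambda>s. K\<^sup>2 * (norm (lam s))\<^sup>2)" using L2_integrable_norm2[OF l] by simp
  moreover have "AE s in ?M. (norm (a s))\<^sup>2 \<le> K\<^sup>2 * (norm (lam s))\<^sup>2"
    using bound
  proof eventually_elim
    case (elim s)
    have "norm (a s) \<le> \<bar>K\<bar> * norm (lam s)"
      unfolding a_def using elim by (intro order_trans[OF norm_blinfun_transpose] mult_right_mono) auto
    from power_mono[OF this, of 2] show ?case by (simp add: power_mult_distrib)
  qed
  ultimately have aL: "a \<in> L2 0 T" by (rule L2I_bound)
  note wL = weak_deriv_in(1)[OF lW]
  show ?thesis
  proof (intro bexI[of _ "\<lambda>s. weak_deriv (emb P) 0 T lam s + a s"] ballI)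
    fix v :: "real \<Rightarrow> 'v" assume v: "v \<in> L2 0 T"
    have "I_x P T T x u v = pairing 0 T (weak_deriv (emb P) 0 T lam) v + pairing 0 T (A_lin P x v) lam"
      using adj v unfolding adjoint_state_def by fastforce
    also have "pairing 0 T (A_lin P x v) lam = pairing 0 T a v"
      by (simp add: pairing_def A_lin_def a_def G_def)
    also have "pairing 0 T (weak_deriv (emb P) 0 T lam) v + pairing 0 T a v
        = pairing 0 T (\<lambda>s. weak_deriv (emb P) 0 T lam s + a s) v"
      unfolding pairing_def using L2_pairing(1)[OF wL v] L2_pairing(1)[OF aL v]
      by (simp add: blinfun.add_left)
    finally show "I_x P T T x u v = pairing 0 T (\<lambda>s. weak_deriv (emb P) 0 T lam s + a s) v" .
  qed (rule L2_add[OF wL aL])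
qed

lemma dual_repr_spec:
  assumes "\<exists>g\<in>L2 0 T. \<forall>v\<in>L2 0 T. l v = pairing 0 T g v"
  shows "dual_repr T l \<in> L2 0 T" "v \<in> L2 0 T \<Longrightarrow> l v = pairing 0 T (dual_repr T l) v"
  using assms someI_ex[of "\<lambda>g. g \<in> L2 0 T \<and> (\<forall>v\<in>L2 0 T. l v = (LINT s|lebesgue_on {0..T}. blinfun_apply (g s) (v s)))"]
  by (auto simp: dual_repr_def pairing_def)

lemma L2_functional_inner:
  fixes f :: "real \<Rightarrow> 'u::real_inner"
  assumes f: "f \<in> L2 a b"
  shows "L2_functional a b (\<lambda>g. LINT s|lebesgue_on {a..b}. inner (f s) (g s))"
  unfolding L2_functional_def
  using L2_inner[OF f] by (auto simp: inner_add_right)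

text \<open>Riesz representation is the Lax-Milgram theorem for the inner product of \<open>L\<^sub>2(0,T;U)\<close> itself.\<close>

lemma hilbert_repr_spec:
  fixes l :: "(real \<Rightarrow> 'u::{real_inner,banach}) \<Rightarrow> real"
  assumes l: "L2_functional 0 T l"
  shows "hilbert_repr T l \<in> L2 0 T"
    and "p \<in> L2 0 T \<Longrightarrow> l p = (LINT s|lebesgue_on {0..T}. inner (hilbert_repr T l s) (p s))"
proof -
  let ?B = "\<lambda>f g :: real \<Rightarrow> 'u. LINT s|lebesgue_on {0..T}. inner (f s) (g s)"
  have B: "L2_bilinear_form 0 T ?B"
    unfolding L2_bilinear_form_def
  proof (intro conjI ballI)
    fix f :: "real \<Rightarrow> 'u" assume f: "f \<in> L2 0 T"
    show "L2_functional 0 T (?B f)" by (rule L2_functional_inner[OF f])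
    then show "L2_functional 0 T (\<lambda>g. ?B g f)" by (simp add: inner_commute)
  next
    show "\<exists>K. \<forall>f\<in>L2 0 T. \<forall>g\<in>L2 0 T. \<bar>?B f g\<bar> \<le> K * L2norm 0 T f * L2norm 0 T g"
      using L2_inner(2) by (intro exI[of _ 1]) auto
  qed
  have "\<exists>q\<in>L2 0 T. \<forall>p\<in>L2 0 T. ?B q p = l p"
    by (rule L2_Lax_Milgram[OF B _ zero_less_one _ l])
       (auto simp: inner_commute L2norm_power2 power2_norm_eq_inner)
  then obtain q where q: "q \<in> L2 0 T" "\<forall>p\<in>L2 0 T. ?B q p = l p" by blast
  have "\<exists>g. g \<in> L2 0 T \<and> (\<forall>p\<in>L2 0 T. l p = ?B g p)"
    using q by (intro exI[of _ q]) simp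
  from someI_ex[OF this] show "hilbert_repr T l \<in> L2 0 T"
    and "p \<in> L2 0 T \<Longrightarrow> l p = ?B (hilbert_repr T l) p"
    unfolding hilbert_repr_def by blast+
qed

lemma pr_add: "pr (\<lambda>s. f s + g s) (\<lambda>_. 0 :: 'u::real_vector) = (\<lambda>s. pr f (\<lambda>_. 0) s + pr g (\<lambda>_. 0) s)"
  "pr (\<lambda>_. 0 :: 'v::real_vector) (\<lambda>s. p s + q s) = (\<lambda>s. pr (\<lambda>_. 0) p s + pr (\<lambda>_. 0) q s)"
  by (auto simp: pr_def)

lemma pr_scaleR: "pr (\<lambda>s. c s *\<^sub>R f s) (\<lambda>_. 0 :: 'u::real_vector) = (\<lambda>s. c s *\<^sub>R pr f (\<lambda>_. 0) s)"
  "pr (\<lambda>_. 0 :: 'v::real_vector) (\<lambda>s. c s *\<^sub>R p s) = (\<lambda>s. c s *\<^sub>R pr (\<lambda>_. 0) p s)"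
  by (auto simp: pr_def)

lemma L2_functional_pr:
  fixes l :: "(real \<Rightarrow> 'v::real_normed_vector \<times> 'u::real_normed_vector) \<Rightarrow> real"
  assumes l: "L2_functional a b l"
  shows "L2_functional a b (\<lambda>p. l (pr (\<lambda>_. 0) p))"
proof -
  obtain K where "\<forall>f\<in>L2 a b. \<bar>l f\<bar> \<le> K * L2norm a b f" using l unfolding L2_functional_def by blast
  then have "\<bar>l (pr (\<lambda>_. 0) p)\<bar> \<le> K * L2norm a b p" if "p \<in> L2 a b" for p
    using pr_L2[OF L2_zero that] by fastforce
  then have bound: "\<exists>K. \<forall>p\<in>L2 a b. \<bar>l (pr (\<lambda>_. 0) p)\<bar> \<le> K * L2norm a b p" by blast
  show ?thesis
    unfolding L2_functional_def pr_add pr_scaleR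
    by (intro conjI ballI allI bound L2_functionalD(1,2)[OF l] pr_L2[OF L2_zero])
qed

section \<open>Time grids and the weighted operators\<close>

lemma time_grid_mono:
  assumes "time_grid t M T" "i \<le> k" "k \<le> M"
  shows "t i \<le> t k"
  using assms(2,3)
proof (induction k rule: dec_induct)
  case (step k)
  then have "t k < t (Suc k)" using assms(1) by (simp add: time_grid_def)
  then show ?case using step by simp
qed simp

text \<open>The two intervals share only the point \<open>b\<close>, which is a null set.\<close>

lemma integral_split:
  fixes f :: "real \<Rightarrow> real"
  assumes f: "integrable (lebesgue_on {a..c}) f" and "a \<le> b" "b \<le> c"
  shows "(LINT s|lebesgue_on {a..c}. f s) = (LINT s|lebesgue_on {a..b}. f s) + (LINT s|lebesgue_on {b..c}. f s)"
proof -
  let ?M = "lebesgue_on {a..c}"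
  have sub: "{a..b} \<subseteq> {a..c}" "{b..c} \<subseteq> {a..c}" using assms by auto
  note [measurable] = borel_measurable_integrable[OF f]
  have i: "integrable ?M (\<lambda>s. indicator A s *\<^sub>R f s)" if "A \<in> sets borel" for A
  proof (rule Bochner_Integration.integrable_bound[OF f])
    show "(\<lambda>s. indicator A s *\<^sub>R f s) \<in> borel_measurable ?M"
      using that by (intro borel_measurable_scaleR measurable_lebesgue_onI[of "indicator A"]) auto
  qed (auto simp: indicator_def)
  have "(LINT s|?M. f s) = (LINT s|?M. indicator {a..b} s *\<^sub>R f s + indicator {b..c} s *\<^sub>R f s)"
  proof (rule integral_cong_AE)
    show "AE s in ?M. f s = indicator {a..b} s *\<^sub>R f s + indicator {b..c} s *\<^sub>R f s"
      using AE_lebesgue_on_noteq[where a=a and b=c and c=b] AE_space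
      by eventually_elim (auto simp: indicator_def)
  qed (use i[of "{a..b}"] i[of "{b..c}"] in \<open>auto intro!: borel_measurable_add\<close>)
  also have "\<dots> = (LINT s|?M. indicator {a..b} s *\<^sub>R f s) + (LINT s|?M. indicator {b..c} s *\<^sub>R f s)"
    by (rule Bochner_Integration.integral_add[OF i i]) simp_all
  finally show ?thesis
    using lebesgue_on_subinterval(2)[OF sub(1) f] lebesgue_on_subinterval(2)[OF sub(2) f] by simp
qed

lemma integral_sum_grid:
  fixes f :: "real \<Rightarrow> real"
  assumes grid: "time_grid t M T" and f: "integrable (lebesgue_on {0..T}) f"
  shows "(\<Sum>m=1..M. LINT s|lebesgue_on {t (m - 1)..t m}. f s) = (LINT s|lebesgue_on {0..T}. f s)"
proof -
  have t0: "t 0 = 0" "t M = T" using grid by (auto simp: time_grid_def)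
  have "(\<Sum>m=1..k. LINT s|lebesgue_on {t (m - 1)..t m}. f s) = (LINT s|lebesgue_on {0..t k}. f s)" if "k \<le> M" for k
    using that
  proof (induction k)
    case 0
    have "{0..t 0} \<in> null_sets lebesgue" using t0 by simp
    then show ?case using integral_eq_zero_null_sets[of "{0..t 0}" f] by simp
  next
    case (Suc k)
    have le: "0 \<le> t k" "t k \<le> t (Suc k)" "t (Suc k) \<le> T"
      using time_grid_mono[OF grid, of 0 k] time_grid_mono[OF grid, of k "Suc k"] time_grid_mono[OF grid, of "Suc k" M] Suc.prems t0 by auto
    have "integrable (lebesgue_on {0..t (Suc k)}) f"
      using le by (intro lebesgue_on_subinterval(1)[OF _ f]) auto
    from integral_split[OF this le(1,2)] show ?case using Suc by simp
  qed
  from this[of M] show ?thesis using t0 by simp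
qed

text \<open>The square of the norm is additive over the grid intervals, and the Euclidean norm of the vector of the
local norms is at most its sum.\<close>

lemma L2norm_le_WM_norm:
  assumes grid: "time_grid t M T" and v: "v \<in> WM j t M"
  shows "L2norm 0 T (fst v) \<le> WM_norm j t M v"
proof -
  have t0: "t 0 = 0" "t M = T" using grid by (auto simp: time_grid_def)
  have vL: "fst v \<in> L2 0 T" using v t0 by (simp add: WM_def)
  have "L2norm 0 T (fst v) = L2_set (\<lambda>m. L2norm (t (m - 1)) (t m) (fst v)) {1..M}"
    unfolding L2_set_def L2norm_power2 integral_sum_grid[OF grid L2_integrable_norm2[OF vL]]
    by (simp add: L2norm_def)
  also have "\<dots> \<le> (\<Sum>m=1..M. L2norm (t (m - 1)) (t m) (fst v))"
    by (rule L2_set_le_sum) simp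
  also have "\<dots> \<le> (\<Sum>m=1..M. W_norm j (t (m - 1)) (t m) (fst v) + norm (left_lim j t v (m - 1) - right_lim j t v (m - 1)))"
  proof (rule sum_mono)
    fix m
    have "L2norm (t (m - 1)) (t m) (fst v) \<le> W_norm j (t (m - 1)) (t m) (fst v)"
      unfolding W_norm_def by (rule real_sqrt_sum_squares_ge1)
    then show "L2norm (t (m - 1)) (t m) (fst v) \<le> W_norm j (t (m - 1)) (t m) (fst v)
        + norm (left_lim j t v (m - 1) - right_lim j t v (m - 1))"
      by (simp add: add_increasing2)
  qed
  finally show ?thesis unfolding WM_norm_def by (simp add: add_increasing2)
qed

lemma grid_interval:
  assumes "time_grid t M T" "m \<in> {1..M}"
  shows "t (m - 1) < t m" "{t (m - 1)..t m} \<subseteq> {0..T}"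
proof -
  have "m - 1 < M" "Suc (m - 1) = m" using assms(2) by auto
  then show "t (m - 1) < t m" using assms(1) unfolding time_grid_def by metis
  show "{t (m - 1)..t m} \<subseteq> {0..T}"
    using time_grid_mono[OF assms(1), of 0 "m - 1"] time_grid_mono[OF assms(1), of m M] assms
    by (auto simp: time_grid_def)
qed

lemma exp_weight_WM_in:
  fixes j :: "'v::{real_normed_vector,second_countable_topology} \<Rightarrow> 'h::real_inner"
  assumes "bounded_linear j" "v \<in> WM j t M"
  shows "exp_weight_WM \<mu> v \<in> WM j t M"
  using assms by (auto simp: WM_def exp_weight_WM_def exp_weight_L2 exp_weight_W(1))

lemma lims_exp_weight:
  assumes j: "bounded_linear j" and grid: "time_grid t M T"
  shows "m \<le> M \<Longrightarrow> left_lim j t (exp_weight_WM \<mu> v) m = exp (\<mu> * t m) *\<^sub>R left_lim j t v m"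
    and "m < M \<Longrightarrow> right_lim j t (exp_weight_WM \<mu> v) m = exp (\<mu> * t m) *\<^sub>R right_lim j t v m"
    and "m < M \<Longrightarrow> jump j t (exp_weight_WM \<mu> v) m = exp (\<mu> * t m) *\<^sub>R jump j t v m"
proof -
  show l: "left_lim j t (exp_weight_WM \<mu> v) m = exp (\<mu> * t m) *\<^sub>R left_lim j t v m" if "m \<le> M"
  proof (cases "m = 0")
    case True
    then show ?thesis using grid by (simp add: left_lim_def exp_weight_WM_def time_grid_def)
  next
    case False
    then have m: "m \<in> {1..M}" using that by simp
    show ?thesis
      using False H_value_exp_weight[OF j grid_interval(1)[OF grid m], of "t m"] grid_interval(1)[OF grid m]
      by (simp add: left_lim_def exp_weight_WM_def)
  qed
  show r: "right_lim j t (exp_weight_WM \<mu> v) m = exp (\<mu> * t m) *\<^sub>R right_lim j t v m" if "m < M"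
  proof -
    have lt: "t m < t (m + 1)" using grid that by (simp add: time_grid_def)
    show ?thesis
      using H_value_exp_weight[OF j lt, of "t m"] lt by (simp add: right_lim_def exp_weight_WM_def)
  qed
  show "jump j t (exp_weight_WM \<mu> v) m = exp (\<mu> * t m) *\<^sub>R jump j t v m" if "m < M"
    using l r that by (simp add: jump_def scaleR_right_diff_distrib)
qed

lemma pairing_exp_weight:
  "pairing a b (exp_weight \<mu> g) f = pairing a b g (exp_weight \<mu> f)"
  by (simp add: pairing_def exp_weight_def blinfun.scaleR_left blinfun.scaleR_right)

text \<open>The perturbations on the grid intervals add up to a single integral over \<open>[0,T]\<close>.\<close>

lemma weak_deriv_sum_exp_weight:
  fixes j :: "'v::{real_normed_vector,second_countable_topology} \<Rightarrow> 'h::real_inner"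
  assumes j: "bounded_linear j" and grid: "time_grid t M T" and v: "v \<in> WM j t M" and \<phi>: "\<phi> \<in> L2 0 T"
  shows "(\<Sum>m=1..M. pairing (t (m - 1)) (t m) (weak_deriv j (t (m - 1)) (t m) (exp_weight \<mu> (fst v))) \<phi>)
    = (\<Sum>m=1..M. pairing (t (m - 1)) (t m) (weak_deriv j (t (m - 1)) (t m) (fst v)) (exp_weight \<mu> \<phi>))
      + \<mu> * pairing 0 T (\<lambda>s. blinfun_apply (Vdual j) (exp_weight \<mu> (fst v) s)) \<phi>"
proof -
  have t0: "t 0 = 0" "t M = T" using grid by (auto simp: time_grid_def)
  have vL: "fst v \<in> L2 0 T" using v t0 by (simp add: WM_def)
  let ?V = "\<lambda>s. blinfun_apply (Vdual j) (exp_weight \<mu> (fst v) s)"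
  have V: "?V \<in> L2 0 T" by (rule blinfun_image_L2[OF exp_weight_L2[OF vL]])
  have "pairing (t (m - 1)) (t m) (weak_deriv j (t (m - 1)) (t m) (exp_weight \<mu> (fst v))) \<phi>
      = pairing (t (m - 1)) (t m) (weak_deriv j (t (m - 1)) (t m) (fst v)) (exp_weight \<mu> \<phi>)
        + \<mu> * pairing (t (m - 1)) (t m) ?V \<phi>" if m: "m \<in> {1..M}" for m
  proof -
    let ?a = "t (m - 1)" and ?b = "t m"
    have W: "fst v \<in> W j ?a ?b" using v m by (simp add: WM_def)
    note sub = grid_interval(2)[OF grid m]
    note \<phi>' = L2_subinterval(1)[OF sub \<phi>] and V' = L2_subinterval(1)[OF sub V]
    note g' = exp_weight_L2[OF weak_deriv_in(1)[OF W], of \<mu>]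
    note w' = weak_deriv_in(1)[OF exp_weight_W(1)[OF j W, of \<mu>]]
    note i = L2_pairing(1)[OF g' \<phi>'] L2_pairing(1)[OF V' \<phi>']
    have "pairing ?a ?b (weak_deriv j ?a ?b (exp_weight \<mu> (fst v))) \<phi>
        = (LINT s|lebesgue_on {?a..?b}. blinfun_apply (exp_weight \<mu> (weak_deriv j ?a ?b (fst v)) s) (\<phi> s) + \<mu> * blinfun_apply (?V s) (\<phi> s))"
      unfolding pairing_def
    proof (rule integral_cong_AE)
      show "AE s in lebesgue_on {?a..?b}. blinfun_apply (weak_deriv j ?a ?b (exp_weight \<mu> (fst v)) s) (\<phi> s)
          = blinfun_apply (exp_weight \<mu> (weak_deriv j ?a ?b (fst v)) s) (\<phi> s) + \<mu> * blinfun_apply (?V s) (\<phi> s)"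
        using exp_weight_W(2)[OF j W, of \<mu>]
        by eventually_elim (simp add: blinfun.add_left blinfun.scaleR_left)
      show "(\<lambda>s. blinfun_apply (weak_deriv j ?a ?b (exp_weight \<mu> (fst v)) s) (\<phi> s)) \<in> borel_measurable (lebesgue_on {?a..?b})"
        by (rule borel_measurable_integrable[OF L2_pairing(1)[OF w' \<phi>']])
      show "(\<lambda>s. blinfun_apply (exp_weight \<mu> (weak_deriv j ?a ?b (fst v)) s) (\<phi> s) + \<mu> * blinfun_apply (?V s) (\<phi> s)) \<in> borel_measurable (lebesgue_on {?a..?b})"
        using i by (intro borel_measurable_integrable) simp
    qed
    also have "\<dots> = pairing ?a ?b (exp_weight \<mu> (weak_deriv j ?a ?b (fst v))) \<phi> + \<mu> * pairing ?a ?b ?V \<phi>"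
      unfolding pairing_def using i by simp
    finally show ?thesis by (simp only: pairing_exp_weight)
  qed
  then have "(\<Sum>m=1..M. pairing (t (m - 1)) (t m) (weak_deriv j (t (m - 1)) (t m) (exp_weight \<mu> (fst v))) \<phi>)
      = (\<Sum>m=1..M. pairing (t (m - 1)) (t m) (weak_deriv j (t (m - 1)) (t m) (fst v)) (exp_weight \<mu> \<phi>))
        + \<mu> * (\<Sum>m=1..M. pairing (t (m - 1)) (t m) ?V \<phi>)"
    by (simp add: sum.distrib sum_distrib_left)
  also have "(\<Sum>m=1..M. pairing (t (m - 1)) (t m) ?V \<phi>) = pairing 0 T ?V \<phi>"
    unfolding pairing_def by (rule integral_sum_grid[OF grid L2_pairing(1)[OF V \<phi>]])
  finally show ?thesis .
qed

lemma A_lin_exp_weight: "A_lin P x (exp_weight \<mu> v) = exp_weight \<mu> (A_lin P x v)"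
  by (simp add: A_lin_def exp_weight_def blinfun.scaleR_right)

lemma B_op_exp_weight: "B_op P (exp_weight \<mu> q) = exp_weight \<mu> (B_op P q)"
  by (simp add: B_op_def exp_weight_def blinfun.scaleR_right)

text \<open>In each jump term both factors belong to the same grid point, so the scalar \<open>exp (\<mu> t\<^sub>m)\<close> can be moved from
one factor to the other; at \<open>t\<^sub>0 = 0\<close> it is 1, so the initial value is unchanged.  The sign of the
perturbation is that of the time derivative in the operator.\<close>

lemma Lam_exp_weight:
  assumes j: "bounded_linear (emb P)" and grid: "time_grid t M T"
    and v: "v \<in> WM (emb P) t M" and \<phi>: "\<phi> \<in> WM (emb P) t M"
  shows "Lam P x t M (exp_weight_WM \<mu> v) \<phi> = Lam P x t M v (exp_weight_WM \<mu> \<phi>)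
      + \<mu> * pairing 0 T (\<lambda>s. blinfun_apply (Vdual (emb P)) (exp_weight \<mu> (fst v) s)) (fst \<phi>)"
    and "Lam_minus P x t M (exp_weight_WM \<mu> v) \<phi> = Lam_minus P x t M v (exp_weight_WM \<mu> \<phi>)
      - \<mu> * pairing 0 T (\<lambda>s. blinfun_apply (Vdual (emb P)) (exp_weight \<mu> (fst v) s)) (fst \<phi>)"
proof -
  have t0: "t 0 = 0" "t M = T" using grid by (auto simp: time_grid_def)
  have \<phi>L: "fst \<phi> \<in> L2 0 T" using \<phi> t0 by (simp add: WM_def)
  note lims = lims_exp_weight[OF j grid]
  have fst_exp: "fst (exp_weight_WM \<mu> w) = exp_weight \<mu> (fst w)" for w :: "(real \<Rightarrow> 'a) \<times> 'b"
    by (simp add: exp_weight_WM_def)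
  have r: "(\<Sum>m=1..M. inner (jump (emb P) t (exp_weight_WM \<mu> v) (m - 1)) (right_lim (emb P) t \<phi> (m - 1)))
      = (\<Sum>m=1..M. inner (jump (emb P) t v (m - 1)) (right_lim (emb P) t (exp_weight_WM \<mu> \<phi>) (m - 1)))"
    by (intro sum.cong) (auto simp: lims)
  have l: "(\<Sum>m=1..M. inner (jump (emb P) t (exp_weight_WM \<mu> v) (m - 1)) (left_lim (emb P) t \<phi> (m - 1)))
      = (\<Sum>m=1..M. inner (jump (emb P) t v (m - 1)) (left_lim (emb P) t (exp_weight_WM \<mu> \<phi>) (m - 1)))"
    by (intro sum.cong) (auto simp: lims)
  show "Lam P x t M (exp_weight_WM \<mu> v) \<phi> = Lam P x t M v (exp_weight_WM \<mu> \<phi>)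
      + \<mu> * pairing 0 T (\<lambda>s. blinfun_apply (Vdual (emb P)) (exp_weight \<mu> (fst v) s)) (fst \<phi>)"
    unfolding Lam_def sum.distrib r fst_exp weak_deriv_sum_exp_weight[OF j grid v \<phi>L] A_lin_exp_weight pairing_exp_weight
    by (simp add: lims)
  show "Lam_minus P x t M (exp_weight_WM \<mu> v) \<phi> = Lam_minus P x t M v (exp_weight_WM \<mu> \<phi>)
      - \<mu> * pairing 0 T (\<lambda>s. blinfun_apply (Vdual (emb P)) (exp_weight \<mu> (fst v) s)) (fst \<phi>)"
    unfolding Lam_minus_def sum.distrib l fst_exp weak_deriv_sum_exp_weight[OF j grid v \<phi>L] A_lin_exp_weight pairing_exp_weight
    by (simp add: lims)
qed

section \<open>The weighted secondary variables\<close>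

lemma L2norm_truncate:
  fixes f :: "real \<Rightarrow> 'e::real_normed_vector"
  assumes f: "f \<in> L2 0 T" and \<tau>: "\<tau> \<le> T"
  shows "L2norm 0 T (\<lambda>s. indicator {0..\<tau>} s *\<^sub>R f s) = L2norm 0 \<tau> f"
proof -
  have sub: "{0..\<tau>} \<subseteq> {0..T}" using \<tau> by auto
  have "(LINT s|lebesgue_on {0..T}. (norm (indicator {0..\<tau>} s *\<^sub>R f s))\<^sup>2)
      = (LINT s|lebesgue_on {0..T}. indicator {0..\<tau>} s *\<^sub>R (norm (f s))\<^sup>2)"
    by (intro Bochner_Integration.integral_cong) (auto simp: indicator_def)
  then show ?thesis
    unfolding L2norm_def lebesgue_on_subinterval(2)[OF sub L2_integrable_norm2[OF f]] by simp
qed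

lemma L2norm_truncate_exp_weight:
  fixes f :: "real \<Rightarrow> 'e::real_normed_vector"
  assumes f: "f \<in> L2 0 T" and \<tau>: "\<tau> \<le> T" and \<mu>: "0 \<le> \<mu>"
  shows "(\<lambda>s. indicator {0..\<tau>} s *\<^sub>R exp_weight \<mu> f s) \<in> L2 0 T"
    and "L2norm 0 T (\<lambda>s. indicator {0..\<tau>} s *\<^sub>R exp_weight \<mu> f s) \<le> exp (\<mu> * \<tau>) * L2norm 0 \<tau> f"
proof -
  show "(\<lambda>s. indicator {0..\<tau>} s *\<^sub>R exp_weight \<mu> f s) \<in> L2 0 T"
    by (rule L2_indicator(1)[OF exp_weight_L2[OF f]]) simp
  have sub: "{0..\<tau>} \<subseteq> {0..T}" using \<tau> by auto
  have "L2norm 0 T (\<lambda>s. indicator {0..\<tau>} s *\<^sub>R exp_weight \<mu> f s) = L2norm 0 \<tau> (exp_weight \<mu> f)"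
    by (rule L2norm_truncate[OF exp_weight_L2[OF f] \<tau>])
  also have "\<dots> \<le> exp (\<mu> * \<tau>) * L2norm 0 \<tau> f"
    unfolding exp_weight_def
    by (rule L2_weight(2)[OF measurable_lebesgue_onI L2_subinterval(1)[OF sub f]])
       (use \<mu> in \<open>auto intro: mult_left_mono\<close>)
  finally show "L2norm 0 T (\<lambda>s. indicator {0..\<tau>} s *\<^sub>R exp_weight \<mu> f s) \<le> exp (\<mu> * \<tau>) * L2norm 0 \<tau> f" .
qed

lemma pairing_cong_AE:
  assumes "g \<in> L2 a b" "h \<in> L2 a b" "f \<in> L2 a b" "AE s in lebesgue_on {a..b}. g s = h s"
  shows "pairing a b g f = pairing a b h f"
  unfolding pairing_def
  using assms(4) borel_measurable_integrable[OF L2_pairing(1)[OF assms(1,3)]]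
    borel_measurable_integrable[OF L2_pairing(1)[OF assms(2,3)]]
  by (intro integral_cong_AE) (auto elim: eventually_mono)

lemma pairing_lin:
  assumes "g \<in> L2 a b" "h \<in> L2 a b" "f \<in> L2 a b"
  shows "pairing a b (\<lambda>s. g s + h s) f = pairing a b g f + pairing a b h f"
    and "pairing a b (\<lambda>s. g s - h s) f = pairing a b g f - pairing a b h f"
    and "pairing a b (\<lambda>s. c *\<^sub>R g s) f = c * pairing a b g f"
    and "pairing a b (\<lambda>s. - g s) f = - pairing a b g f"
  unfolding pairing_def using L2_pairing(1)[OF assms(1,3)] L2_pairing(1)[OF assms(2,3)]
  by (simp_all add: blinfun.add_left blinfun.diff_left blinfun.scaleR_left blinfun.minus_left)

text \<open>If the data vanish, the quotient in the supremum is infinite unless the solution vanishes, so a finite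
bound excludes a nontrivial kernel.\<close>

lemma Mk_inv_norm_bound:
  assumes N: "Mk_inv_norm P T x u lam t M \<le> ennreal N" "0 < N"
    and mem: "v \<in> WM (emb P) t M" "z \<in> WM (emb P) t M" "l1 \<in> L2 0 T" "l2 \<in> L2 0 T"
    and eq: "Mk_eq P T x u lam t M v z l1 zT l2 v0"
  shows "WM_norm (emb P) t M v + WM_norm (emb P) t M z
    \<le> N * ((L2norm 0 T l1 + norm zT) + (L2norm 0 T l2 + norm v0))"
proof -
  let ?a = "WM_norm (emb P) t M v + WM_norm (emb P) t M z"
    and ?b = "(L2norm 0 T l1 + norm zT) + (L2norm 0 T l2 + norm v0)"
  have b: "0 \<le> ?b" by simp
  have "ennreal ?a / ennreal ?b \<le> Mk_inv_norm P T x u lam t M"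
    unfolding Mk_inv_norm_def
    by (rule SUP_upper2[of "(v, z, l1, zT, l2, v0)"]) (use mem eq in auto)
  then have le: "ennreal ?a / ennreal ?b \<le> ennreal N" using N(1) by (rule order_trans)
  show ?thesis
  proof (cases "?b = 0")
    case True
    have "?a \<le> 0"
    proof (rule ccontr)
      assume "\<not> ?a \<le> 0"
      then have "ennreal ?a \<noteq> 0" by (simp add: ennreal_eq_0_iff)
      then have "ennreal ?a / ennreal ?b = \<infinity>" using True by (simp add: ennreal_divide_eq_top_iff)
      with le show False by (simp add: top_unique)
    qed
    then show ?thesis using True by simp
  next
    case False
    show ?thesis
    proof (cases "0 \<le> ?a")
      case True
      have "ennreal ?a / ennreal ?b = ennreal (?a / ?b)"
        using b False by (intro divide_ennreal True) linarith
      with le have "ennreal (?a / ?b) \<le> ennreal N" by metis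
      then have "?a / ?b \<le> N" using N(2) by (simp add: ennreal_le_iff)
      then show ?thesis using b False by (simp add: divide_le_eq)
    next
      case F: False
      then show ?thesis using mult_nonneg_nonneg[OF less_imp_le[OF N(2)] b] by linarith
    qed
  qed
qed

text \<open>The weight can be moved between the arguments: the cost contributes a local form, and the second
derivative of the drift in \<open>L\<^sub>x\<^sub>x\<close> is bilinear at every time.\<close>

lemma second_derivative_forms:
  fixes P :: "('v::{banach,second_countable_topology}, 'h::{real_inner,banach}, 'u::{real_inner,banach}) ocp"
  assumes reg: "ocp_regular P T" and xu: "pr x u \<in> L2 0 T"
  shows "L2_bilinear_form 0 T (J_uu P T x u)"
    and "q \<in> L2 0 T \<Longrightarrow> p \<in> L2 0 T \<Longrightarrow> J_uu P T x u (exp_weight \<mu> q) p = J_uu P T x u q (exp_weight \<mu> p)"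
    and "v \<in> L2 0 T \<Longrightarrow> w \<in> L2 0 T \<Longrightarrow> L_xx P T x u lam (exp_weight \<mu> v) w = L_xx P T x u lam v (exp_weight \<mu> w)"
proof -
  let ?B = "L2_deriv2 T (cost_functional P T) (pr x u)"
  have C2: "L2_C2 T (cost_functional P T)" using reg by (simp add: ocp_regular_def)
  have B: "L2_bilinear_form 0 T ?B"
    using L2_C2D(2)[OF C2 xu] by (simp add: L2_has_derivative2_def)
  obtain k where k: "\<forall>f\<in>L2 0 T. \<forall>g\<in>L2 0 T. \<bar>?B f g\<bar> \<le> k * L2norm 0 T f * L2norm 0 T g"
    using L2_bilinear_formD(3)[OF B] by auto
  show "L2_bilinear_form 0 T (J_uu P T x u)"
    unfolding L2_bilinear_form_def
  proof (intro conjI ballI)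
    fix q :: "real \<Rightarrow> 'u" assume q: "q \<in> L2 0 T"
    show "L2_functional 0 T (J_uu P T x u q)" "L2_functional 0 T (\<lambda>p. J_uu P T x u p q)"
      using L2_functional_pr[OF L2_bilinear_formD(1)[OF B pr_L2[OF L2_zero q]]]
        L2_functional_pr[OF L2_bilinear_formD(2)[OF B pr_L2[OF L2_zero q]]]
      by (simp_all add: J_uu_def[abs_def])
  next
    have "\<bar>J_uu P T x u q p\<bar> \<le> k * L2norm 0 T q * L2norm 0 T p" if "q \<in> L2 0 T" "p \<in> L2 0 T" for q p
      using k[rule_format, OF pr_L2[OF L2_zero that(1)] pr_L2[OF L2_zero that(2)]] by (simp add: J_uu_def)
    then show "\<exists>K. \<forall>f\<in>L2 0 T. \<forall>g\<in>L2 0 T. \<bar>J_uu P T x u f g\<bar> \<le> K * L2norm 0 T f * L2norm 0 T g" by blast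
  qed
  show "J_uu P T x u (exp_weight \<mu> q) p = J_uu P T x u q (exp_weight \<mu> p)" if "q \<in> L2 0 T" "p \<in> L2 0 T"
    using cost_deriv2_exp_weight[OF reg xu pr_L2[OF L2_zero that(1)] pr_L2[OF L2_zero that(2)], of \<mu>]
    by (simp add: J_uu_def exp_weight_pr)
  show "L_xx P T x u lam (exp_weight \<mu> v) w = L_xx P T x u lam v (exp_weight \<mu> w)" if "v \<in> L2 0 T" "w \<in> L2 0 T"
    using cost_deriv2_exp_weight[OF reg xu pr_L2[OF that(1) L2_zero] pr_L2[OF that(2) L2_zero], of \<mu>]
    by (simp add: L_xx_def J_xx_def exp_weight_pr pairing_def A_second_def)
       (simp add: exp_weight_def blinfun.scaleR_left blinfun.scaleR_right)
qed

text \<open>With \<open>g'\<close> and \<open>h'\<close> the truncated and weighted representatives of \<open>J\<^sub>x\<close> and \<open>J\<^sub>u\<close>, and \<open>r = J\<^sub>u\<^sub>u\<^sup>-\<^sup>1 h'\<close>, the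
weighted control is \<open>q' = J\<^sub>u\<^sub>u\<^sup>-\<^sup>1 B\<^sup>* z' - r\<close>.  Inserting it into the state equation gives the equation
for \<open>M\<^sup>k\<close> with \<open>l1 = - g' - \<mu> z'\<close> and \<open>l2 = \<mu> v' - B r\<close> and with vanishing initial and terminal data.
Here \<open>X\<close> bounds \<open>g'\<close>, \<open>Y\<close> bounds \<open>r\<close>, and \<open>V\<close>, \<open>Z\<close> are the norms to be estimated.\<close>

lemma weighted_secondary_variables_bound:
  fixes P :: "('v::{banach,second_countable_topology}, 'h::{real_inner,banach}, 'u::{real_inner,banach}) ocp"
    and C :: "(real \<Rightarrow> 'v) \<Rightarrow> real \<Rightarrow> 'y::banach"
  assumes j: "bounded_linear (emb P)" and drift: "C2_frechet (drift P)"
    and \<alpha>: "0 < \<alpha>" and \<mu>: "0 < \<mu>" and N: "0 < N" and \<tau>: "\<tau> \<le> T"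
    and reg: "ocp_regular P T" and opt: "optimal P T x u" and adj: "adjoint_state P T x u lam"
    and grid: "time_grid t M T" and S: "assumption_S P T x u lam C R K \<alpha>"
    and Mk: "Mk_inv_norm P T x u lam t M \<le> ennreal N"
    and sec: "secondary_solution P T \<tau> x u lam t M v q z"
  defines "V \<equiv> WM_norm (emb P) t M (exp_weight_WM \<mu> v)"
    and "Z \<equiv> WM_norm (emb P) t M (exp_weight_WM \<mu> z)"
    and "X \<equiv> exp (\<mu> * \<tau>) * L2norm 0 \<tau> (dual_repr T (I_x P T T x u))"
    and "Y \<equiv> exp (\<mu> * \<tau>) * L2norm 0 \<tau> (hilbert_repr T (I_u P T T x u)) / \<alpha>\<^sup>2"
  shows "V + Z \<le> N * (X + \<bar>K\<bar> * Y + \<mu> * norm (Vdual (emb P)) * (V + Z))"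
    and "L2norm 0 T (exp_weight \<mu> q) \<le> \<bar>K\<bar> / \<alpha>\<^sup>2 * Z + Y"
proof -
  have t0: "t 0 = 0" "t M = T" using grid by (auto simp: time_grid_def)
  have x: "x \<in> L2 0 T" and u: "u \<in> L2 0 T" using opt by (auto simp: optimal_def feasible_def W_def)
  note xu = pr_L2[OF x u]
  note J = second_derivative_forms[OF reg xu]
  have v: "v \<in> WM (emb P) t M" and q: "q \<in> L2 0 T" and z: "z \<in> WM (emb P) t M"
    and row1: "\<And>\<phi>. \<phi> \<in> WM (emb P) t M \<Longrightarrow> L_xx P T x u lam (fst v) (fst \<phi>) + Lam_minus P x t M z \<phi> = - I_x P T \<tau> x u (fst \<phi>)"
    and row2: "\<And>p. p \<in> L2 0 T \<Longrightarrow> J_uu P T x u q p - B_adj P T (fst z) p = - I_u P T \<tau> x u p"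
    and row3: "\<And>\<phi>. \<phi> \<in> WM (emb P) t M \<Longrightarrow> Lam P x t M v \<phi> - pairing 0 T (B_op P q) (fst \<phi>) = 0"
    using sec unfolding secondary_solution_def by auto
  have vL: "fst v \<in> L2 0 T" and zL: "fst z \<in> L2 0 T" using v z t0 by (auto simp: WM_def)
  have A: "L2_operator 0 T K (A_lin P x)" and Bop: "L2_operator 0 T K (B_op P)"
    and Rco: "\<And>p. p \<in> L2 0 T \<Longrightarrow> \<alpha> * L2norm 0 T p \<le> L2norm 0 T (R p)"
    and Juu: "\<And>p r. p \<in> L2 0 T \<Longrightarrow> r \<in> L2 0 T \<Longrightarrow> J_uu P T x u p r = (LINT s|lebesgue_on {0..T}. inner (R p s) (R r s))"
    using S unfolding assumption_S_def by auto
  have Bq: "B_op P p \<in> L2 0 T" "L2norm 0 T (B_op P p) \<le> \<bar>K\<bar> * L2norm 0 T p" if "p \<in> L2 0 T" for p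
  proof -
    show "B_op P p \<in> L2 0 T" using Bop that by (simp add: L2_operator_def)
    have "L2norm 0 T (B_op P p) \<le> K * L2norm 0 T p" using Bop that by (simp add: L2_operator_def)
    also have "\<dots> \<le> \<bar>K\<bar> * L2norm 0 T p" by (intro mult_right_mono) auto
    finally show "L2norm 0 T (B_op P p) \<le> \<bar>K\<bar> * L2norm 0 T p" .
  qed
  have coercive: "\<alpha>\<^sup>2 * (L2norm 0 T p)\<^sup>2 \<le> J_uu P T x u p p" if "p \<in> L2 0 T" for p
  proof -
    have "(\<alpha> * L2norm 0 T p)\<^sup>2 \<le> (L2norm 0 T (R p))\<^sup>2" using Rco[OF that] \<alpha> by (intro power_mono) auto
    then show ?thesis by (simp add: Juu[OF that that] L2norm_power2 power2_norm_eq_inner power_mult_distrib)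
  qed
  have small: "L2norm 0 T p \<le> c / \<alpha>\<^sup>2" if "p \<in> L2 0 T" "J_uu P T x u p p \<le> c * L2norm 0 T p" "0 \<le> c" for p c
  proof (cases "L2norm 0 T p = 0")
    case True
    then show ?thesis using that by simp
  next
    case False
    then have pos: "0 < L2norm 0 T p" using L2norm_nonneg[of 0 T p] by linarith
    have "(\<alpha>\<^sup>2 * L2norm 0 T p) * L2norm 0 T p \<le> c * L2norm 0 T p"
      using coercive[OF that(1)] that(2) by (simp add: power2_eq_square mult.assoc)
    then have "\<alpha>\<^sup>2 * L2norm 0 T p \<le> c" using pos by simp
    then show ?thesis using \<alpha> by (simp add: field_simps)
  qed
  define g where "g = dual_repr T (I_x P T T x u)"
  have g: "g \<in> L2 0 T" "\<And>w. w \<in> L2 0 T \<Longrightarrow> I_x P T T x u w = pairing 0 T g w"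
    using dual_repr_spec[OF adjoint_state_represents_I_x[OF drift x adj A]] by (auto simp: g_def)
  define h where "h = hilbert_repr T (I_u P T T x u)"
  have C2: "L2_C2 T (cost_functional P T)" using reg by (simp add: ocp_regular_def)
  have "L2_functional 0 T (I_u P T T x u)"
    unfolding I_u_def[abs_def]
    using L2_C2D(1)[OF C2 xu] by (intro L2_functional_pr) (simp add: L2_has_derivative_def)
  from hilbert_repr_spec[OF this] have h: "h \<in> L2 0 T"
    "\<And>p. p \<in> L2 0 T \<Longrightarrow> I_u P T T x u p = (LINT s|lebesgue_on {0..T}. inner (h s) (p s))" by (auto simp: h_def)
  define g' where "g' s = indicator {0..\<tau>} s *\<^sub>R exp_weight \<mu> g s" for s
  define h' where "h' s = indicator {0..\<tau>} s *\<^sub>R exp_weight \<mu> h s" for s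
  have g': "g' \<in> L2 0 T" "L2norm 0 T g' \<le> X"
    using L2norm_truncate_exp_weight[OF g(1) \<tau>, of \<mu>] \<mu> by (auto simp: g'_def[abs_def] X_def g_def)
  have h': "h' \<in> L2 0 T" "L2norm 0 T h' \<le> exp (\<mu> * \<tau>) * L2norm 0 \<tau> h"
    using L2norm_truncate_exp_weight[OF h(1) \<tau>, of \<mu>] \<mu> by (auto simp: h'_def[abs_def])
  have I_x: "I_x P T \<tau> x u (exp_weight \<mu> w) = pairing 0 T g' w" if w: "w \<in> L2 0 T" for w
  proof -
    have "I_x P T \<tau> x u (exp_weight \<mu> w) = I_x P T T x u (\<lambda>s. indicator {0..\<tau>} s *\<^sub>R exp_weight \<mu> w s)"
      using cost_deriv_truncate[OF reg xu pr_L2[OF exp_weight_L2[OF w] L2_zero] \<tau>]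
      by (simp add: I_x_def pr_scaleR)
    also have "\<dots> = pairing 0 T g (\<lambda>s. indicator {0..\<tau>} s *\<^sub>R exp_weight \<mu> w s)"
      by (intro g(2) L2_indicator(1) exp_weight_L2 w) simp
    also have "\<dots> = pairing 0 T g' w"
      by (simp add: pairing_def g'_def exp_weight_def blinfun.scaleR_left blinfun.scaleR_right)
    finally show ?thesis .
  qed
  have I_u: "I_u P T \<tau> x u (exp_weight \<mu> p) = (LINT s|lebesgue_on {0..T}. inner (h' s) (p s))" if p: "p \<in> L2 0 T" for p
  proof -
    have "I_u P T \<tau> x u (exp_weight \<mu> p) = I_u P T T x u (\<lambda>s. indicator {0..\<tau>} s *\<^sub>R exp_weight \<mu> p s)"
      using cost_deriv_truncate[OF reg xu pr_L2[OF L2_zero exp_weight_L2[OF p]] \<tau>]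
      by (simp add: I_u_def pr_scaleR)
    also have "\<dots> = (LINT s|lebesgue_on {0..T}. inner (h s) (indicator {0..\<tau>} s *\<^sub>R exp_weight \<mu> p s))"
      by (intro h(2) L2_indicator(1) exp_weight_L2 p) simp
    also have "\<dots> = (LINT s|lebesgue_on {0..T}. inner (h' s) (p s))"
      by (simp add: h'_def exp_weight_def)
    finally show ?thesis .
  qed
  obtain r where r: "r \<in> L2 0 T" "\<And>p. p \<in> L2 0 T \<Longrightarrow> J_uu P T x u r p = (LINT s|lebesgue_on {0..T}. inner (h' s) (p s))"
  proof -
    have "\<exists>r\<in>L2 0 T. \<forall>p\<in>L2 0 T. J_uu P T x u r p = (LINT s|lebesgue_on {0..T}. inner (h' s) (p s))"
    proof (rule L2_Lax_Milgram[OF J(1)])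
      show "J_uu P T x u f g = J_uu P T x u g f" if "f \<in> L2 0 T" "g \<in> L2 0 T" for f g
        using that by (simp add: Juu inner_commute)
      show "0 < \<alpha>\<^sup>2" using \<alpha> by simp
    qed (use coercive L2_functional_inner[OF h'(1)] in auto)
    then show ?thesis using that by blast
  qed
  have rY: "L2norm 0 T r \<le> Y"
  proof -
    have "J_uu P T x u r r \<le> L2norm 0 T h' * L2norm 0 T r"
      using r(2)[OF r(1)] L2_inner(2)[OF h'(1) r(1)] by simp
    then have "L2norm 0 T r \<le> L2norm 0 T h' / \<alpha>\<^sup>2" by (rule small[OF r(1)]) simp
    also have "\<dots> \<le> Y" unfolding Y_def h_def[symmetric] using h'(2) by (intro divide_right_mono) auto
    finally show ?thesis .
  qed
  define v' q' z' where "v' = exp_weight_WM \<mu> v" and "q' = exp_weight \<mu> q" and "z' = exp_weight_WM \<mu> z"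
  have v': "v' \<in> WM (emb P) t M" and z': "z' \<in> WM (emb P) t M"
    unfolding v'_def z'_def by (intro exp_weight_WM_in[OF j] v z)+
  have fst': "fst v' = exp_weight \<mu> (fst v)" "fst z' = exp_weight \<mu> (fst z)"
    by (simp_all add: v'_def z'_def exp_weight_WM_def)
  have v'L: "fst v' \<in> L2 0 T" and z'L: "fst z' \<in> L2 0 T" and q': "q' \<in> L2 0 T"
    unfolding fst' q'_def by (intro exp_weight_L2 vL zL q)+
  define p' where "p' s = q' s + r s" for s
  have p': "p' \<in> L2 0 T" unfolding p'_def by (rule L2_add[OF q' r(1)])
  have Jp': "J_uu P T x u p' p = B_adj P T (fst z') p" if p: "p \<in> L2 0 T" for p
  proof -
    have "J_uu P T x u p' p = J_uu P T x u q' p + J_uu P T x u r p"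
      unfolding p'_def by (rule L2_functionalD(1)[OF L2_bilinear_formD(2)[OF J(1) p] q' r(1)])
    also have "J_uu P T x u q' p = J_uu P T x u q (exp_weight \<mu> p)"
      unfolding q'_def by (rule J(2)[OF q p])
    also have "\<dots> = B_adj P T (fst z) (exp_weight \<mu> p) - J_uu P T x u r p"
      using row2[OF exp_weight_L2[OF p], of \<mu>] I_u[OF p] r(2)[OF p] by simp
    also have "B_adj P T (fst z) (exp_weight \<mu> p) = B_adj P T (fst z') p"
      by (simp add: B_adj_def B_op_exp_weight pairing_exp_weight fst')
    finally show ?thesis by simp
  qed
  have Z0: "L2norm 0 T (fst z') \<le> Z" and V0: "L2norm 0 T (fst v') \<le> V"
    using L2norm_le_WM_norm[OF grid z'] L2norm_le_WM_norm[OF grid v'] by (simp_all add: Z_def V_def v'_def z'_def)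
  have "J_uu P T x u p' p' \<le> \<bar>K\<bar> * L2norm 0 T (fst z') * L2norm 0 T p'"
  proof -
    have "B_adj P T (fst z') p' \<le> L2norm 0 T (B_op P p') * L2norm 0 T (fst z')"
      using L2_pairing(2)[OF Bq(1)[OF p'] z'L] by (simp add: B_adj_def)
    also have "\<dots> \<le> (\<bar>K\<bar> * L2norm 0 T p') * L2norm 0 T (fst z')"
      by (intro mult_right_mono Bq(2) p') simp
    finally show ?thesis using Jp'[OF p'] by (simp add: mult_ac)
  qed
  then have "L2norm 0 T p' \<le> \<bar>K\<bar> * L2norm 0 T (fst z') / \<alpha>\<^sup>2" by (rule small[OF p']) simp
  also have "\<dots> \<le> \<bar>K\<bar> / \<alpha>\<^sup>2 * Z"
    using Z0 \<alpha> by (simp add: divide_right_mono mult_left_mono)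
  finally have p'_le: "L2norm 0 T p' \<le> \<bar>K\<bar> / \<alpha>\<^sup>2 * Z" .
  have "L2norm 0 T q' \<le> L2norm 0 T p' + L2norm 0 T r"
    using L2norm_triangle_diff[OF p' r(1)] by (simp add: p'_def)
  then show "L2norm 0 T (exp_weight \<mu> q) \<le> \<bar>K\<bar> / \<alpha>\<^sup>2 * Z + Y"
    using p'_le rY by (simp add: q'_def)

  define k where "k = J_uu_inv P T x u (B_adj P T (fst z'))"
  have k: "k \<in> L2 0 T" "\<And>p. p \<in> L2 0 T \<Longrightarrow> J_uu P T x u k p = B_adj P T (fst z') p"
  proof -
    have "\<exists>q. q \<in> L2 0 T \<and> (\<forall>p\<in>L2 0 T. J_uu P T x u q p = B_adj P T (fst z') p)" using p' Jp' by blast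
    from someI_ex[OF this] show "k \<in> L2 0 T" "\<And>p. p \<in> L2 0 T \<Longrightarrow> J_uu P T x u k p = B_adj P T (fst z') p"
      unfolding k_def J_uu_inv_def by blast+
  qed
  \<comment> \<open>the chosen preimage \<open>k\<close> of \<open>B\<^sup>* z'\<close> under \<open>J\<^sub>u\<^sub>u\<close> is \<open>p' = q' + r\<close>, by coercivity\<close>
  have kp: "AE s in lebesgue_on {0..T}. k s = p' s"
  proof -
    let ?d = "\<lambda>s. k s - p' s"
    have d: "?d \<in> L2 0 T" by (rule L2_diff[OF k(1) p'])
    have "J_uu P T x u ?d ?d = 0"
      using L2_functionalD(3)[OF L2_bilinear_formD(2)[OF J(1) d] k(1) p'] k(2)[OF d] Jp'[OF d] by simp
    then have "L2norm 0 T ?d \<le> 0 / \<alpha>\<^sup>2" by (intro small[OF d]) auto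
    then have "L2norm 0 T ?d = 0" using L2norm_nonneg[of 0 T ?d] by simp
    then show ?thesis using L2norm_eq_0_iff[OF d] by auto
  qed
  let ?D = "\<lambda>w s. blinfun_apply (Vdual (emb P)) (w s)"
  have D: "?D w \<in> L2 0 T" "L2norm 0 T (?D w) \<le> norm (Vdual (emb P)) * L2norm 0 T w" if "w \<in> L2 0 T" for w
    using L2_linear_image[OF blinfun.bounded_linear_right that, of "norm (Vdual (emb P))" "Vdual (emb P)"] norm_blinfun
    by auto
  define l1 where "l1 s = - (g' s + \<mu> *\<^sub>R ?D (fst z') s)" for s
  define l2 where "l2 s = \<mu> *\<^sub>R ?D (fst v') s - B_op P r s" for s
  note gz = L2_add[OF g'(1) L2_scaleR[OF D(1)[OF z'L], of \<mu>]]
  have l1: "l1 \<in> L2 0 T" unfolding l1_def by (rule L2_uminus[OF gz])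
  have l2: "l2 \<in> L2 0 T" unfolding l2_def by (intro L2_diff L2_scaleR D(1) v'L Bq(1) r(1))
  have eq: "Mk_eq P T x u lam t M v' z' l1 0 l2 0"
    unfolding Mk_eq_def
  proof (intro conjI ballI)
    fix \<phi> assume \<phi>: "\<phi> \<in> WM (emb P) t M"
    have \<phi>L: "fst \<phi> \<in> L2 0 T" using \<phi> t0 by (simp add: WM_def)
    note \<phi>' = exp_weight_WM_in[OF j \<phi>, of \<mu>]
    have fst_exp: "fst (exp_weight_WM \<mu> \<phi>) = exp_weight \<mu> (fst \<phi>)" by (simp add: exp_weight_WM_def)
    have Lz: "Lam_minus P x t M z' \<phi> = Lam_minus P x t M z (exp_weight_WM \<mu> \<phi>)
        - \<mu> * pairing 0 T (?D (fst z')) (fst \<phi>)"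
      unfolding fst' unfolding z'_def by (rule Lam_exp_weight(2)[OF j grid z \<phi>])
    have Lv: "Lam P x t M v' \<phi> = Lam P x t M v (exp_weight_WM \<mu> \<phi>)
        + \<mu> * pairing 0 T (?D (fst v')) (fst \<phi>)"
      unfolding fst' unfolding v'_def by (rule Lam_exp_weight(1)[OF j grid v \<phi>])
    have "L_xx P T x u lam (fst v') (fst \<phi>) + Lam_minus P x t M z' \<phi>
        = - I_x P T \<tau> x u (exp_weight \<mu> (fst \<phi>)) - \<mu> * pairing 0 T (?D (fst z')) (fst \<phi>)"
      using row1[OF \<phi>'] unfolding fst_exp
      by (simp add: Lz J(3)[OF vL \<phi>L] fst')
    also have "\<dots> = pairing 0 T l1 (fst \<phi>)"
      unfolding l1_def[abs_def] I_x[OF \<phi>L] pairing_lin(4)[OF gz gz \<phi>L]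
        pairing_lin(1)[OF g'(1) L2_scaleR[OF D(1)[OF z'L]] \<phi>L] pairing_lin(3)[OF D(1)[OF z'L] D(1)[OF z'L] \<phi>L]
      by simp
    finally show "L_xx P T x u lam (fst v') (fst \<phi>) + Lam_minus P x t M z' \<phi>
        = pairing 0 T l1 (fst \<phi>) + inner 0 (left_lim (emb P) t \<phi> M)" by simp
    have "pairing 0 T (B_op P k) (fst \<phi>) = pairing 0 T (\<lambda>s. B_op P q' s + B_op P r s) (fst \<phi>)"
      using kp by (intro pairing_cong_AE Bq(1) k(1) \<phi>L L2_add q' r(1))
        (auto simp: B_op_def p'_def blinfun.add_right elim: eventually_mono)
    then have Bk: "pairing 0 T (B_op P k) (fst \<phi>) = pairing 0 T (B_op P q') (fst \<phi>) + pairing 0 T (B_op P r) (fst \<phi>)"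
      using pairing_lin(1)[OF Bq(1)[OF q'] Bq(1)[OF r(1)] \<phi>L] by simp
    have "Lam P x t M v' \<phi> = pairing 0 T (B_op P q') (fst \<phi>) + \<mu> * pairing 0 T (?D (fst v')) (fst \<phi>)"
      using row3[OF \<phi>'] unfolding fst_exp
      by (simp add: Lv q'_def B_op_exp_weight pairing_exp_weight)
    then show "Lam P x t M v' \<phi> - pairing 0 T (B_op P (J_uu_inv P T x u (B_adj P T (fst z')))) (fst \<phi>)
        = pairing 0 T l2 (fst \<phi>) + inner 0 (left_lim (emb P) t \<phi> 0)"
      unfolding k_def[symmetric] Bk l2_def[abs_def] pairing_lin(2)[OF L2_scaleR[OF D(1)[OF v'L]] Bq(1)[OF r(1)] \<phi>L]
        pairing_lin(3)[OF D(1)[OF v'L] D(1)[OF v'L] \<phi>L]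
      by simp
  qed
  let ?n = "norm (Vdual (emb P))"
  have D': "L2norm 0 T (\<lambda>s. \<mu> *\<^sub>R ?D w s) \<le> \<mu> * ?n * c" if "w \<in> L2 0 T" "L2norm 0 T w \<le> c" for w c
  proof -
    have "L2norm 0 T (\<lambda>s. \<mu> *\<^sub>R ?D w s) \<le> \<mu> * (?n * L2norm 0 T w)"
      unfolding L2norm_scaleR using \<mu> D(2)[OF that(1)] by simp
    also have "\<dots> \<le> \<mu> * (?n * c)" using \<mu> that(2) by (intro mult_left_mono) auto
    finally show ?thesis by (simp add: mult.assoc)
  qed
  have l1_le: "L2norm 0 T l1 \<le> X + \<mu> * ?n * Z"
  proof -
    have "L2norm 0 T l1 \<le> L2norm 0 T g' + L2norm 0 T (\<lambda>s. \<mu> *\<^sub>R ?D (fst z') s)"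
      unfolding l1_def[abs_def] L2norm_uminus by (rule L2norm_triangle[OF g'(1) L2_scaleR[OF D(1)[OF z'L]]])
    then show ?thesis using g'(2) D'[OF z'L Z0] by linarith
  qed
  have l2_le: "L2norm 0 T l2 \<le> \<mu> * ?n * V + \<bar>K\<bar> * Y"
  proof -
    have "L2norm 0 T l2 \<le> L2norm 0 T (\<lambda>s. \<mu> *\<^sub>R ?D (fst v') s) + L2norm 0 T (B_op P r)"
      unfolding l2_def[abs_def] by (rule L2norm_triangle_diff[OF L2_scaleR[OF D(1)[OF v'L]] Bq(1)[OF r(1)]])
    moreover have "\<bar>K\<bar> * L2norm 0 T r \<le> \<bar>K\<bar> * Y" using rY by (intro mult_left_mono) auto
    ultimately show ?thesis using D'[OF v'L V0] Bq(2)[OF r(1)] by linarith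
  qed
  have "V + Z \<le> N * ((L2norm 0 T l1 + norm (0::'h)) + (L2norm 0 T l2 + norm (0::'h)))"
    using Mk_inv_norm_bound[OF Mk N v' z' l1 l2 eq] by (simp add: V_def Z_def v'_def z'_def)
  also have "\<dots> \<le> N * (X + \<bar>K\<bar> * Y + \<mu> * ?n * (V + Z))"
    using N l1_le l2_le by (intro mult_left_mono) (auto simp: distrib_left)
  finally show "V + Z \<le> N * (X + \<bar>K\<bar> * Y + \<mu> * ?n * (V + Z))" .
qed

theorem theorem6:
  fixes P :: "('v::{banach,second_countable_topology}, 'h::{real_inner,banach}, 'u::{real_inner,banach}) ocp"
    and K \<alpha> \<tau> \<mu> N :: real
  assumes "gelfand_triple (emb P)" and "C2_frechet (drift P)"
    and "0 < \<alpha>" and "0 < \<tau>" and "0 < \<mu>"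
    and "\<mu> < 1 / N" and "\<mu> * norm (Vdual (emb P)) < 1 / N"
  shows "\<exists>c>0. \<forall>T x u lam t M (C :: (real \<Rightarrow> 'v) \<Rightarrow> real \<Rightarrow> 'y::banach) R v q z.
     \<tau> \<le> T \<longrightarrow>
     ocp_regular P T \<longrightarrow>
     optimal P T x u \<longrightarrow>
     adjoint_state P T x u lam \<longrightarrow>
     time_grid t M T \<longrightarrow>
     assumption_S P T x u lam C R K \<alpha> \<longrightarrow>
     Mk_inv_norm P T x u lam t M \<le> ennreal N \<longrightarrow>
     secondary_solution P T \<tau> x u lam t M v q z \<longrightarrow>
     WM_norm (emb P) t M (exp_weight_WM \<mu> v) + L2norm 0 T (exp_weight \<mu> q)
         + WM_norm (emb P) t M (exp_weight_WM \<mu> z)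
       \<le> c * (L2norm 0 \<tau> (dual_repr T (I_x P T T x u))
              + L2norm 0 \<tau> (hilbert_repr T (I_u P T T x u)))"
proof -
  have j: "bounded_linear (emb P)" using assms(1) by (simp add: gelfand_triple_def)
  have N: "0 < N"
  proof -
    have "0 < 1 / N" using assms(5,6) by linarith
    then show ?thesis by simp
  qed
  \<comment> \<open>the factor of the perturbation caused by the weight, which is absorbed\<close>
  define \<theta> where "\<theta> = N * (\<mu> * norm (Vdual (emb P)))"
  have \<theta>: "\<theta> < 1" using assms(7) N by (simp add: \<theta>_def field_simps)
  define a where "a = \<bar>K\<bar> / \<alpha>\<^sup>2"
  define e where "e = exp (\<mu> * \<tau>)"
  define D where "D = N / (1 - \<theta>)"
  define c where "c = (1 + a) * (D * e) * (1 + a) + e / \<alpha>\<^sup>2"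
  have pos: "0 \<le> a" "0 < e" "0 < D" using N \<theta> by (auto simp: a_def e_def D_def)
  have c: "0 < c" unfolding c_def using pos assms(3) by (intro add_nonneg_pos) auto
  show ?thesis
  proof (intro exI[of _ c] conjI allI impI c)
    fix T x u lam t M R v q z and C :: "(real \<Rightarrow> 'v) \<Rightarrow> real \<Rightarrow> 'y"
    assume H: "\<tau> \<le> T" "ocp_regular P T" "optimal P T x u" "adjoint_state P T x u lam" "time_grid t M T"
      "assumption_S P T x u lam C R K \<alpha>" "Mk_inv_norm P T x u lam t M \<le> ennreal N"
      "secondary_solution P T \<tau> x u lam t M v q z"
    define V Z Q where "V = WM_norm (emb P) t M (exp_weight_WM \<mu> v)"
      and "Z = WM_norm (emb P) t M (exp_weight_WM \<mu> z)" and "Q = L2norm 0 T (exp_weight \<mu> q)"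
    define G F where "G = L2norm 0 \<tau> (dual_repr T (I_x P T T x u))"
      and "F = L2norm 0 \<tau> (hilbert_repr T (I_u P T T x u))"
    note bound = weighted_secondary_variables_bound[OF j assms(2,3,5) N H, folded V_def Z_def Q_def G_def F_def e_def]
    have GF: "0 \<le> G" "0 \<le> F" by (auto simp: G_def F_def)
    have V: "0 \<le> V" unfolding V_def WM_norm_def W_norm_def by (intro add_nonneg_nonneg sum_nonneg) auto
    have Z: "0 \<le> Z" unfolding Z_def WM_norm_def W_norm_def by (intro add_nonneg_nonneg sum_nonneg) auto
    have "(1 - \<theta>) * (V + Z) \<le> N * (e * G + \<bar>K\<bar> * (e * F / \<alpha>\<^sup>2))"
      using bound(1) by (simp add: \<theta>_def algebra_simps)
    also have "\<dots> = N * e * (G + a * F)" by (simp add: a_def algebra_simps)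
    finally have VZ: "V + Z \<le> D * e * (G + a * F)"
      using \<theta> by (simp add: D_def pos_le_divide_eq mult.commute mult.left_commute)
    have "V + Q + Z \<le> (1 + a) * (V + Z) + e / \<alpha>\<^sup>2 * F"
      using bound(2) mult_nonneg_nonneg[OF pos(1) V] by (simp add: a_def[symmetric] algebra_simps)
    also have "\<dots> \<le> (1 + a) * (D * e * (G + a * F)) + e / \<alpha>\<^sup>2 * F"
      using VZ pos by (intro add_right_mono mult_left_mono) auto
    also have "\<dots> \<le> (1 + a) * (D * e * ((1 + a) * (G + F))) + e / \<alpha>\<^sup>2 * (G + F)"
    proof (intro add_mono mult_left_mono)
      have "0 \<le> a * G" using pos GF by simp
      then show "G + a * F \<le> (1 + a) * (G + F)" using GF by (simp add: algebra_simps)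
    qed (use pos GF in auto)
    also have "\<dots> = c * (G + F)" by (simp add: c_def algebra_simps)
    finally show "V + Q + Z \<le> c * (G + F)" .
  qed
qed

end
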